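(* Let $N\ge 3$ and $0<\gamma_2<\gamma_1=2$. Then there exists a constant $\tilde c_1>0$ depending only on $N$ such that $m(c)=0$ for any $0<c\le\tilde c_1$ and $m(c)=-\infty$ for any $c>\tilde c_1$. In addition, for any $0<c\le\tilde c_1$, there exists no solution to the problem $$-\Delta u+\lambda u=\left(|x|^{-\gamma_1}\ast|u|^2\right)u-\left(|x|^{-\gamma_2}\ast|u|^2\right)u\ \text{ in }\mathbb{R}^N,\qquad \int_{\mathbb{R}^N}|u|^2\,dx=c .$$
   Context: For $\gamma\in(0,N)$ and $u\in H^1(\mathbb{R}^N)$ write $D_\gamma(u):=\int_{\mathbb{R}^N}\int_{\mathbb{R}^N}\frac{|u(x)|^2|u(y)|^2}{|x-y|^{\gamma}}\,dx\,dy$. The energy is $E(u):=\frac12\int_{\mathbb{R}^N}|\nabla u|^2\,dx+\frac14 D_{\gamma_2}(u)-\frac14 D_{\gamma_1}(u)$. For $c>0$, $S(c):=\{u\in H^1(\mathbb{R}^N):\int_{\mathbb{R}^N}|u|^2\,dx=c\}$ and $m(c):=\inf_{u\in S(c)}E(u)$. A solution of the problem in the claim is a function $u\in S(c)$ for which there is some $\lambda\in\mathbb{R}$ (unknown, a Lagrange multiplier) such that the equation holds (in the weak sense). *)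

theory Defs
  imports "HOL-Analysis.Analysis"
begin

text \<open>
  Functions on \<open>\<real>\<^sup>N\<close> are Borel measurable representatives of their classes modulo null
  sets; every Lebesgue measurable class has one, so nothing is lost by integrating over
  \<^const>\<open>lborel\<close>.  The definitions allow values in any Euclidean space; the scalar fields
  are its instances \<^typ>\<open>real\<close> and \<^typ>\<open>complex\<close>.
\<close>

definition partial_deriv :: "'n::finite \<Rightarrow> (real ^ 'n \<Rightarrow> real) \<Rightarrow> real ^ 'n \<Rightarrow> real" where
  "partial_deriv i f x = frechet_derivative f (at x) (axis i 1)"

primrec C_k :: "nat \<Rightarrow> (real ^ 'n::finite \<Rightarrow> real) \<Rightarrow> bool" where
  "C_k 0 f \<longleftrightarrow> continuous_on UNIV f"
| "C_k (Suc k) f \<longleftrightarrow> (\<forall>x. f differentiable (at x)) \<and> (\<forall>i. C_k k (partial_deriv i f))"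

definition test_function :: "(real ^ 'n::finite \<Rightarrow> real) \<Rightarrow> bool" where
  "test_function \<phi> \<longleftrightarrow> (\<forall>k. C_k k \<phi>) \<and> compact (closure {x. \<phi> x \<noteq> 0})"

definition L2 :: "(real ^ 'n::finite \<Rightarrow> 'v::euclidean_space) set" where
  "L2 = {f. f \<in> borel_measurable borel \<and> integrable lborel (\<lambda>x. (norm (f x))\<^sup>2)}"

definition has_weak_grad ::
    "(real ^ 'n::finite \<Rightarrow> 'v::euclidean_space) \<Rightarrow> (real ^ 'n \<Rightarrow> 'v ^ 'n) \<Rightarrow> bool" where
  "has_weak_grad u G \<longleftrightarrow>
     (\<forall>\<phi> i. test_function \<phi> \<longrightarrow>
        (\<integral>x. partial_deriv i \<phi> x *\<^sub>R u x \<partial>lborel) = - (\<integral>x. \<phi> x *\<^sub>R (G x $ i) \<partial>lborel))"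

definition H1 :: "(real ^ 'n::finite \<Rightarrow> 'v::euclidean_space) set" where
  "H1 = {u \<in> L2. \<exists>G \<in> L2. has_weak_grad u G}"

text \<open>For \<open>u \<in> H1\<close> the weak gradient is unique up to null sets, and only integrals of it are
  used below, so the choice of representative is immaterial.\<close>

definition weak_grad ::
    "(real ^ 'n::finite \<Rightarrow> 'v::euclidean_space) \<Rightarrow> real ^ 'n \<Rightarrow> 'v ^ 'n" where
  "weak_grad u = (SOME G. G \<in> L2 \<and> has_weak_grad u G)"

text \<open>For \<open>u \<in> H1\<close>, \<open>N \<ge> 3\<close> and \<open>0 < \<gamma> \<le> 2\<close> the integrals in the next two definitions converge
  (by the Hardy inequality), so the value 0 that Bochner integration assigns to
  non-integrable functions plays no role there; the diagonal, where the kernel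
  evaluates to 0, is a null set.\<close>

definition D_gamma :: "real \<Rightarrow> (real ^ 'n::finite \<Rightarrow> 'v::euclidean_space) \<Rightarrow> real" where
  "D_gamma \<gamma> u = (\<integral>x. (\<integral>y. (norm (u x))\<^sup>2 * (norm (u y))\<^sup>2 / norm (x - y) powr \<gamma> \<partial>lborel) \<partial>lborel)"

definition hartree_potential ::
    "real \<Rightarrow> (real ^ 'n::finite \<Rightarrow> 'v::euclidean_space) \<Rightarrow> real ^ 'n \<Rightarrow> real" where
  "hartree_potential \<gamma> u x = (\<integral>y. norm (x - y) powr (- \<gamma>) * (norm (u y))\<^sup>2 \<partial>lborel)"

definition energy ::
    "real \<Rightarrow> real \<Rightarrow> (real ^ 'n::finite \<Rightarrow> 'v::euclidean_space) \<Rightarrow> real" where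
  "energy \<gamma>\<^sub>1 \<gamma>\<^sub>2 u =
     1/2 * (\<integral>x. (norm (weak_grad u x))\<^sup>2 \<partial>lborel) + 1/4 * D_gamma \<gamma>\<^sub>2 u - 1/4 * D_gamma \<gamma>\<^sub>1 u"

definition mass_sphere :: "real \<Rightarrow> (real ^ 'n::finite \<Rightarrow> 'v::euclidean_space) set" where
  "mass_sphere c = {u \<in> H1. (\<integral>x. (norm (u x))\<^sup>2 \<partial>lborel) = c}"

text \<open>The \<open>itself\<close> argument fixes the dimension and the scalars; the infimum is taken in the
  extended reals.\<close>

definition min_energy ::
    "(real ^ 'n::finite \<Rightarrow> 'v::euclidean_space) itself \<Rightarrow> real \<Rightarrow> real \<Rightarrow> real \<Rightarrow> ereal" where
  "min_energy _ \<gamma>\<^sub>1 \<gamma>\<^sub>2 c =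
     (INF u \<in> (mass_sphere c :: (real ^ 'n \<Rightarrow> 'v) set). ereal (energy \<gamma>\<^sub>1 \<gamma>\<^sub>2 u))"

text \<open>Real-valued test functions suffice: by linearity the identity then holds for test
  functions with complex values.\<close>

definition weak_solution ::
    "real \<Rightarrow> real \<Rightarrow> real \<Rightarrow> (real ^ 'n::finite \<Rightarrow> 'v::euclidean_space) \<Rightarrow> bool" where
  "weak_solution \<gamma>\<^sub>1 \<gamma>\<^sub>2 \<mu> u \<longleftrightarrow>
     u \<in> H1 \<and>
     (\<forall>\<phi>. test_function \<phi> \<longrightarrow>
        (\<integral>x. (\<Sum>i\<in>UNIV. partial_deriv i \<phi> x *\<^sub>R (weak_grad u x $ i)) \<partial>lborel)
          + \<mu> *\<^sub>R (\<integral>x. \<phi> x *\<^sub>R u x \<partial>lborel)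
        = (\<integral>x. \<phi> x *\<^sub>R (hartree_potential \<gamma>\<^sub>1 u x *\<^sub>R u x) \<partial>lborel)
          - (\<integral>x. \<phi> x *\<^sub>R (hartree_potential \<gamma>\<^sub>2 u x *\<^sub>R u x) \<partial>lborel))"

end

(*
  The critical mass is c_1 = inf 2 A(u) |u|^2 / D_2(u), where A(u) is the squared L^2 norm of the
  gradient and |u|^2 the mass; Hardy's inequality, applied around each point, makes it positive.
  For mass at most c_1 one has D_2 <= 2 A, so the energy is nonnegative; for larger mass some function
  has A/2 - D_2/4 < 0.  In both cases the mass-preserving dilations v(x) = t^(N/2) u(t x), which multiply
  A and D_2 by t^2 and D_g by t^g, yield the infimum, with t -> 0 and t -> infinity respectively.

  A solution satisfies the Pohozaev identity A = D_2/2 - (g_2/4) D_{g_2}, and D_{g_2} > 0 contradicts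
  D_2 <= 2 A.  The identity is obtained without regularity theory: with a compactly supported vector
  field X in place of the generator x of dilations, the equation is mollified and multiplied by
  X.grad v + (div X / 2) v.  This multiplier is antisymmetric, so the Lagrange multiplier drops out,
  no second derivative of the solution survives, and X can be let tend to x.
*)
theory Submission
  imports Defs "HOL-Real_Asymp.Real_Asymp"
begin

section \<open>Smooth functions\<close>

text \<open>The exponent 2 is critical in two ways. Under mass-preserving dilations
  \<open>D_gamma 2\<close> scales exactly like the kinetic energy, so only the ratio of the two
  decides the sign of the energy for large dilations. And |z|^(-2) is the Hardy weight: every kernel
  |z|^(-\<gamma>) with 0 < \<gamma> <= 2 lies below 1 + |z|^(-2), so the Hartree potentials of an
  H^1 function are bounded. The right side of the equation is then in L^2, which is why L^2
  convergence of the mollified solution, its gradient and its right side is enough to pass to the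
  limit. Values may lie in any Euclidean space. The components interact only through |u|^2, so the
  analysis is done for real functions and summed over an orthonormal basis, while the potential
  theory sees only the scalar density |u|^2. The critical mass is built from
  \<open>D_gamma 2\<close> alone and hence does not change with the second exponent. At the critical
  mass itself strictness is supplied by the defocusing term, not by the comparison of D_2 with A, so
  that endpoint belongs to the nonexistence range.\<close>

lemma partial_deriv_eq:
  "(f has_derivative D) (at x) \<Longrightarrow> partial_deriv i f x = D (axis i 1)"
  by (metis frechet_derivative_at partial_deriv_def)

lemma C_k_continuous: "C_k k f \<Longrightarrow> continuous_on UNIV f"
  by (cases k) (auto simp: continuous_on_eq_continuous_within intro!: differentiable_imp_continuous_within)

lemma C_k_Suc_imp: "C_k (Suc k) f \<Longrightarrow> C_k k f"
proof (induction k arbitrary: f)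
  case 0
  then show ?case using C_k_continuous[of "Suc 0" f] by simp
next
  case (Suc k)
  from Suc.prems have "(\<forall>x. f differentiable (at x)) \<and> (\<forall>i. C_k (Suc k) (partial_deriv i f))"
    by (subst (asm) C_k.simps(2))
  then have a: "\<forall>x. f differentiable (at x)" and b: "\<And>i. C_k (Suc k) (partial_deriv i f)"
    by blast+
  show ?case unfolding C_k.simps(2) using a b Suc.IH by blast
qed

definition smooth :: "(real ^ 'n::finite \<Rightarrow> real) \<Rightarrow> bool" where
  "smooth f \<longleftrightarrow> (\<forall>k. C_k k f)"

lemma smooth_differentiable: "smooth f \<Longrightarrow> f differentiable (at x)"
  using C_k.simps(2)[of 0 f] unfolding smooth_def by blast

lemma smooth_partial_deriv: "smooth f \<Longrightarrow> smooth (partial_deriv i f)"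
  using C_k.simps(2) unfolding smooth_def by blast

text \<open>Differentiability of f supplies continuity, hence level 0; the partial derivatives
  supply every level \<open>Suc k\<close>.\<close>

lemma smoothI:
  assumes "\<And>x. f differentiable (at x)" "\<And>i. smooth (partial_deriv i f)"
  shows "smooth f"
  unfolding smooth_def
proof
  fix k show "C_k k f"
    using assms by (cases k) (auto simp: smooth_def continuous_on_eq_continuous_within
       intro!: differentiable_imp_continuous_within)
qed

lemma smooth_continuous: "smooth f \<Longrightarrow> continuous_on UNIV f"
  unfolding smooth_def using C_k.simps(1) by blast

lemma smooth_isCont: "smooth f \<Longrightarrow> isCont f x"
  using smooth_continuous continuous_on_eq_continuous_at by blast

lemma smooth_borel [measurable]: "smooth f \<Longrightarrow> f \<in> borel_measurable borel"
  by (intro borel_measurable_continuous_onI smooth_continuous)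

lemma smooth_has_derivative:
  "smooth f \<Longrightarrow> (f has_derivative frechet_derivative f (at x)) (at x)"
  using frechet_derivative_works smooth_differentiable by blast

lemma frechet_derivative_partial:
  assumes "f differentiable (at x)"
  shows "frechet_derivative f (at x) h = (\<Sum>i\<in>UNIV. h $ i * partial_deriv i f x)"
proof -
  have lin: "linear (frechet_derivative f (at x))"
    using assms by (simp add: linear_frechet_derivative)
  have h: "h = (\<Sum>i\<in>UNIV. (h $ i) *\<^sub>R axis i 1)"
    by (simp add: vec_eq_iff axis_def if_distrib cong: if_cong)
  have "frechet_derivative f (at x) (\<Sum>i\<in>UNIV. (h $ i) *\<^sub>R axis i 1) = (\<Sum>i\<in>UNIV. h $ i * partial_deriv i f x)"
    by (simp add: linear_sum[OF lin] linear_scale[OF lin] partial_deriv_def)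
  then show ?thesis using h by simp
qed

lemma partial_deriv_const [simp]: "partial_deriv i (\<lambda>x. c) = (\<lambda>x. 0)"
  by (simp add: partial_deriv_def fun_eq_iff)

lemma partial_deriv_add:
  "f differentiable (at x) \<Longrightarrow> g differentiable (at x) \<Longrightarrow>
   partial_deriv i (\<lambda>x. f x + g x) x = partial_deriv i f x + partial_deriv i g x"
  unfolding partial_deriv_def
  by (subst frechet_derivative_at[symmetric, OF has_derivative_add])
     (auto simp: frechet_derivative_works[symmetric])

lemma partial_deriv_mult:
  "f differentiable (at x) \<Longrightarrow> g differentiable (at x) \<Longrightarrow>
   partial_deriv i (\<lambda>x. f x * g x) x = f x * partial_deriv i g x + partial_deriv i f x * g x"
  unfolding partial_deriv_def
  by (subst frechet_derivative_at[symmetric, OF has_derivative_mult])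
     (auto simp: frechet_derivative_works[symmetric])

lemma partial_deriv_compose:
  assumes "(g has_real_derivative g') (at (q x))" "q differentiable (at x)"
  shows "partial_deriv i (\<lambda>x. g (q x)) x = g' * partial_deriv i q x"
proof -
  have "((\<lambda>x. g (q x)) has_derivative (\<lambda>h. g' * frechet_derivative q (at x) h)) (at x)"
    using has_derivative_compose[OF assms(2)[unfolded frechet_derivative_works]
      assms(1)[unfolded has_field_derivative_def]] .
  from partial_deriv_eq[OF this, of i] show ?thesis unfolding partial_deriv_def .
qed

section \<open>Closure of smooth functions under algebra and composition\<close>

lemma C_k_const [simp]: "C_k k (\<lambda>x. c)"
  by (induction k arbitrary: c) (auto)

lemma C_k_add: "C_k k f \<Longrightarrow> C_k k g \<Longrightarrow> C_k k (\<lambda>x. f x + g x)"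
proof (induction k arbitrary: f g)
  case (Suc k)
  have *: "partial_deriv i (\<lambda>x. f x + g x) = (\<lambda>x. partial_deriv i f x + partial_deriv i g x)" for i
    using Suc.prems by (auto simp: fun_eq_iff partial_deriv_add)
  show ?case using Suc by (simp add: *)
qed (auto intro: continuous_intros)

lemma C_k_mult: "C_k k f \<Longrightarrow> C_k k g \<Longrightarrow> C_k k (\<lambda>x. f x * g x)"
proof (induction k arbitrary: f g)
  case (Suc k)
  have *: "partial_deriv i (\<lambda>x. f x * g x) = (\<lambda>x. f x * partial_deriv i g x + partial_deriv i f x * g x)" for i
    using Suc.prems by (auto simp: fun_eq_iff partial_deriv_mult)
  show ?case using Suc C_k_Suc_imp[OF Suc.prems(1)] C_k_Suc_imp[OF Suc.prems(2)]
    by (simp add: * C_k_add)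
qed (auto intro: continuous_intros)

text \<open>The outer function comes with the tower \<open>d\<close> of all its derivatives, so the
  induction over k can move from \<open>d m\<close> to \<open>d (Suc m)\<close>. Restricting the
  tower to S admits real powers on the positive half-line.\<close>

lemma C_k_compose:
  assumes d: "\<And>m s. s \<in> S \<Longrightarrow> (d m has_real_derivative d (Suc m) s) (at s)"
    and q: "\<And>x. q x \<in> S"
  shows "C_k k q \<Longrightarrow> C_k k (\<lambda>x. d m (q x))"
proof (induction k arbitrary: m)
  case 0
  have "continuous_on (range q) (d m)"
    by (rule continuous_at_imp_continuous_on) (use d q DERIV_isCont in blast)
  with 0 show ?case using continuous_on_compose[of UNIV q "d m"] by (simp add: o_def)
next
  case (Suc k)
  have q': "q differentiable (at x)" for x using Suc.prems by simp
  have *: "partial_deriv i (\<lambda>x. d m (q x)) = (\<lambda>x. d (Suc m) (q x) * partial_deriv i q x)" for i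
    using partial_deriv_compose[OF d[OF q] q'] by (auto simp: fun_eq_iff)
  have "(\<lambda>x. d m (q x)) differentiable (at x)" for x
    using differentiable_compose[of "d m" q x UNIV] d[OF q] q'
    by (metis field_differentiable_def field_differentiable_imp_differentiable)
  moreover have "C_k k (\<lambda>x. d (Suc m) (q x))"
    using Suc C_k_Suc_imp by blast
  ultimately show ?case using Suc.prems by (simp add: * C_k_mult)
qed

lemma smooth_const [simp]: "smooth (\<lambda>x. c)" by (simp add: smooth_def)
lemma smooth_add: "smooth f \<Longrightarrow> smooth g \<Longrightarrow> smooth (\<lambda>x. f x + g x)"
  by (simp add: smooth_def C_k_add)
lemma smooth_mult: "smooth f \<Longrightarrow> smooth g \<Longrightarrow> smooth (\<lambda>x. f x * g x)"
  by (simp add: smooth_def C_k_mult)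
lemma smooth_minus: "smooth f \<Longrightarrow> smooth (\<lambda>x. - f x)"
  using smooth_mult[of "\<lambda>_. -1" f] by simp
lemma smooth_diff: "smooth f \<Longrightarrow> smooth g \<Longrightarrow> smooth (\<lambda>x. f x - g x)"
  using smooth_add[of f "\<lambda>x. - g x"] smooth_minus by auto
lemma smooth_sum: "(\<And>j. j \<in> A \<Longrightarrow> smooth (f j)) \<Longrightarrow> smooth (\<lambda>x. \<Sum>j\<in>A. f j x)"
  by (induction A rule: infinite_finite_induct) (auto simp: smooth_add)

lemma partial_deriv_coord: "partial_deriv i (\<lambda>x. x $ j) x = (if i = j then 1 else 0)"
proof -
  have "((\<lambda>x. x $ j) has_derivative (\<lambda>h. h $ j)) (at x)"
    by (rule bounded_linear_imp_has_derivative[OF bounded_linear_vec_nth])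
  from partial_deriv_eq[OF this] show ?thesis by (simp add: axis_def)
qed

lemma smooth_coord [simp]: "smooth (\<lambda>x::real^'n::finite. x $ j)"
proof (rule smoothI)
  show "(\<lambda>x. x $ j) differentiable (at x)" for x :: "real^'n"
    by (rule bounded_linear_imp_differentiable[OF bounded_linear_vec_nth])
  show "smooth (partial_deriv i (\<lambda>x::real^'n. x $ j))" for i
    by (subst ext[OF partial_deriv_coord]) simp
qed

lemma smooth_norm_sq: "smooth (\<lambda>x::real^'n::finite. (norm x)\<^sup>2)"
proof -
  have "(\<lambda>x::real^'n. (norm x)\<^sup>2) = (\<lambda>x. \<Sum>j\<in>UNIV. x $ j * x $ j)"
    by (simp add: fun_eq_iff power2_norm_eq_inner inner_vec_def)
  then show ?thesis by (simp add: smooth_sum smooth_mult)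
qed

lemma partial_deriv_norm_sq: "partial_deriv i (\<lambda>x::real^'n::finite. (norm x)\<^sup>2) x = 2 * x $ i"
proof -
  have "((\<lambda>x::real^'n. x \<bullet> x) has_derivative (\<lambda>h. x \<bullet> h + h \<bullet> x)) (at x)"
    by (auto intro!: derivative_eq_intros)
  from partial_deriv_eq[OF this] show ?thesis
    by (simp add: power2_norm_eq_inner inner_axis inner_axis' )
qed

lemma smooth_compose:
  assumes "\<And>m s. s \<in> S \<Longrightarrow> (d m has_real_derivative d (Suc m) s) (at s)"
    and "\<And>x. q x \<in> S" "smooth q"
  shows "smooth (\<lambda>x. d m (q x))"
  unfolding smooth_def
proof
  fix k show "C_k k (\<lambda>x. d m (q x))"
    by (rule C_k_compose[where S = S]) (use assms in \<open>auto simp: smooth_def\<close>)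
qed

lemma has_derivative_affine:
  assumes "smooth f"
  shows "((\<lambda>x. f (a *\<^sub>R x + b)) has_derivative
     (\<lambda>h. a * frechet_derivative f (at (a *\<^sub>R x + b)) h)) (at x)"
proof -
  have l: "linear (frechet_derivative f (at (a *\<^sub>R x + b)))"
    using assms linear_frechet_derivative smooth_differentiable by blast
  have 1: "((\<lambda>x. a *\<^sub>R x + b) has_derivative (\<lambda>h. a *\<^sub>R h)) (at x)"
    by (auto intro!: derivative_eq_intros)
  show ?thesis
    using has_derivative_compose[OF 1 smooth_has_derivative[OF assms]] by (simp add: linear_scale[OF l])
qed

lemma partial_deriv_affine:
  "smooth f \<Longrightarrow> partial_deriv i (\<lambda>x. f (a *\<^sub>R x + b)) x = a * partial_deriv i f (a *\<^sub>R x + b)"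
  using partial_deriv_eq[OF has_derivative_affine] by (simp add: partial_deriv_def)

lemma smooth_affine:
  assumes "smooth f" shows "smooth (\<lambda>x. f (a *\<^sub>R x + b))"
proof -
  have "smooth f \<Longrightarrow> C_k k (\<lambda>x. f (a *\<^sub>R x + b))" for k
  proof (induction k arbitrary: f)
    case 0
    then show ?case
      by (auto intro!: continuous_on_compose2[OF smooth_continuous[OF 0], of UNIV "\<lambda>x. a *\<^sub>R x + b"]
           continuous_intros)
  next
    case (Suc k)
    have "partial_deriv i (\<lambda>x. f (a *\<^sub>R x + b)) = (\<lambda>x. a * partial_deriv i f (a *\<^sub>R x + b))" for i
      using Suc.prems by (simp add: fun_eq_iff partial_deriv_affine)
    moreover have "(\<lambda>x. f (a *\<^sub>R x + b)) differentiable (at x)" for x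
      using has_derivative_affine[OF Suc.prems] by (rule differentiableI)
    ultimately show ?case using Suc by (auto simp: smooth_partial_deriv intro!: C_k_mult)
  qed
  with assms show ?thesis by (simp add: smooth_def)
qed

lemma partial_deriv_reflect:
  "smooth f \<Longrightarrow> partial_deriv i (\<lambda>y. f (x - y)) y = - partial_deriv i f (x - y)"
  using partial_deriv_affine[of f i "-1" x y] by simp

text \<open>The bump \<open>\<chi> s = exp (-1/s)\<close> for \<open>s > 0\<close>: its \<open>k\<close>-th derivative is
  \<open>p\<^sub>k (1/s) * exp (-1/s)\<close> for a polynomial \<open>p\<^sub>k\<close>.\<close>

primrec bump_poly :: "nat \<Rightarrow> real poly" where
  "bump_poly 0 = 1"
| "bump_poly (Suc k) = [:0, 0, 1:] * (bump_poly k - pderiv (bump_poly k))"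

definition bump_deriv :: "nat \<Rightarrow> real \<Rightarrow> real" where
  "bump_deriv k s = (if s > 0 then poly (bump_poly k) (1 / s) * exp (- (1 / s)) else 0)"

lemma poly_times_exp_minus_tendsto_0:
  fixes p :: "real poly"
  shows "((\<lambda>z. poly p z * exp (- z)) \<longlongrightarrow> 0) at_top"
proof -
  have "((\<lambda>z. \<Sum>i\<le>degree p. coeff p i * (z ^ i / exp z)) \<longlongrightarrow> (\<Sum>i\<le>degree p. coeff p i * 0)) at_top"
    by (intro tendsto_sum tendsto_mult tendsto_const tendsto_power_div_exp_0)
  moreover have "(\<lambda>z. \<Sum>i\<le>degree p. coeff p i * (z ^ i / exp z)) = (\<lambda>z. poly p z * exp (- z))"
    by (simp add: poly_altdef sum_distrib_right exp_minus divide_inverse mult.assoc)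
  ultimately show ?thesis by simp
qed

text \<open>For s > 0 this is the chain rule with z = 1/s and dz/ds = - z^2, which is where the
  recursion of \<open>bump_poly\<close> comes from: (p(z) exp(-z))' = z^2 (p - p')(z) exp(-z). The
  point s = 0 is treated by one-sided difference quotients.\<close>

lemma bump_deriv_DERIV: "(bump_deriv k has_real_derivative bump_deriv (Suc k) s) (at s)"
proof -
  consider "s > 0" | "s < 0" | "s = 0" by linarith
  then show ?thesis
  proof cases
    case 1
    have "((\<lambda>s. poly (bump_poly k) (1 / s) * exp (- (1 / s))) has_real_derivative bump_deriv (Suc k) s) (at s)"
      using 1 by (auto intro!: derivative_eq_intros DERIV_chain2[OF poly_DERIV]
           simp: bump_deriv_def field_simps power2_eq_square)
    then show ?thesis
      by (rule DERIV_cong_ev[THEN iffD1, rotated 3])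
         (use 1 eventually_nhds_in_open[of "{0<..}" s] in \<open>auto simp: bump_deriv_def elim!: eventually_mono\<close>)
  next
    case 2
    have "((\<lambda>s. 0) has_real_derivative bump_deriv (Suc k) s) (at s)"
      using 2 by (auto simp: bump_deriv_def)
    then show ?thesis
      by (rule DERIV_cong_ev[THEN iffD1, rotated 3])
         (use 2 eventually_nhds_in_open[of "{..<0}" s] in \<open>auto simp: bump_deriv_def elim!: eventually_mono\<close>)
  next
    case 3
    \<comment> \<open>With z = 1/h the quotient is z p(z) exp(-z), a polynomial times a decaying
      exponential as z tends to infinity.\<close>
    have r: "((\<lambda>h. bump_deriv k h / h) \<longlongrightarrow> 0) (at_right 0)"
    proof -
      have "((\<lambda>h. poly ([:0,1:] * bump_poly k) (inverse h) * exp (- (inverse h))) \<longlongrightarrow> 0) (at_right (0::real))"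
        by (rule filterlim_compose[OF poly_times_exp_minus_tendsto_0 filterlim_inverse_at_top_right])
      then show ?thesis
        by (rule Lim_transform_eventually)
           (auto simp: bump_deriv_def eventually_at_right_less eventually_at_filter field_simps)
    qed
    have l: "((\<lambda>h. bump_deriv k h / h) \<longlongrightarrow> 0) (at_left 0)"
      by (rule Lim_transform_eventually[OF tendsto_const])
         (auto simp: bump_deriv_def eventually_at_filter)
    show ?thesis unfolding 3 has_field_derivative_iff
      using l r by (auto simp: filterlim_at_split bump_deriv_def)
  qed
qed

text \<open>Using the squared norm keeps the argument a polynomial in the coordinates, hence smooth
  at the origin too; for \<delta> > 0 it is positive exactly on the open ball of radius
  \<delta>.\<close>

definition bump :: "real \<Rightarrow> real^'n::finite \<Rightarrow> real" where
  "bump \<delta> x = bump_deriv 0 (\<delta>\<^sup>2 - (norm x)\<^sup>2)"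

lemma smooth_bump_deriv: "smooth q \<Longrightarrow> smooth (\<lambda>x. bump_deriv k (q x))"
  by (rule smooth_compose[of UNIV bump_deriv]) (auto intro: bump_deriv_DERIV)

lemma smooth_bump: "smooth (bump \<delta>)"
  unfolding bump_def by (intro smooth_bump_deriv smooth_diff smooth_const smooth_norm_sq)

lemma bump_nonneg: "bump \<delta> x \<ge> 0"
  by (simp add: bump_def bump_deriv_def)

lemma bump_neq_0_iff:
  assumes "\<delta> > 0" shows "bump \<delta> x \<noteq> 0 \<longleftrightarrow> norm x < \<delta>"
proof -
  have "bump \<delta> x \<noteq> 0 \<longleftrightarrow> (norm x)\<^sup>2 < \<delta>\<^sup>2"
    by (simp add: bump_def bump_deriv_def)
  also have "\<dots> \<longleftrightarrow> norm x < \<delta>"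
    using assms by (metis less_le_not_le linorder_not_less norm_ge_zero power2_le_imp_le power_mono)
  finally show ?thesis .
qed

lemma partial_deriv_bump_deriv:
  "partial_deriv i (\<lambda>x::real^'n::finite. bump_deriv k (\<delta>\<^sup>2 - (norm x)\<^sup>2)) =
   (\<lambda>x. (-2) * (bump_deriv (Suc k) (\<delta>\<^sup>2 - (norm x)\<^sup>2) * x $ i))"
proof
  fix x :: "real^'n"
  have q: "smooth (\<lambda>x::real^'n. \<delta>\<^sup>2 - (norm x)\<^sup>2)"
    by (intro smooth_diff smooth_const smooth_norm_sq)
  have "((\<lambda>x::real^'n. \<delta>\<^sup>2 - x \<bullet> x) has_derivative (\<lambda>h. - (x \<bullet> h + h \<bullet> x))) (at x)"
    by (auto intro!: derivative_eq_intros)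
  from partial_deriv_eq[OF this, of i]
  have dq: "partial_deriv i (\<lambda>x::real^'n. \<delta>\<^sup>2 - (norm x)\<^sup>2) x = (-2) * x $ i"
    by (simp add: power2_norm_eq_inner inner_axis inner_axis')
  show "partial_deriv i (\<lambda>x::real^'n. bump_deriv k (\<delta>\<^sup>2 - (norm x)\<^sup>2)) x =
     (-2) * (bump_deriv (Suc k) (\<delta>\<^sup>2 - (norm x)\<^sup>2) * x $ i)"
    by (subst partial_deriv_compose[OF bump_deriv_DERIV smooth_differentiable[OF q]])
       (simp only: dq mult_ac)
qed

lemma partial_deriv_cmult:
  "f differentiable (at x) \<Longrightarrow> partial_deriv i (\<lambda>x. c * f x) x = c * partial_deriv i f x"
  by (subst partial_deriv_mult) simp_all

text \<open>Two explicit differentiations give a formula symmetric in i and j. Through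
  \<open>moll_partial_commute\<close> this is the source of the symmetric second derivatives of
  mollified functions.\<close>

lemma partial_deriv_bump_commute:
  "partial_deriv j (partial_deriv i (bump \<delta>)) = partial_deriv i (partial_deriv j (bump \<delta> :: real^'n::finite \<Rightarrow> real))"
proof -
  let ?b = "\<lambda>k (x::real^'n). bump_deriv k (\<delta>\<^sup>2 - (norm x)\<^sup>2)"
  have sm: "smooth (?b k)" for k
    by (intro smooth_bump_deriv smooth_diff smooth_const smooth_norm_sq)
  have *: "partial_deriv j (partial_deriv i (?b 0)) x
       = (-2) * (?b (Suc 0) x * (if j = i then 1 else 0) + (-2) * (?b (Suc (Suc 0)) x * x $ j) * x $ i)" for i j x
    unfolding partial_deriv_bump_deriv
    by (subst partial_deriv_cmult, intro smooth_differentiable smooth_mult sm smooth_coord,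
        subst partial_deriv_mult, intro smooth_differentiable sm, intro smooth_differentiable smooth_coord)
       (simp only: partial_deriv_bump_deriv partial_deriv_coord)
  have b: "bump \<delta> = ?b 0" by (simp add: bump_def fun_eq_iff)
  show ?thesis unfolding b by (rule ext, cases "i = j") (simp_all only: * mult_ac simp_thms if_False eq_commute)
qed

section \<open>Test functions: closure properties and uniform estimates\<close>

lemma test_function_iff_smooth: "test_function f \<longleftrightarrow> smooth f \<and> compact (closure {x. f x \<noteq> 0})"
  by (simp add: test_function_def smooth_def)

lemma test_function_smooth: "test_function f \<Longrightarrow> smooth f"
  by (simp add: test_function_iff_smooth)

lemma test_functionI:
  assumes "smooth f" "\<And>x. norm x > R \<Longrightarrow> f x = 0"
  shows "test_function f"
proof -
  have "{x. f x \<noteq> 0} \<subseteq> cball 0 R"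
    using assms(2) by (auto simp: not_less[symmetric])
  then have "bounded {x. f x \<noteq> 0}" using bounded_cball bounded_subset by blast
  then show ?thesis using assms(1) by (simp add: test_function_iff_smooth compact_closure)
qed

lemma test_function_support:
  assumes "test_function f"
  obtains R where "R > 0" "\<And>x. norm x \<ge> R \<Longrightarrow> f x = 0"
proof -
  have "bounded {x. f x \<noteq> 0}"
    using assms by (simp add: test_function_iff_smooth compact_closure)
  then obtain R where "\<And>x. f x \<noteq> 0 \<Longrightarrow> norm x \<le> R" by (auto simp: bounded_iff)
  then show ?thesis using that[of "max 0 R + 1"] by force
qed

lemma test_function_mult_smooth:
  assumes "test_function f" "smooth g" shows "test_function (\<lambda>x. f x * g x)"
proof -
  obtain R where "\<And>x. norm x \<ge> R \<Longrightarrow> f x = 0" using test_function_support[OF assms(1)] by metis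
  then show ?thesis using assms by (intro test_functionI[of _ R]) (auto simp: smooth_mult test_function_smooth)
qed

lemma test_function_add:
  assumes "test_function f" "test_function g" shows "test_function (\<lambda>x. f x + g x)"
proof -
  obtain R where 1: "\<And>x. norm x \<ge> R \<Longrightarrow> f x = 0" using test_function_support[OF assms(1)] by metis
  obtain S where 2: "\<And>x. norm x \<ge> S \<Longrightarrow> g x = 0" using test_function_support[OF assms(2)] by metis
  show ?thesis using assms 1 2
    by (intro test_functionI[of _ "max R S"]) (auto simp: smooth_add test_function_smooth)
qed

lemma test_function_partial_deriv:
  assumes "test_function f" shows "test_function (partial_deriv i f)"
proof -
  obtain R where R: "\<And>x. norm x \<ge> R \<Longrightarrow> f x = 0" using test_function_support[OF assms(1)] by metis
  show ?thesis
  proof (rule test_functionI)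
    show "smooth (partial_deriv i f)" using assms smooth_partial_deriv test_function_smooth by blast
    fix x :: "real^'a" assume x: "norm x > R"
    have "open {x::real^'a. norm x > R}" by (intro open_Collect_less continuous_intros)
    then have "(f has_derivative (\<lambda>h. 0)) (at x)"
      using x R by (intro has_derivative_transform_within_open[OF has_derivative_const[of "0::real"]]) auto
    from partial_deriv_eq[OF this] show "partial_deriv i f x = 0" .
  qed
qed

lemma test_function_affine:
  assumes "test_function f" "a \<noteq> 0" shows "test_function (\<lambda>x. f (a *\<^sub>R x + b))"
proof -
  obtain R where R: "\<And>x. norm x \<ge> R \<Longrightarrow> f x = 0" using test_function_support[OF assms(1)] by metis
  show ?thesis
  proof (rule test_functionI)
    show "smooth (\<lambda>x. f (a *\<^sub>R x + b))" using assms smooth_affine test_function_smooth by blast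
    fix x :: "real^'a" assume x: "norm x > (R + norm b) / \<bar>a\<bar>"
    have "norm (a *\<^sub>R x) \<le> norm (a *\<^sub>R x + b) + norm b"
      by (metis add_diff_cancel_right' norm_triangle_ineq4)
    moreover have "\<bar>a\<bar> * norm x > R + norm b" using x assms(2) by (simp add: field_simps)
    ultimately have "norm (a *\<^sub>R x + b) \<ge> R" by simp
    then show "f (a *\<^sub>R x + b) = 0" by (rule R)
  qed
qed

lemma test_function_reflect:
  "test_function f \<Longrightarrow> test_function (\<lambda>y. f (x - y))"
  using test_function_affine[of f "-1" x] by simp

lemma test_function_bounded:
  assumes "test_function f" obtains B where "B > 0" "\<And>x. \<bar>f x\<bar> \<le> B"
proof -
  obtain R where R: "\<And>x. norm x \<ge> R \<Longrightarrow> f x = 0" using test_function_support[OF assms(1)] by metis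
  have "compact (f ` cball 0 R)"
    by (intro compact_continuous_image continuous_on_subset[OF smooth_continuous[OF test_function_smooth[OF assms]]]) auto
  then obtain B where B: "\<And>x. x \<in> cball 0 R \<Longrightarrow> \<bar>f x\<bar> \<le> B"
    by (fastforce dest!: compact_imp_bounded simp: bounded_iff)
  have "\<bar>f x\<bar> \<le> max B 0 + 1" for x
    using R[of x] B[of x] by (cases "norm x \<ge> R") auto
  then show ?thesis using that[of "max B 0 + 1"] by auto
qed

lemma onorm_partial:
  assumes "smooth f" "\<And>i. \<bar>partial_deriv i f x\<bar> \<le> B"
  shows "norm (frechet_derivative f (at x) h) \<le> real CARD('n) * B * norm (h::real^'n::finite)"
proof -
  have "norm (frechet_derivative f (at x) h) \<le> (\<Sum>i\<in>UNIV. \<bar>h $ i\<bar> * \<bar>partial_deriv i f x\<bar>)"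
    by (subst frechet_derivative_partial[OF smooth_differentiable[OF assms(1)]])
       (auto intro: sum_abs[THEN order_trans] simp: abs_mult)
  also have "\<dots> \<le> (\<Sum>i\<in>(UNIV::'n set). norm h * B)"
    using assms(2) by (intro sum_mono mult_mono) (auto simp: component_le_norm_cart)
  finally show ?thesis by (simp add: mult_ac)
qed

lemma test_function_partial_bound:
  assumes "test_function (f :: real^'n::finite \<Rightarrow> real)" obtains B where "B > 0" "\<And>i x. \<bar>partial_deriv i f x\<bar> \<le> B"
proof -
  have "\<forall>i. \<exists>B>0. \<forall>x. \<bar>partial_deriv i f x\<bar> \<le> B"
    using test_function_bounded[OF test_function_partial_deriv[OF assms]] by metis
  then obtain B where B: "\<And>i. B i > 0" "\<And>i x. \<bar>partial_deriv i f x\<bar> \<le> B i" by metis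
  have "\<bar>partial_deriv i f x\<bar> \<le> (\<Sum>i\<in>UNIV. B i)" for i x
    using B(2)[of i x] member_le_sum[of i UNIV B] B(1) by (smt (verit) UNIV_I finite)
  then show ?thesis using that B(1) by (metis UNIV_I finite sum_pos empty_iff)
qed

lemma test_function_Lipschitz:
  assumes "test_function (f :: real^'n::finite \<Rightarrow> real)" obtains L where "L > 0" "\<And>x y. \<bar>f x - f y\<bar> \<le> L * norm (x - y)"
proof -
  obtain B where B: "B > 0" "\<And>i x. \<bar>partial_deriv i f x\<bar> \<le> B" using test_function_partial_bound[OF assms] by metis
  have "norm (f x - f y) \<le> (real CARD('n) * B) * norm (x - y)" for x y
    by (rule differentiable_bound[of UNIV f "\<lambda>x. frechet_derivative f (at x)"])
       (use smooth_has_derivative[OF test_function_smooth[OF assms]] onorm_partial[OF test_function_smooth[OF assms] B(2)]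
         in \<open>auto intro!: onorm_le\<close>)
  then show ?thesis using that[of "real CARD('n) * B"] B by auto
qed

text \<open>The partial derivatives are Lipschitz, which makes C independent of the point x. This
  uniformity is what permits differentiation of a convolution under the integral sign.\<close>

lemma test_function_Taylor:
  assumes "test_function (f :: real^'n::finite \<Rightarrow> real)"
  obtains C where "C > 0"
    "\<And>x h. \<bar>f (x + h) - f x - (\<Sum>i\<in>UNIV. h $ i * partial_deriv i f x)\<bar> \<le> C * (norm h)\<^sup>2"
proof -
  note sm = test_function_smooth[OF assms]
  have "\<forall>i. \<exists>L>0. \<forall>x y. \<bar>partial_deriv i f x - partial_deriv i f y\<bar> \<le> L * norm (x - y)"
    using test_function_Lipschitz[OF test_function_partial_deriv[OF assms]] by metis
  then obtain L where L: "\<And>i. L i > 0" "\<And>i x y. \<bar>partial_deriv i f x - partial_deriv i f y\<bar> \<le> L i * norm (x - y)" by metis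
  let ?L = "\<Sum>i\<in>UNIV. L i"
  have le: "L i \<le> ?L" for i using member_le_sum[of i UNIV L] L(1) by (simp add: less_imp_le)
  have pos: "?L > 0" using L(1) by (simp add: sum_pos)
  have "norm (f (x + h) - f x - frechet_derivative f (at x) ((x+h) - x)) \<le> norm ((x+h) - x) * (real CARD('n) * (?L * norm h))" for x h
  proof (rule differentiable_bound_linearization[of _ _ "cball x (norm h)" f "\<lambda>y. frechet_derivative f (at y)"])
    show "x + t *\<^sub>R (x + h - x) \<in> cball x (norm h)" if "t \<in> {0..1}" for t
      using that by (auto simp: dist_norm mult_left_le_one_le)
    show "(f has_derivative frechet_derivative f (at y)) (at y within cball x (norm h))" for y
      using smooth_has_derivative[OF sm] has_derivative_at_withinI by blast
    show "x \<in> cball x (norm h)" by simp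
    fix y assume y: "y \<in> cball x (norm h)"
    show "onorm (frechet_derivative f (at y) - frechet_derivative f (at x)) \<le> real CARD('n) * (?L * norm h)"
    proof (rule onorm_le)
      fix v :: "real^'n"
      have "norm ((frechet_derivative f (at y) - frechet_derivative f (at x)) v)
         = \<bar>\<Sum>i\<in>UNIV. v $ i * (partial_deriv i f y - partial_deriv i f x)\<bar>"
        by (simp add: frechet_derivative_partial[OF smooth_differentiable[OF sm]] sum_subtractf right_diff_distrib)
      also have "\<dots> \<le> (\<Sum>i\<in>UNIV. \<bar>v $ i\<bar> * \<bar>partial_deriv i f y - partial_deriv i f x\<bar>)"
        by (auto intro: sum_abs[THEN order_trans] simp: abs_mult)
      also have "\<dots> \<le> (\<Sum>i\<in>(UNIV::'n set). norm v * (?L * norm h))"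
      proof (intro sum_mono mult_mono)
        fix i
        have "\<bar>partial_deriv i f y - partial_deriv i f x\<bar> \<le> L i * norm (y - x)" by (rule L)
        also have "\<dots> \<le> ?L * norm h"
          using y le[of i] L(1)[of i] by (intro mult_mono) (auto simp: dist_norm norm_minus_commute)
        finally show "\<bar>partial_deriv i f y - partial_deriv i f x\<bar> \<le> ?L * norm h" .
      qed (auto simp: component_le_norm_cart)
      finally show "norm ((frechet_derivative f (at y) - frechet_derivative f (at x)) v)
           \<le> real CARD('n) * (?L * norm h) * norm v" by (simp add: mult_ac)
    qed
  qed
  then have "\<bar>f (x + h) - f x - (\<Sum>i\<in>UNIV. h $ i * partial_deriv i f x)\<bar> \<le> (real CARD('n) * ?L) * (norm h)\<^sup>2" for x h
    by (simp add: frechet_derivative_partial[OF smooth_differentiable[OF sm]] power2_eq_square mult_ac)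
  then show ?thesis using that[of "real CARD('n) * ?L"] pos by auto
qed

lemma bump_test_function: "\<delta> > 0 \<Longrightarrow> test_function (bump \<delta>)"
  by (rule test_functionI[of _ \<delta>]) (use smooth_bump bump_neq_0_iff[of \<delta>] in \<open>auto dest: order.asym\<close>)

lemma test_function_integrable:
  assumes "test_function f" shows "integrable lborel f"
proof -
  obtain R where R: "\<And>x. norm x \<ge> R \<Longrightarrow> f x = 0" using test_function_support[OF assms(1)] by metis
  have "integrable lborel (\<lambda>x. indicat_real (cball 0 R) x *\<^sub>R f x)"
    by (intro borel_integrable_compact continuous_on_subset[OF smooth_continuous[OF test_function_smooth[OF assms]]]) auto
  moreover have "(\<lambda>x. indicat_real (cball 0 R) x *\<^sub>R f x) = f"
    using R by (auto simp: fun_eq_iff indicator_def)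
  ultimately show ?thesis by simp
qed

section \<open>Affine changes of variables and integration by parts\<close>

lemma lborel_affine_nn_integral:
  fixes f :: "'a::euclidean_space \<Rightarrow> ennreal"
  assumes [measurable]: "f \<in> borel_measurable borel" and c: "c \<noteq> 0"
  shows "(\<integral>\<^sup>+x. f x \<partial>lborel) = \<bar>c\<bar> ^ DIM('a) * (\<integral>\<^sup>+x. f (c *\<^sub>R x + t) \<partial>lborel)"
  by (subst lborel_affine[OF c, of t])
     (simp add: nn_integral_density nn_integral_distr nn_integral_cmult add.commute ennreal_power)

lemma lborel_affine_integrable:
  fixes f :: "'a::euclidean_space \<Rightarrow> 'b::{banach, second_countable_topology}"
  assumes f: "integrable lborel f" and c: "c \<noteq> 0"
  shows "integrable lborel (\<lambda>x. f (c *\<^sub>R x + t))"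
proof -
  have [measurable]: "f \<in> borel_measurable borel" using borel_measurable_integrable[OF f] by simp
  have "(\<integral>\<^sup>+x. norm (f x) \<partial>lborel) < \<infinity>" using f by (simp add: integrable_iff_bounded)
  then have "(\<integral>\<^sup>+x. norm (f (c *\<^sub>R x + t)) \<partial>lborel) < \<infinity>"
    using c by (subst (asm) lborel_affine_nn_integral[of _ c t]) (auto simp: ennreal_mult_less_top)
  then show ?thesis by (simp add: integrable_iff_bounded)
qed

lemma lborel_affine_integral:
  fixes f :: "'a::euclidean_space \<Rightarrow> 'b::{banach, second_countable_topology}"
  assumes [measurable]: "f \<in> borel_measurable borel" and c: "c \<noteq> 0"
  shows "(LBINT x. f x) = \<bar>c\<bar> ^ DIM('a) *\<^sub>R (LBINT x. f (c *\<^sub>R x + t))"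
  by (subst lborel_affine[OF c, of t])
     (simp add: integral_density integral_distr add.commute)

text \<open>Difference quotients in direction i integrate to 0 by translation invariance, and they
  converge to the partial derivative dominatedly.\<close>

lemma integral_partial_deriv_eq_0:
  assumes "test_function (f :: real^'n::finite \<Rightarrow> real)"
  shows "(LBINT x. partial_deriv i f x) = 0"
proof -
  note sm = test_function_smooth[OF assms]
  have [measurable]: "f \<in> borel_measurable borel" using sm by simp
  obtain R where R: "R > 0" "\<And>x. norm x \<ge> R \<Longrightarrow> f x = 0" using test_function_support[OF assms] by metis
  obtain L where L: "L > 0" "\<And>x y. \<bar>f x - f y\<bar> \<le> L * norm (x - y)" using test_function_Lipschitz[OF assms] by metis
  define F where "F n x = (f (x + (1 / real (Suc n)) *\<^sub>R axis i 1) - f x) * real (Suc n)" for n x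
  have [measurable]: "F n \<in> borel_measurable borel" for n unfolding F_def by measurable
  have "(\<lambda>n. LBINT x. F n x) \<longlonglongrightarrow> (LBINT x. partial_deriv i f x)"
  \<comment> \<open>The steps 1/(n+1) have length at most 1, so all quotients vanish outside the
    ball of radius R + 1; the Lipschitz constant bounds them inside.\<close>
  proof (rule integral_dominated_convergence[where w = "\<lambda>x. L * indicator (cball 0 (R + 1)) x"])
    show "partial_deriv i f \<in> borel_measurable lborel" using smooth_borel[OF smooth_partial_deriv[OF sm]] by simp
    have "emeasure lborel (cball (0::real^'n) (R+1)) < \<infinity>" by (rule emeasure_lborel_cball_finite)
    then show "integrable lborel (\<lambda>x::real^'n. L * indicator (cball 0 (R + 1)) x)" by simp
    show "AE x in lborel. (\<lambda>n. F n x) \<longlonglongrightarrow> partial_deriv i f x"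
    proof (rule AE_I2)
      fix x
      have 1: "((\<lambda>t::real. f (x + t *\<^sub>R axis i 1)) has_derivative (\<lambda>t. frechet_derivative f (at x) (t *\<^sub>R axis i 1))) (at 0)"
        by (rule has_derivative_compose[of "\<lambda>t. x + t *\<^sub>R axis i 1" _ 0 UNIV f])
           (auto intro!: derivative_eq_intros smooth_has_derivative sm)
      have l: "linear (frechet_derivative f (at x))" using linear_frechet_derivative smooth_differentiable[OF sm] by blast
      have "((\<lambda>t::real. f (x + t *\<^sub>R axis i 1)) has_real_derivative partial_deriv i f x) (at 0)"
        using 1 by (simp add: has_field_derivative_def linear_scale[OF l] partial_deriv_def mult_commute_abs)
      then have "((\<lambda>t. (f (x + t *\<^sub>R axis i 1) - f x) / t) \<longlongrightarrow> partial_deriv i f x) (at 0)"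
        by (simp add: has_field_derivative_iff)
      moreover have "filterlim (\<lambda>n. 1 / real (Suc n)) (at 0) sequentially"
        using LIMSEQ_inverse_real_of_nat by (auto simp: filterlim_at inverse_eq_divide)
      ultimately have "(\<lambda>n. (f (x + (1 / real (Suc n)) *\<^sub>R axis i 1) - f x) / (1 / real (Suc n))) \<longlonglongrightarrow> partial_deriv i f x"
        by (rule filterlim_compose)
      then show "(\<lambda>n. F n x) \<longlonglongrightarrow> partial_deriv i f x" by (simp add: F_def)
    qed
    show "AE x in lborel. norm (F n x) \<le> L * indicator (cball 0 (R + 1)) x" for n
    proof (rule AE_I2)
      fix x
      show "norm (F n x) \<le> L * indicator (cball 0 (R + 1)) x"
      proof (cases "norm x \<le> R + 1")
        case True
        have "\<bar>f (x + (1 / real (Suc n)) *\<^sub>R axis i 1) - f x\<bar> \<le> L * (1 / real (Suc n))"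
          using L(2)[of "x + (1 / real (Suc n)) *\<^sub>R axis i 1" x] by (simp add: norm_axis_1)
        then have "\<bar>f (x + (1 / real (Suc n)) *\<^sub>R axis i 1) - f x\<bar> * real (Suc n) \<le> L"
          by (simp del: of_nat_Suc add: field_simps)
        then show ?thesis using True by (simp del: of_nat_Suc add: F_def abs_mult)
      next
        case False
        let ?h = "(1 / real (Suc n)) *\<^sub>R axis i 1 :: real^'n"
        have "norm ?h \<le> 1" by (simp add: norm_axis_1)
        moreover have "norm x \<le> norm (x + ?h) + norm ?h"
          using norm_triangle_ineq4[of "x + ?h" ?h] by (simp only: add_diff_cancel_right')
        ultimately have "norm (x + ?h) \<ge> R" using False by linarith
        then show ?thesis using False R(2)[of x] R(2)[of "x + (1 / real (Suc n)) *\<^sub>R axis i 1"] by (simp add: F_def)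
      qed
    qed
  qed measurable
  moreover have "(LBINT x. F n x) = 0" for n
  proof -
    have "(LBINT x. f (x + (1 / real (Suc n)) *\<^sub>R axis i 1)) = (LBINT x. f x)"
      using lborel_affine_integral[of f 1 "(1 / real (Suc n)) *\<^sub>R axis i 1"] by simp
    moreover have "integrable lborel (\<lambda>x. f (x + (1 / real (Suc n)) *\<^sub>R axis i 1))"
      using lborel_affine_integrable[OF test_function_integrable[OF assms], of 1 "(1 / real (Suc n)) *\<^sub>R axis i 1"] by simp
    ultimately show ?thesis
      using test_function_integrable[OF assms] by (simp del: of_nat_Suc add: F_def)
  qed
  ultimately have "(\<lambda>n. 0) \<longlonglongrightarrow> (LBINT x. partial_deriv i f x)" by (simp only:)
  then show ?thesis by (rule LIMSEQ_unique) (rule tendsto_const)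
qed

lemma integral_by_parts:
  assumes "test_function f" "smooth g"
  shows "(LBINT x. partial_deriv i f x * g x) = - (LBINT x. f x * partial_deriv i g x)"
proof -
  have 1: "integrable lborel (\<lambda>x. partial_deriv i f x * g x)" "integrable lborel (\<lambda>x. f x * partial_deriv i g x)"
    by (intro test_function_integrable test_function_mult_smooth test_function_partial_deriv smooth_partial_deriv assms)+
  have "(LBINT x. partial_deriv i (\<lambda>x. f x * g x) x) = 0"
    using assms by (intro integral_partial_deriv_eq_0 test_function_mult_smooth)
  also have "partial_deriv i (\<lambda>x. f x * g x) = (\<lambda>x. f x * partial_deriv i g x + partial_deriv i f x * g x)"
    by (rule ext) (intro partial_deriv_mult smooth_differentiable test_function_smooth assms)
  finally show ?thesis using 1 by simp
qed

section \<open>Square-integrable functions and mollification\<close>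

lemma L2_borel: "f \<in> L2 \<Longrightarrow> f \<in> borel_measurable borel"
  by (simp add: L2_def)

lemma L2_integrable_norm_sq: "f \<in> L2 \<Longrightarrow> integrable lborel (\<lambda>x. (norm (f x))\<^sup>2)"
  by (simp add: L2_def)

lemma L2_real_iff:
  "(f :: real^'n::finite \<Rightarrow> real) \<in> L2 \<longleftrightarrow> f \<in> borel_measurable borel \<and> integrable lborel (\<lambda>x. (f x)\<^sup>2)"
  by (simp add: L2_def)

lemma L2_integrable_sq: "(f :: real^'n::finite \<Rightarrow> real) \<in> L2 \<Longrightarrow> integrable lborel (\<lambda>x. (f x)\<^sup>2)"
  by (simp add: L2_def)

lemma L2_mono:
  assumes "g \<in> L2" "f \<in> borel_measurable borel" "\<And>x. norm (f x) \<le> B * norm (g x)"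
  shows "f \<in> L2"
  unfolding L2_def
proof (intro CollectI conjI assms(2))
  note [measurable] = assms(2)
  show "integrable lborel (\<lambda>x. (norm (f x))\<^sup>2)"
  proof (rule Bochner_Integration.integrable_bound)
    show "integrable lborel (\<lambda>x. B\<^sup>2 * (norm (g x))\<^sup>2)" using L2_integrable_norm_sq[OF assms(1)] by simp
    have "(norm (f x))\<^sup>2 \<le> (B * norm (g x))\<^sup>2" for x
      using assms(3)[of x] by (intro power_mono) auto
    then show "AE x in lborel. norm ((norm (f x))\<^sup>2) \<le> norm (B\<^sup>2 * (norm (g x))\<^sup>2)"
      by (simp add: power_mult_distrib)
  qed auto
qed

lemma L2_add:
  assumes "f \<in> L2" "g \<in> L2" shows "(\<lambda>x. f x + g x) \<in> L2"
proof -
  note [measurable] = L2_borel[OF assms(1)] L2_borel[OF assms(2)]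
  have "integrable lborel (\<lambda>x. (norm (f x + g x))\<^sup>2)"
  proof (rule Bochner_Integration.integrable_bound)
    show "integrable lborel (\<lambda>x. 2 * (norm (f x))\<^sup>2 + 2 * (norm (g x))\<^sup>2)"
      using assms by (simp add: L2_integrable_norm_sq)
    have "(norm (f x + g x))\<^sup>2 \<le> 2 * (norm (f x))\<^sup>2 + 2 * (norm (g x))\<^sup>2" for x
    proof -
      have "(norm (f x + g x))\<^sup>2 \<le> (norm (f x) + norm (g x))\<^sup>2"
        by (intro power_mono norm_triangle_ineq) auto
      also have "\<dots> \<le> 2 * (norm (f x))\<^sup>2 + 2 * (norm (g x))\<^sup>2"
        using sum_squares_bound[of "norm (f x)" "norm (g x)"] by (simp add: power2_sum)
      finally show ?thesis .
    qed
    then show "AE x in lborel. norm ((norm (f x + g x))\<^sup>2) \<le> norm (2 * (norm (f x))\<^sup>2 + 2 * (norm (g x))\<^sup>2)"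
      by simp
  qed auto
  then show ?thesis by (simp add: L2_def)
qed

lemma L2_bounded_mult:
  fixes f :: "real^'n::finite \<Rightarrow> real"
  assumes "f \<in> L2" "m \<in> borel_measurable borel" "\<And>x. \<bar>m x\<bar> \<le> B"
  shows "(\<lambda>x. m x * f x) \<in> L2"
proof (rule L2_mono[OF assms(1)])
  show "(\<lambda>x. m x * f x) \<in> borel_measurable borel"
    using assms(2) L2_borel[OF assms(1)] by (rule borel_measurable_times)
  show "norm (m x * f x) \<le> B * norm (f x)" for x
    using assms(3)[of x] by (simp add: abs_mult mult_right_mono)
qed

lemma L2_cmult: "(f :: real^'n::finite \<Rightarrow> real) \<in> L2 \<Longrightarrow> (\<lambda>x. c * f x) \<in> L2"
  by (rule L2_bounded_mult[where B = "\<bar>c\<bar>"]) auto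

lemma L2_diff: "(f :: real^'n::finite \<Rightarrow> real) \<in> L2 \<Longrightarrow> g \<in> L2 \<Longrightarrow> (\<lambda>x. f x - g x) \<in> L2"
  using L2_add[of f "\<lambda>x. -1 * g x"] L2_cmult[of g "-1"] by simp

lemma L2_integrable_mult:
  fixes f g :: "real^'n::finite \<Rightarrow> real"
  assumes "f \<in> L2" "g \<in> L2" shows "integrable lborel (\<lambda>x. f x * g x)"
proof (rule Bochner_Integration.integrable_bound)
  note [measurable] = L2_borel[OF assms(1)] L2_borel[OF assms(2)]
  show "(\<lambda>x. f x * g x) \<in> borel_measurable lborel" by simp
  show "integrable lborel (\<lambda>x. (f x)\<^sup>2 + (g x)\<^sup>2)" using assms by (simp add: L2_integrable_sq)
  have "\<bar>f x * g x\<bar> \<le> (f x)\<^sup>2 + (g x)\<^sup>2" for x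
  proof -
    have "2 * (\<bar>f x\<bar> * \<bar>g x\<bar>) \<le> (f x)\<^sup>2 + (g x)\<^sup>2"
      using sum_squares_bound[of "\<bar>f x\<bar>" "\<bar>g x\<bar>"] by simp
    moreover have "0 \<le> \<bar>f x\<bar> * \<bar>g x\<bar>" by simp
    ultimately show ?thesis unfolding abs_mult by linarith
  qed
  then show "AE x in lborel. norm (f x * g x) \<le> norm ((f x)\<^sup>2 + (g x)\<^sup>2)" by simp
qed

lemma L2_integrable_mult3:
  fixes f g :: "real^'n::finite \<Rightarrow> real"
  assumes "f \<in> L2" "g \<in> L2" "m \<in> borel_measurable borel" "\<And>x. \<bar>m x\<bar> \<le> B"
  shows "integrable lborel (\<lambda>x. m x * f x * g x)"
  using L2_integrable_mult[OF L2_bounded_mult[OF assms(1,3,4)] assms(2)] .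

text \<open>The integral of (|f| - t |g|)^2 is a nonnegative quadratic in t; evaluating it at its
  minimum \<open>?C / ?B\<close> gives the claim when \<open>?B\<close> is nonzero.\<close>

lemma L2_Cauchy_Schwarz:
  fixes f g :: "real^'n::finite \<Rightarrow> real"
  assumes "f \<in> L2" "g \<in> L2"
  shows "(LBINT x. \<bar>f x * g x\<bar>)\<^sup>2 \<le> (LBINT x. (f x)\<^sup>2) * (LBINT x. (g x)\<^sup>2)"
proof -
  note [measurable] = L2_borel[OF assms(1)] L2_borel[OF assms(2)]
  let ?C = "LBINT x. \<bar>f x * g x\<bar>" and ?A = "LBINT x. (f x)\<^sup>2" and ?B = "LBINT x. (g x)\<^sup>2"
  have i: "integrable lborel (\<lambda>x. (f x)\<^sup>2)" "integrable lborel (\<lambda>x. (g x)\<^sup>2)" "integrable lborel (\<lambda>x. \<bar>f x * g x\<bar>)"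
    using assms by (auto simp: L2_integrable_sq intro!: integrable_abs L2_integrable_mult)
  have "0 \<le> ?A - 2 * t * ?C + t\<^sup>2 * ?B" for t
  proof -
    have "0 \<le> (LBINT x. (\<bar>f x\<bar> - t * \<bar>g x\<bar>)\<^sup>2)" by simp
    also have "\<dots> = (LBINT x. (f x)\<^sup>2 - 2 * t * \<bar>f x * g x\<bar> + t\<^sup>2 * (g x)\<^sup>2)"
      by (intro Bochner_Integration.integral_cong) (simp_all add: power2_diff power_mult_distrib abs_mult)
    also have "\<dots> = ?A - 2 * t * ?C + t\<^sup>2 * ?B" using i by simp
    finally show ?thesis .
  qed
  note q = this
  have C: "?C \<ge> 0" and B: "?B \<ge> 0" by simp_all
  show ?thesis
  proof (cases "?B = 0")
    case True
    have "?C = 0"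
    proof (rule ccontr)
      assume "?C \<noteq> 0"
      then have "?C > 0" using C by linarith
      \<comment> \<open>For \<open>?B\<close> = 0 the quadratic is affine with slope -2
        \<open>?C\<close>; this t makes its value -1.\<close>
      then show False using q[of "(?A + 1) / (2 * ?C)"] True by (simp add: field_simps)
    qed
    then show ?thesis using B by simp
  next
    case False
    then have "?B > 0" using B by linarith
    then show ?thesis using q[of "?C / ?B"] by (simp add: field_simps power2_eq_square)
  qed
qed

text \<open>Membership in \<open>L2\<close> is part of the notion, because a non-integrable square
  would have Bochner integral 0 and fake convergence.\<close>

definition L2_lim :: "(nat \<Rightarrow> real^'n::finite \<Rightarrow> real) \<Rightarrow> (real^'n \<Rightarrow> real) \<Rightarrow> bool" where
  "L2_lim f g \<longleftrightarrow> g \<in> L2 \<and> (\<forall>n. f n \<in> L2) \<and> (\<lambda>n. LBINT x. (f n x - g x)\<^sup>2) \<longlonglongrightarrow> 0"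

text \<open>The difference splits as f g - f' g' = (f - f')(g - g') + (f - f') g' + f' (g - g'), and
  Cauchy-Schwarz bounds each piece. The limits of mollified identities in
  \<open>product_rule_test\<close> and \<open>local_virial_identity\<close> are taken with this
  lemma.\<close>

lemma L2_lim_integral:
  assumes f: "L2_lim f f'" and g: "L2_lim g g'"
    and m: "m \<in> borel_measurable borel" "\<And>x. \<bar>m x\<bar> \<le> B"
  shows "(\<lambda>n. LBINT x. m x * f n x * g n x) \<longlonglongrightarrow> (LBINT x. m x * f' x * g' x)"
proof -
  let ?F = "\<lambda>n. LBINT x. (f n x - f' x)\<^sup>2" and ?G = "\<lambda>n. LBINT x. (g n x - g' x)\<^sup>2"
  let ?f = "LBINT x. (f' x)\<^sup>2" and ?g = "LBINT x. (g' x)\<^sup>2"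
  have L: "f' \<in> L2" "g' \<in> L2" "f n \<in> L2" "g n \<in> L2" "(\<lambda>x. f n x - f' x) \<in> L2" "(\<lambda>x. g n x - g' x) \<in> L2" for n
    using f g by (auto simp: L2_lim_def intro: L2_diff)
  have B: "B \<ge> 0" using m(2)[of undefined] by linarith
  have cs: "(LBINT x. \<bar>a x * b x\<bar>) \<le> sqrt (LBINT x. (a x)\<^sup>2) * sqrt (LBINT x. (b x)\<^sup>2)" 
    if "a \<in> L2" "b \<in> L2" for a b :: "real^'a \<Rightarrow> real"
    unfolding real_sqrt_mult[symmetric] by (rule real_le_rsqrt[OF L2_Cauchy_Schwarz[OF that]])
  have bd: "\<bar>(LBINT x. m x * f n x * g n x) - (LBINT x. m x * f' x * g' x)\<bar>
     \<le> B * (sqrt (?F n) * sqrt (?G n) + sqrt (?F n) * sqrt ?g + sqrt ?f * sqrt (?G n))" for n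
  proof -
    have "(LBINT x. m x * f n x * g n x) - (LBINT x. m x * f' x * g' x)
      = (LBINT x. m x * f n x * g n x - m x * f' x * g' x)"
      by (intro Bochner_Integration.integral_diff[symmetric] L2_integrable_mult3[OF _ _ m] L)
    also have "\<bar>\<dots>\<bar> \<le> (LBINT x. \<bar>m x * f n x * g n x - m x * f' x * g' x\<bar>)" by (rule integral_abs_bound)
    also have "\<dots> \<le> (LBINT x. B * (\<bar>(f n x - f' x) * (g n x - g' x)\<bar> + \<bar>(f n x - f' x) * g' x\<bar> + \<bar>f' x * (g n x - g' x)\<bar>))"
    proof (rule integral_mono)
      show "integrable lborel (\<lambda>x. \<bar>m x * f n x * g n x - m x * f' x * g' x\<bar>)"
        by (intro integrable_abs Bochner_Integration.integrable_diff L2_integrable_mult3[OF _ _ m] L)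
      show "integrable lborel (\<lambda>x. B * (\<bar>(f n x - f' x) * (g n x - g' x)\<bar> + \<bar>(f n x - f' x) * g' x\<bar> + \<bar>f' x * (g n x - g' x)\<bar>))"
        by (intro integrable_mult_right Bochner_Integration.integrable_add integrable_abs L2_integrable_mult L)
      fix x
      have "\<bar>m x * f n x * g n x - m x * f' x * g' x\<bar> = \<bar>m x\<bar> * \<bar>(f n x - f' x) * (g n x - g' x) + (f n x - f' x) * g' x + f' x * (g n x - g' x)\<bar>"
        unfolding abs_mult[symmetric] by (simp add: algebra_simps)
      also have "\<dots> \<le> B * (\<bar>(f n x - f' x) * (g n x - g' x)\<bar> + \<bar>(f n x - f' x) * g' x\<bar> + \<bar>f' x * (g n x - g' x)\<bar>)"
        by (intro mult_mono m(2) B order_trans[OF abs_triangle_ineq] add_mono order_refl abs_ge_zero)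
      finally show "\<bar>m x * f n x * g n x - m x * f' x * g' x\<bar> \<le> \<dots>" .
    qed
    also have "\<dots> = B * ((LBINT x. \<bar>(f n x - f' x) * (g n x - g' x)\<bar>) + (LBINT x. \<bar>(f n x - f' x) * g' x\<bar>) + (LBINT x. \<bar>f' x * (g n x - g' x)\<bar>))"
      by (simp only: integral_mult_right_zero Bochner_Integration.integral_add Bochner_Integration.integrable_add
          integrable_abs[OF L2_integrable_mult] L)
    also have "\<dots> \<le> B * (sqrt (?F n) * sqrt (?G n) + sqrt (?F n) * sqrt ?g + sqrt ?f * sqrt (?G n))"
      using B L by (intro mult_left_mono add_mono cs) auto
    finally show ?thesis .
  qed
  have "(\<lambda>n. B * (sqrt (?F n) * sqrt (?G n) + sqrt (?F n) * sqrt ?g + sqrt ?f * sqrt (?G n))) \<longlonglongrightarrow> 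
      B * (sqrt 0 * sqrt 0 + sqrt 0 * sqrt ?g + sqrt ?f * sqrt 0)"
    using f g unfolding L2_lim_def
    by (intro tendsto_mult tendsto_add tendsto_const tendsto_real_sqrt) blast+
  then have 0: "(\<lambda>n. B * (sqrt (?F n) * sqrt (?G n) + sqrt (?F n) * sqrt ?g + sqrt ?f * sqrt (?G n))) \<longlonglongrightarrow> 0"
    by (simp only: real_sqrt_zero mult_zero_left mult_zero_right add_0_right)
  have "(\<lambda>n. (LBINT x. m x * f n x * g n x) - (LBINT x. m x * f' x * g' x)) \<longlonglongrightarrow> 0"
    by (rule Lim_null_comparison[OF always_eventually 0]) (intro allI, unfold real_norm_def, rule bd)
  then show ?thesis by (rule LIM_zero_cancel)
qed

lemma test_function_L2:
  assumes "test_function f" shows "f \<in> L2"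
proof -
  have "test_function (\<lambda>x. f x * f x)" using assms by (intro test_function_mult_smooth test_function_smooth)
  from test_function_integrable[OF this] show ?thesis
    using test_function_smooth[OF assms] by (simp add: L2_real_iff power2_eq_square)
qed

text \<open>Values are clamped and the support is cut off first, with error below e/4. The truncated
  function is bounded on a ball, so almost everywhere convergence of continuous functions to f
  becomes L^2 convergence after the same truncation, again with error below e/4; (a + b)^2 <= 2 a^2
  + 2 b^2 combines the two.\<close>

lemma L2_approx_continuous:
  fixes f :: "real^'n::finite \<Rightarrow> real"
  assumes f: "f \<in> L2" and e: "e > 0"
  obtains g R where "g \<in> L2" "continuous_on UNIV g" "R > 0" "\<And>x. norm x \<ge> R \<Longrightarrow> g x = 0"
    "(LBINT x. (f x - g x)\<^sup>2) < e"
proof -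
  have [measurable]: "f \<in> borel_measurable borel" using L2_borel[OF f] .
  \<comment> \<open>Lebesgue measurability yields continuous functions \<open>h n\<close> that
    converge to f off a negligible set.\<close>
  have "f \<in> borel_measurable lebesgue" by (rule measurable_completion) simp
  then have "f measurable_on UNIV" by (intro lebesgue_measurable_imp_measurable_on_real) auto
  then obtain N h where N: "negligible N" and h: "\<And>n. continuous_on UNIV (h n)"
    and lim: "\<And>x. x \<notin> N \<Longrightarrow> (\<lambda>n. h n x) \<longlonglongrightarrow> f x"
    by (auto simp: measurable_on_def)
  have [measurable]: "h n \<in> borel_measurable borel" for n using h by (rule borel_measurable_continuous_onI)
  have AEN: "AE x in lborel. x \<notin> N"
  proof -
    have "N \<in> null_sets lebesgue" using N by (simp add: negligible_iff_null_sets)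
    then have "AE x in lebesgue. x \<notin> N" by (rule AE_not_in)
    then show ?thesis by (simp add: AE_completion_iff)
  qed
  \<comment> \<open>\<open>cl M\<close> clamps values to [-M, M] and \<open>ct M\<close> is a tent
    cutoff, 1 on the ball of radius M and 0 beyond M + 1. Both are continuous, so truncating
    \<open>h n\<close> keeps it continuous.\<close>
  define cl :: "nat \<Rightarrow> real \<Rightarrow> real" where "cl M y = max (- real M) (min (real M) y)" for M y
  define ct :: "nat \<Rightarrow> real^'n \<Rightarrow> real" where "ct M x = max 0 (min 1 (real M + 1 - norm x))" for M x
  have ct: "0 \<le> ct M x" "ct M x \<le> 1" "norm x \<ge> real M + 1 \<Longrightarrow> ct M x = 0" "norm x \<le> real M \<Longrightarrow> ct M x = 1" for M x
    by (auto simp: ct_def)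
  have cl: "\<bar>cl M y\<bar> \<le> real M" "\<bar>cl M y\<bar> \<le> \<bar>y\<bar>" for M y by (auto simp: cl_def)
  have [measurable]: "cl M \<in> borel_measurable borel" "ct M \<in> borel_measurable borel" for M
    unfolding cl_def ct_def by measurable
  have ccl: "continuous_on A (cl M)" for M A unfolding cl_def by (intro continuous_intros)
  have cct: "continuous_on A (ct M)" for M A unfolding ct_def by (intro continuous_intros)
  have "(\<lambda>M. LBINT x. (f x - cl M (f x) * ct M x)\<^sup>2) \<longlonglongrightarrow> (\<integral>x. 0 \<partial>(lborel :: (real^'n) measure))"
  proof (rule integral_dominated_convergence[where w = "\<lambda>x. 4 * (f x)\<^sup>2"])
    show "integrable lborel (\<lambda>x. 4 * (f x)\<^sup>2)" using L2_integrable_sq[OF f] by simp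
    show "AE x in lborel. (\<lambda>M. (f x - cl M (f x) * ct M x)\<^sup>2) \<longlonglongrightarrow> 0"
    proof (rule AE_I2)
      fix x
      have "\<forall>\<^sub>F M in sequentially. real M \<ge> \<bar>f x\<bar> \<and> real M \<ge> norm x"
        using eventually_ge_at_top[of "nat \<lceil>\<bar>f x\<bar>\<rceil> + nat \<lceil>norm x\<rceil>"]
        by eventually_elim linarith
      then have "\<forall>\<^sub>F M in sequentially. 0 = (f x - cl M (f x) * ct M x)\<^sup>2"
        by eventually_elim (auto simp: cl_def ct)
      then show "(\<lambda>M. (f x - cl M (f x) * ct M x)\<^sup>2) \<longlonglongrightarrow> 0"
        by (rule Lim_transform_eventually[OF tendsto_const])
    qed
    show "AE x in lborel. norm ((f x - cl M (f x) * ct M x)\<^sup>2) \<le> 4 * (f x)\<^sup>2" for M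
    proof (rule AE_I2)
      fix x
      have "\<bar>cl M (f x) * ct M x\<bar> \<le> \<bar>f x\<bar> * 1"
        unfolding abs_mult using cl(2)[of M "f x"] ct(1,2)[of M x] by (intro mult_mono) auto
      then have "\<bar>f x - cl M (f x) * ct M x\<bar> \<le> \<bar>2 * f x\<bar>" by simp
      then have "(f x - cl M (f x) * ct M x)\<^sup>2 \<le> (2 * f x)\<^sup>2" by (rule abs_le_square_iff[THEN iffD1])
      then show "norm ((f x - cl M (f x) * ct M x)\<^sup>2) \<le> 4 * (f x)\<^sup>2" by simp
    qed
  qed measurable
  note lim0 = this[unfolded Bochner_Integration.integral_zero]
  have "\<forall>\<^sub>F M in sequentially. (LBINT x. (f x - cl M (f x) * ct M x)\<^sup>2) < e / 4"
    by (rule order_tendstoD(2)[OF lim0]) (use e in simp)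
  then obtain M where M: "(LBINT x. (f x - cl M (f x) * ct M x)\<^sup>2) < e / 4"
    unfolding eventually_sequentially by blast
  have fin: "integrable lborel (\<lambda>x::real^'n. c * indicator (cball 0 (real M + 1)) x)" for c :: real
    using emeasure_lborel_cball_finite[of "0::real^'n" "real M + 1"] by simp
  have bdd: "\<bar>cl M y * ct M x\<bar> \<le> real M * indicator (cball 0 (real M + 1)) x" for y x
  proof (cases "norm x \<le> real M + 1")
    case True
    have "\<bar>cl M y * ct M x\<bar> \<le> real M * 1"
      unfolding abs_mult using cl(1)[of M y] ct(1,2)[of M x] by (intro mult_mono) auto
    then show ?thesis using True by simp
  qed (use ct(3)[of M x] in auto)
  have L2: "(\<lambda>x. cl M (k x) * ct M x) \<in> L2" if [measurable]: "k \<in> borel_measurable borel" for k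
  proof -
    have "integrable lborel (\<lambda>x. (cl M (k x) * ct M x)\<^sup>2)"
    proof (rule Bochner_Integration.integrable_bound[OF fin[of "(real M)\<^sup>2"]])
      have "(cl M (k x) * ct M x)\<^sup>2 \<le> (real M * indicator (cball 0 (real M + 1)) x)\<^sup>2" for x
        using bdd[of "k x" x] by (intro abs_le_square_iff[THEN iffD1]) simp
      moreover have "(real M * indicator (cball 0 (real M + 1)) x)\<^sup>2 = (real M)\<^sup>2 * indicat_real (cball 0 (real M + 1)) x" for x :: "real^'n"
        by (simp add: power_mult_distrib indicator_def)
      ultimately show "AE x in lborel. norm ((cl M (k x) * ct M x)\<^sup>2) \<le> norm ((real M)\<^sup>2 * indicat_real (cball 0 (real M + 1)) x)"
        by (intro AE_I2) simp
    qed measurable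
    then show ?thesis by (simp add: L2_real_iff)
  qed
  have "(\<lambda>n. LBINT x. (cl M (f x) * ct M x - cl M (h n x) * ct M x)\<^sup>2) \<longlonglongrightarrow> (\<integral>x. 0 \<partial>(lborel :: (real^'n) measure))"
  proof (rule integral_dominated_convergence[where w = "\<lambda>x. (2 * real M)\<^sup>2 * indicator (cball 0 (real M + 1)) x"])
    show "AE x in lborel. (\<lambda>n. (cl M (f x) * ct M x - cl M (h n x) * ct M x)\<^sup>2) \<longlonglongrightarrow> 0"
      using AEN
    proof eventually_elim
      case (elim x)
      have "(\<lambda>n. cl M (h n x)) \<longlonglongrightarrow> cl M (f x)"
        using continuous_on_tendsto_compose[OF ccl[of UNIV M] lim[OF elim]] by simp
      then have "(\<lambda>n. (cl M (f x) * ct M x - cl M (h n x) * ct M x)\<^sup>2) \<longlonglongrightarrow> (cl M (f x) * ct M x - cl M (f x) * ct M x)\<^sup>2"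
        by (intro tendsto_intros)
      then show ?case by simp
    qed
    show "AE x in lborel. norm ((cl M (f x) * ct M x - cl M (h n x) * ct M x)\<^sup>2) \<le> (2 * real M)\<^sup>2 * indicator (cball 0 (real M + 1)) x" for n
    proof (rule AE_I2)
      fix x
      have "(cl M (f x) * ct M x - cl M (h n x) * ct M x)\<^sup>2 \<le> (2 * (real M * indicator (cball 0 (real M + 1)) x))\<^sup>2"
        using bdd[of "f x" x] bdd[of "h n x" x] by (intro abs_le_square_iff[THEN iffD1]) simp
      moreover have "(2 * (real M * indicator (cball 0 (real M + 1)) x))\<^sup>2 = (2 * real M)\<^sup>2 * indicat_real (cball 0 (real M + 1)) x"
        by (simp add: power_mult_distrib indicator_def)
      ultimately show "norm ((cl M (f x) * ct M x - cl M (h n x) * ct M x)\<^sup>2) \<le> (2 * real M)\<^sup>2 * indicator (cball 0 (real M + 1)) x"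
        by simp
    qed
    show "integrable lborel (\<lambda>x::real^'n. (2 * real M)\<^sup>2 * indicator (cball 0 (real M + 1)) x)" by (rule fin)
  qed measurable
  note lim0 = this[unfolded Bochner_Integration.integral_zero]
  have "\<forall>\<^sub>F n in sequentially. (LBINT x. (cl M (f x) * ct M x - cl M (h n x) * ct M x)\<^sup>2) < e / 4"
    by (rule order_tendstoD(2)[OF lim0]) (use e in simp)
  then obtain n where n: "(LBINT x. (cl M (f x) * ct M x - cl M (h n x) * ct M x)\<^sup>2) < e / 4"
    unfolding eventually_sequentially by blast
  let ?g = "\<lambda>x. cl M (h n x) * ct M x" and ?k = "\<lambda>x. cl M (f x) * ct M x"
  have Lg: "?g \<in> L2" and Lk: "?k \<in> L2" using L2 by auto
  have "(LBINT x. (f x - ?g x)\<^sup>2) \<le> (LBINT x. 2 * (f x - ?k x)\<^sup>2 + 2 * (?k x - ?g x)\<^sup>2)"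
  proof (rule integral_mono)
    fix x
    have "((f x - ?k x) + (?k x - ?g x))\<^sup>2 \<le> 2 * (f x - ?k x)\<^sup>2 + 2 * (?k x - ?g x)\<^sup>2"
      using sum_squares_bound[of "f x - ?k x" "?k x - ?g x"] by (simp only: power2_sum)
    then show "(f x - ?g x)\<^sup>2 \<le> 2 * (f x - ?k x)\<^sup>2 + 2 * (?k x - ?g x)\<^sup>2" by simp
  qed (intro L2_integrable_sq L2_diff f Lg Lk Bochner_Integration.integrable_add integrable_mult_right)+
  also have "\<dots> = 2 * (LBINT x. (f x - ?k x)\<^sup>2) + 2 * (LBINT x. (?k x - ?g x)\<^sup>2)"
    using L2_integrable_sq[OF L2_diff[OF f Lk]] L2_integrable_sq[OF L2_diff[OF Lk Lg]] by simp
  also have "\<dots> < e" using M n by linarith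
  finally have "(LBINT x. (f x - ?g x)\<^sup>2) < e" .
  moreover have "continuous_on UNIV ?g"
    by (intro continuous_on_mult cct continuous_on_compose2[OF ccl[of UNIV] h]) auto
  ultimately show ?thesis using that[of ?g "real M + 1"] Lg ct(3)[of M] by auto
qed

section \<open>Convolution of an L^2 function with a test function\<close>

definition conv :: "(real^'n::finite \<Rightarrow> real) \<Rightarrow> (real^'n \<Rightarrow> real) \<Rightarrow> real^'n \<Rightarrow> real" where
  "conv \<phi> f x = (LBINT y. \<phi> (x - y) * f y)"

lemma conv_integrable:
  assumes "test_function \<phi>" "f \<in> L2"
  shows "integrable lborel (\<lambda>y. \<phi> (x - y) * f y)"
  by (intro L2_integrable_mult test_function_L2 test_function_reflect assms)

text \<open>The uniform Taylor remainder of \<phi> is integrated against f: it is at most C |h|^2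
  and vanishes outside a fixed ball around x, on which f is integrable.\<close>

lemma conv_has_derivative:
  fixes \<phi> :: "real^'n::finite \<Rightarrow> real"
  assumes \<phi>: "test_function \<phi>" and f: "f \<in> L2"
  shows "(conv \<phi> f has_derivative (\<lambda>h. \<Sum>i\<in>UNIV. h $ i * conv (partial_deriv i \<phi>) f x)) (at x)"
proof -
  have [measurable]: "f \<in> borel_measurable borel" using f L2_borel by blast
  have d\<phi>: "test_function (partial_deriv i \<phi>)" for i using \<phi> test_function_partial_deriv by blast
  obtain R where R: "R > 0" "\<And>x. norm x \<ge> R \<Longrightarrow> \<phi> x = 0" using test_function_support[OF \<phi>] by metis
  have "\<exists>S>0. \<forall>x. norm x \<ge> S \<longrightarrow> partial_deriv i \<phi> x = 0" for i using test_function_support[OF d\<phi>] by metis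
  then obtain S where S: "\<And>i. S i > 0" "\<And>i x. norm x \<ge> S i \<Longrightarrow> partial_deriv i \<phi> x = 0" by metis
  \<comment> \<open>T exceeds R by at least 1, so for |h| <= 1 the shifted \<phi>, \<phi> itself and
    its partial derivatives all vanish at x - y once |x - y| > T.\<close>
  define T where "T = R + (\<Sum>i\<in>UNIV. S i) + 1"
  have ST: "S i \<le> T" "R + 1 \<le> T" for i
    using member_le_sum[of i UNIV S] S(1) R(1) by (auto simp: T_def less_imp_le intro!: sum_nonneg add_increasing add_increasing2)
  obtain C where C: "C > 0"
    "\<And>x h. \<bar>\<phi> (x + h) - \<phi> x - (\<Sum>i\<in>UNIV. h $ i * partial_deriv i \<phi> x)\<bar> \<le> C * (norm h)\<^sup>2"
    using test_function_Taylor[OF \<phi>] by metis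
  have ind: "(\<lambda>y. indicator (cball x T) y) \<in> (L2 :: (real^'n \<Rightarrow> real) set)"
  proof -
    have "(\<lambda>y. (indicat_real (cball x T) y)\<^sup>2) = indicator (cball x T)"
      by (auto simp: indicator_def fun_eq_iff)
    moreover have "indicat_real (cball x T) \<in> borel_measurable borel" by (intro borel_measurable_indicator) simp
    ultimately show ?thesis using emeasure_lborel_cball_finite[of x T] by (simp add: L2_real_iff)
  qed
  define K where "K = (LBINT y. indicator (cball x T) y * \<bar>f y\<bar>)"
  have Ki: "integrable lborel (\<lambda>y. indicator (cball x T) y * \<bar>f y\<bar>)"
    by (intro L2_integrable_mult ind L2_mono[OF f, of _ 1]) auto
  have K: "K \<ge> 0" unfolding K_def by (intro Bochner_Integration.integral_nonneg) auto
  let ?D = "\<lambda>h. \<Sum>i\<in>UNIV. h $ i * conv (partial_deriv i \<phi>) f x"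
  have bd: "\<bar>conv \<phi> f (x + h) - conv \<phi> f x - ?D h\<bar> \<le> C * K * (norm h)\<^sup>2" if h: "norm h \<le> 1" for h
  proof -
    let ?r = "\<lambda>y. (\<phi> ((x - y) + h) - \<phi> (x - y) - (\<Sum>i\<in>UNIV. h $ i * partial_deriv i \<phi> (x - y)))"
    have i1: "integrable lborel (\<lambda>y. \<phi> (x + h - y) * f y)" "integrable lborel (\<lambda>y. \<phi> (x - y) * f y)"
      "\<And>i. integrable lborel (\<lambda>y. partial_deriv i \<phi> (x - y) * f y)"
      by (intro conv_integrable \<phi> f d\<phi>)+
    have eq: "?r y * f y = \<phi> (x + h - y) * f y - \<phi> (x - y) * f y - (\<Sum>i\<in>UNIV. h $ i * (partial_deriv i \<phi> (x - y) * f y))" for y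
      by (simp add: left_diff_distrib sum_distrib_right mult.assoc add_diff_eq add.commute diff_add_eq)
    have i2: "integrable lborel (\<lambda>y. ?r y * f y)"
      unfolding eq by (intro Bochner_Integration.integrable_diff Bochner_Integration.integrable_sum integrable_mult_right i1)
    have "(LBINT y. ?r y * f y) = conv \<phi> f (x + h) - conv \<phi> f x - ?D h"
      unfolding eq conv_def
      by (simp only: Bochner_Integration.integral_diff Bochner_Integration.integrable_diff Bochner_Integration.integrable_sum
           Bochner_Integration.integral_sum integrable_mult_right integral_mult_right_zero i1)
    moreover have "\<bar>LBINT y. ?r y * f y\<bar> \<le> (LBINT y. \<bar>?r y * f y\<bar>)" by (rule integral_abs_bound)
    moreover have "(LBINT y. \<bar>?r y * f y\<bar>) \<le> (LBINT y. (C * (norm h)\<^sup>2) * (indicator (cball x T) y * \<bar>f y\<bar>))"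
    proof (rule integral_mono[OF integrable_abs[OF i2] integrable_mult_right[OF Ki]])
      fix y
      show "\<bar>?r y * f y\<bar> \<le> (C * (norm h)\<^sup>2) * (indicator (cball x T) y * \<bar>f y\<bar>)"
      proof (cases "y \<in> cball x T")
        case True
        then show ?thesis using C(2)[of "x - y" h] by (simp add: abs_mult mult_right_mono)
      next
        case False
        then have y: "norm (x - y) > T" by (simp add: dist_norm)
        have "norm (x - y) \<le> norm (x - y + h) + norm h"
          by (metis add_diff_cancel_right' norm_triangle_ineq4)
        then have "norm (x - y + h) \<ge> R" using y h ST(2) by linarith
        moreover have "norm (x - y) \<ge> R" "\<And>i. norm (x - y) \<ge> S i" using y ST less_imp_le order_trans by (fastforce, metis less_imp_le order_trans)
        ultimately show ?thesis using R(2) S(2) False by simp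
      qed
    qed
    moreover have "(LBINT y. (C * (norm h)\<^sup>2) * (indicator (cball x T) y * \<bar>f y\<bar>)) = C * K * (norm h)\<^sup>2"
      unfolding K_def integral_mult_right_zero by (simp only: mult_ac)
    ultimately show ?thesis by linarith
  qed
  show ?thesis
    unfolding has_derivative_at
  proof
    show "bounded_linear ?D"
      by (intro bounded_linear_sum bounded_linear_mult_const bounded_linear_vec_nth)
    show "(\<lambda>h. norm (conv \<phi> f (x + h) - conv \<phi> f x - ?D h) / norm h) \<midarrow>0\<rightarrow> 0"
    proof (rule tendsto_sandwich[OF _ _ tendsto_const])
      show "\<forall>\<^sub>F h in at 0. 0 \<le> norm (conv \<phi> f (x + h) - conv \<phi> f x - ?D h) / norm h" by simp
      show "\<forall>\<^sub>F h in at 0. norm (conv \<phi> f (x + h) - conv \<phi> f x - ?D h) / norm h \<le> C * K * norm h"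
        unfolding eventually_at
      proof (intro exI[of _ 1] conjI ballI impI)
        fix h :: "real^'n" assume "h \<noteq> 0 \<and> dist h 0 < 1"
        then show "norm (conv \<phi> f (x + h) - conv \<phi> f x - ?D h) / norm h \<le> C * K * norm h"
          using bd[of h] by (simp add: divide_le_eq power2_eq_square mult.assoc)
      qed simp
      have "((\<lambda>h::real^'n. C * K * norm h) \<longlongrightarrow> C * K * norm (0::real^'n)) (at 0)"
        by (intro tendsto_intros)
      then show "((\<lambda>h::real^'n. C * K * norm h) \<longlongrightarrow> 0) (at 0)" by simp
    qed
  qed
qed

lemma partial_deriv_conv:
  "test_function \<phi> \<Longrightarrow> f \<in> L2 \<Longrightarrow> partial_deriv i (conv \<phi> f) = conv (partial_deriv i \<phi>) f"
proof
  fix x assume a: "test_function \<phi>" "f \<in> L2"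
  let ?c = "\<lambda>j. conv (partial_deriv j \<phi>) f x"
  have "partial_deriv i (conv \<phi> f) x = (\<Sum>j\<in>UNIV. axis i 1 $ j * ?c j)"
    by (rule partial_deriv_eq[OF conv_has_derivative[OF a]])
  also have "\<dots> = (\<Sum>j\<in>UNIV. if j = i then ?c j else 0)"
    by (intro sum.cong) (auto simp: axis_def)
  finally show "partial_deriv i (conv \<phi> f) x = conv (partial_deriv i \<phi>) f x" by simp
qed

text \<open>Derivatives fall on \<phi>, which stays a test function, so the induction over the order
  runs for arbitrary \<phi> while f is merely in \<open>L2\<close>.\<close>

lemma smooth_conv:
  assumes "test_function \<phi>" "f \<in> L2" shows "smooth (conv \<phi> f)"
proof -
  have "C_k k (conv \<phi> f)" if "test_function \<phi>" for k \<phi>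
    using that
  proof (induction k arbitrary: \<phi>)
    case 0
    then show ?case
      using conv_has_derivative[OF 0 assms(2)] 
      by (auto simp: continuous_on_eq_continuous_within intro!: has_derivative_continuous)
  next
    case (Suc k)
    have "conv \<phi> f differentiable (at x)" for x
      using conv_has_derivative[OF Suc.prems assms(2)] by (rule differentiableI)
    then show ?case using Suc by (simp add: partial_deriv_conv[OF _ assms(2)] test_function_partial_deriv)
  qed
  then show ?thesis using assms(1) by (simp add: smooth_def)
qed

definition weak_partial :: "'n::finite \<Rightarrow> (real^'n \<Rightarrow> real) \<Rightarrow> (real^'n \<Rightarrow> real) \<Rightarrow> bool" where
  "weak_partial i u g \<longleftrightarrow> (\<forall>\<phi>. test_function \<phi> \<longrightarrow>
     (LBINT x. partial_deriv i \<phi> x * u x) = - (LBINT x. \<phi> x * g x))"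

text \<open>The definition of the weak derivative is applied to the reflected function y -> \<phi>(x
  - y); the sign from the reflection cancels the one from integration by parts.\<close>

lemma conv_weak_partial:
  assumes "weak_partial i u g" "test_function \<phi>"
  shows "conv (partial_deriv i \<phi>) u = conv \<phi> g"
proof
  fix x
  have "(LBINT y. partial_deriv i (\<lambda>y. \<phi> (x - y)) y * u y) = - (LBINT y. \<phi> (x - y) * g y)"
    using assms test_function_reflect unfolding weak_partial_def by blast
  then show "conv (partial_deriv i \<phi>) u x = conv \<phi> g x"
    using assms(2) by (simp add: partial_deriv_reflect test_function_smooth conv_def)
qed

section \<open>Mollifiers and their convergence in L^2\<close>

definition moll :: "nat \<Rightarrow> real^'n::finite \<Rightarrow> real" where
  "moll n x = bump (1 / real (Suc n)) x * (1 / (LBINT y. bump (1 / real (Suc n)) (y :: real^'n)))"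

text \<open>A vanishing integral would force the nonnegative bump to vanish almost everywhere and
  make a nonempty open ball negligible.\<close>

lemma integral_bump_pos:
  assumes "\<delta> > 0" shows "(LBINT y. bump \<delta> (y :: real^'n::finite)) > 0"
proof -
  have i: "integrable lborel (bump \<delta> :: real^'n \<Rightarrow> real)"
    using assms by (intro test_function_integrable bump_test_function)
  have "(LBINT y. bump \<delta> (y :: real^'n)) \<noteq> 0"
  proof
    assume "(LBINT y. bump \<delta> (y :: real^'n)) = 0"
    then have "AE y in lborel. bump \<delta> (y :: real^'n) = 0"
      using integral_nonneg_eq_0_iff_AE[OF i] bump_nonneg by auto
    then have "AE y in lborel. (y :: real^'n) \<notin> ball 0 \<delta>"
      by eventually_elim (use bump_neq_0_iff[OF assms] in auto)
    then have "emeasure lborel (ball (0::real^'n) \<delta>) = 0"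
      by (subst (asm) AE_iff_measurable[of "ball 0 \<delta>"]) auto
    then have "negligible (ball (0::real^'n) \<delta>)"
      unfolding negligible_iff_null_sets by (intro null_sets_completionI null_setsI) auto
    then show False using assms open_not_negligible[OF open_ball, of "0::real^'n" \<delta>] by simp
  qed
  moreover have "(LBINT y. bump \<delta> (y :: real^'n)) \<ge> 0"
    by (intro Bochner_Integration.integral_nonneg bump_nonneg)
  ultimately show ?thesis by linarith
qed

lemma moll_test_function: "test_function (moll n)"
  unfolding moll_def
  by (intro test_function_mult_smooth bump_test_function smooth_const) simp

lemma moll_nonneg: "moll n x \<ge> 0"
  unfolding moll_def by (intro mult_nonneg_nonneg bump_nonneg divide_nonneg_nonneg Bochner_Integration.integral_nonneg) auto

lemma moll_integral: "(LBINT x. moll n (x::real^'n::finite)) = 1"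
  using integral_bump_pos[of "1 / real (Suc n)", where 'n = 'n] by (simp add: moll_def del: of_nat_Suc)

lemma moll_eq_0: "norm x \<ge> 1 / real (Suc n) \<Longrightarrow> moll n x = 0"
  using bump_neq_0_iff[of "1 / real (Suc n)" x] by (auto simp: moll_def not_less[symmetric] simp del: of_nat_Suc)

lemma moll_partial_commute:
  "partial_deriv j (partial_deriv i (moll n)) = partial_deriv i (partial_deriv j (moll n :: real^'n::finite \<Rightarrow> real))"
proof -
  let ?c = "1 / (LBINT y. bump (1 / real (Suc n)) (y :: real^'n))" and ?b = "bump (1 / real (Suc n)) :: real^'n \<Rightarrow> real"
  have m: "moll n = (\<lambda>x::real^'n. ?c * ?b x)" by (simp add: moll_def fun_eq_iff)
  have 1: "partial_deriv i (\<lambda>x. c * f x) = (\<lambda>x. c * partial_deriv i f x)" if "smooth f" for i c and f :: "real^'n \<Rightarrow> real"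
    using that by (auto simp: fun_eq_iff intro!: partial_deriv_cmult smooth_differentiable)
  show ?thesis unfolding m by (simp only: 1 smooth_bump smooth_partial_deriv partial_deriv_bump_commute[of i j])
qed

lemma moll_reflect_integral: "(LBINT y. moll n (x - y :: real^'n::finite)) = 1"
  using lborel_affine_integral[of "moll n" "-1" x] moll_integral[of n, where 'n = 'n]
  by (simp add: smooth_borel test_function_smooth[OF moll_test_function])

text \<open>Jensen's inequality for the probability density y -> \<open>moll n (x - y)\<close>,
  obtained from the nonnegativity of the variance of f under that density.\<close>

lemma conv_moll_square_le:
  fixes f :: "real^'n::finite \<Rightarrow> real"
  assumes f: "f \<in> L2"
  shows "(conv (moll n) f x)\<^sup>2 \<le> (LBINT y. moll n (x - y) * (f y)\<^sup>2)"
    and "integrable lborel (\<lambda>y. moll n (x - y) * (f y)\<^sup>2)"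
proof -
  let ?m = "\<lambda>y. moll n (x - y)"
  have tm: "test_function ?m" by (intro test_function_reflect moll_test_function)
  have [measurable]: "f \<in> borel_measurable borel" "?m \<in> borel_measurable borel"
    using f L2_borel tm by (auto intro: smooth_borel test_function_smooth)
  obtain B where B: "\<And>y. \<bar>?m y\<bar> \<le> B" using test_function_bounded[OF tm] by metis
  have i: "integrable lborel (\<lambda>y. ?m y * (f y)\<^sup>2)"
    using L2_integrable_mult3[OF f f _ B] by (simp add: power2_eq_square mult.assoc)
  then show "integrable lborel (\<lambda>y. moll n (x - y) * (f y)\<^sup>2)" .
  let ?c = "conv (moll n) f x"
  have i2: "integrable lborel (\<lambda>y. ?m y * f y)" by (intro conv_integrable moll_test_function f)
  have i3: "integrable lborel ?m" by (intro test_function_integrable tm)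
  have "0 \<le> (LBINT y. ?m y * (f y - ?c)\<^sup>2)"
    by (intro Bochner_Integration.integral_nonneg mult_nonneg_nonneg moll_nonneg) auto
  also have "\<dots> = (LBINT y. ?m y * (f y)\<^sup>2 - 2 * ?c * (?m y * f y) + ?c\<^sup>2 * ?m y)"
    by (intro Bochner_Integration.integral_cong) (auto simp: power2_diff algebra_simps)
  also have "\<dots> = (LBINT y. ?m y * (f y)\<^sup>2) - 2 * ?c * ?c + ?c\<^sup>2 * 1"
    using i i2 i3 by (simp add: moll_reflect_integral conv_def[symmetric])
  finally show "?c\<^sup>2 \<le> (LBINT y. ?m y * (f y)\<^sup>2)" by (simp add: power2_eq_square)
qed

text \<open>Jensen's bound is integrated over x and the order of integration exchanged; the
  mollifier has mass 1 in either variable.\<close>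

lemma conv_moll_L2:
  fixes f :: "real^'n::finite \<Rightarrow> real"
  assumes f: "f \<in> L2"
  shows "conv (moll n) f \<in> L2" "(LBINT x. (conv (moll n) f x)\<^sup>2) \<le> (LBINT x. (f x)\<^sup>2)"
proof -
  have [measurable]: "f \<in> borel_measurable borel" using f L2_borel by blast
  have m [measurable]: "moll n \<in> borel_measurable (borel :: (real^'n) measure)"
    by (intro smooth_borel test_function_smooth moll_test_function)
  have c [measurable]: "conv (moll n) f \<in> borel_measurable borel"
    by (intro smooth_borel smooth_conv moll_test_function f)
  have "(\<integral>\<^sup>+x. ennreal ((conv (moll n) f x)\<^sup>2) \<partial>lborel) \<le> (\<integral>\<^sup>+x. \<integral>\<^sup>+y. ennreal (moll n (x - y)) * ennreal ((f y)\<^sup>2) \<partial>lborel \<partial>lborel)"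
  proof (rule nn_integral_mono)
    fix x
    have "ennreal ((conv (moll n) f x)\<^sup>2) \<le> ennreal (LBINT y. moll n (x - y) * (f y)\<^sup>2)"
      using conv_moll_square_le(1)[OF f] by (rule ennreal_leI)
    also have "\<dots> = (\<integral>\<^sup>+y. ennreal (moll n (x - y) * (f y)\<^sup>2) \<partial>lborel)"
      by (rule nn_integral_eq_integral[symmetric, OF conv_moll_square_le(2)[OF f]])
         (auto intro!: mult_nonneg_nonneg moll_nonneg)
    finally show "ennreal ((conv (moll n) f x)\<^sup>2) \<le> (\<integral>\<^sup>+y. ennreal (moll n (x - y)) * ennreal ((f y)\<^sup>2) \<partial>lborel)"
      by (simp add: ennreal_mult moll_nonneg)
  qed
  also have "\<dots> = (\<integral>\<^sup>+y. \<integral>\<^sup>+x. ennreal (moll n (x - y)) * ennreal ((f y)\<^sup>2) \<partial>lborel \<partial>lborel)"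
    by (rule lborel_pair.Fubini'[symmetric]) measurable
  also have "\<dots> = (\<integral>\<^sup>+y. ennreal ((f y)\<^sup>2) \<partial>lborel)"
  proof (rule nn_integral_cong)
    fix y :: "real^'n"
    have "(\<integral>\<^sup>+x. ennreal (moll n (x - y)) \<partial>lborel) = ennreal (LBINT x. moll n (x - y))"
      using lborel_affine_integrable[OF test_function_integrable[OF moll_test_function[of n]], of 1 "- y"]
      by (intro nn_integral_eq_integral) (auto simp: moll_nonneg)
    also have "(LBINT x. moll n (x - y)) = 1"
      using lborel_affine_integral[OF m, of 1 "- y"] moll_integral[of n, where 'n = 'n] by simp
    finally show "(\<integral>\<^sup>+x. ennreal (moll n (x - y)) * ennreal ((f y)\<^sup>2) \<partial>lborel) = ennreal ((f y)\<^sup>2)"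
      by (simp add: nn_integral_multc)
  qed
  also have "\<dots> = ennreal (LBINT y. (f y)\<^sup>2)"
    by (rule nn_integral_eq_integral[OF L2_integrable_sq[OF f]]) auto
  finally have le: "(\<integral>\<^sup>+x. ennreal ((conv (moll n) f x)\<^sup>2) \<partial>lborel) \<le> ennreal (LBINT y. (f y)\<^sup>2)" .
  then have "(\<integral>\<^sup>+x. ennreal (norm ((conv (moll n) f x)\<^sup>2)) \<partial>lborel) < \<infinity>"
    using le_less_trans ennreal_less_top by fastforce
  then have i: "integrable lborel (\<lambda>x. (conv (moll n) f x)\<^sup>2)"
    by (intro integrableI_bounded) auto
  then show "conv (moll n) f \<in> L2" by (simp add: L2_real_iff c)
  show "(LBINT x. (conv (moll n) f x)\<^sup>2) \<le> (LBINT x. (f x)\<^sup>2)"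
    using le by (subst (asm) nn_integral_eq_integral[OF i]) (auto simp: ennreal_le_iff Bochner_Integration.integral_nonneg)
qed

lemma conv_diff_right:
  "test_function \<phi> \<Longrightarrow> f \<in> L2 \<Longrightarrow> g \<in> L2 \<Longrightarrow> conv \<phi> (\<lambda>x. f x - g x) x = conv \<phi> f x - conv \<phi> g x"
  by (simp add: conv_def right_diff_distrib conv_integrable)

text \<open>Uniform continuity makes the convergence uniform. Since the mollifier radius is at most
  1, the difference lives on the ball of radius R + 1, whose finite volume turns the uniform bound
  into an L^2 bound.\<close>

lemma conv_moll_continuous:
  fixes g :: "real^'n::finite \<Rightarrow> real"
  assumes g: "g \<in> L2" "continuous_on UNIV g" and R: "R > 0" "\<And>x. norm x \<ge> R \<Longrightarrow> g x = 0"
  shows "(\<lambda>n. LBINT x. (conv (moll n) g x - g x)\<^sup>2) \<longlonglongrightarrow> 0"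
proof (rule LIMSEQ_I)
  fix e :: real assume e: "e > 0"
  let ?V = "measure lborel (cball (0::real^'n) (R + 1))"
  have V: "?V \<ge> 0" by simp
  \<comment> \<open>Chosen so that d^2 times the volume \<open>?V\<close> is below e; the summand 1
    keeps the denominator positive.\<close>
  define d where "d = sqrt (e / (?V + 1)) / 2"
  have d: "d > 0" using e V by (simp add: d_def add_nonneg_pos)
  have "uniformly_continuous_on (cball 0 (R + 2)) g"
    by (intro compact_uniformly_continuous continuous_on_subset[OF g(2)]) auto
  then obtain \<eta> where \<eta>: "\<eta> > 0" "\<And>x y. x \<in> cball 0 (R+2) \<Longrightarrow> y \<in> cball 0 (R+2) \<Longrightarrow> dist y x < \<eta> \<Longrightarrow> dist (g y) (g x) < d"
    using d unfolding uniformly_continuous_on_def by metis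
  obtain N where N: "1 / real (Suc N) < \<eta>" using \<eta>(1) nat_approx_posE by blast
  have "norm ((LBINT x. (conv (moll n) g x - g x)\<^sup>2) - 0) < e" if n: "n \<ge> N" for n
  proof -
    have n\<eta>: "1 / real (Suc n) < \<eta>" "1 / real (Suc n) \<le> 1"
      using n frac_le[of 1 1 "real (Suc N)" "real (Suc n)"] N by (auto intro: le_less_trans)
    have pw: "\<bar>conv (moll n) g x - g x\<bar> \<le> d * indicator (cball 0 (R + 1)) x" for x
    proof (cases "norm x \<le> R + 1")
      case True
      have "conv (moll n) g x - g x = (LBINT y. moll n (x - y) * g y) - (LBINT y. moll n (x - y) * g x)"
        by (simp add: conv_def moll_reflect_integral)
      also have "\<dots> = (LBINT y. moll n (x - y) * g y - moll n (x - y) * g x)"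
        by (intro Bochner_Integration.integral_diff[symmetric] conv_integrable moll_test_function g integrable_mult_left
             test_function_integrable test_function_reflect)
      also have "\<bar>\<dots>\<bar> \<le> (LBINT y. \<bar>moll n (x - y) * g y - moll n (x - y) * g x\<bar>)" by (rule integral_abs_bound)
      also have "\<dots> \<le> (LBINT y. moll n (x - y) * d)"
      proof (rule integral_mono)
        show "integrable lborel (\<lambda>y. \<bar>moll n (x - y) * g y - moll n (x - y) * g x\<bar>)"
          by (intro integrable_abs Bochner_Integration.integrable_diff conv_integrable moll_test_function g integrable_mult_left
             test_function_integrable test_function_reflect)
        show "integrable lborel (\<lambda>y. moll n (x - y) * d)"
          by (intro integrable_mult_left test_function_integrable test_function_reflect moll_test_function)
        fix y
        show "\<bar>moll n (x - y) * g y - moll n (x - y) * g x\<bar> \<le> moll n (x - y) * d"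
        proof (cases "norm (x - y) \<ge> 1 / real (Suc n)")
          case True then show ?thesis using moll_eq_0[OF True] by simp
        next
          case False
          then have xy: "norm (x - y) < \<eta>" "norm (x - y) \<le> 1" using n\<eta> by linarith+
          have "norm y \<le> norm x + norm (x - y)" by (metis norm_minus_commute norm_triangle_sub)
          then have "norm y \<le> R + 2" using xy True by linarith
          then have "dist (g y) (g x) < d"
            using True xy by (intro \<eta>(2)) (auto simp: dist_norm norm_minus_commute)
          then have "\<bar>g y - g x\<bar> \<le> d" by (simp add: dist_real_def)
          then show ?thesis using moll_nonneg[of n "x - y"]
            by (simp add: abs_mult mult_left_mono flip: right_diff_distrib)
        qed
      qed
      also have "\<dots> = d" by (simp add: moll_reflect_integral)
      finally show ?thesis using True by simp
    next
      case False
      have "moll n (x - y) * g y = 0" for y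
      proof (cases "norm y \<ge> R")
        case True then show ?thesis using R(2) by simp
      next
        case F: False
        have "norm x \<le> norm (x - y) + norm y" by (metis norm_triangle_sub add.commute)
        then have "norm (x - y) \<ge> 1 / real (Suc n)" using F False n\<eta>(2) by linarith
        then have "moll n (x - y) = 0" by (rule moll_eq_0)
        then show ?thesis by simp
      qed
      then have "conv (moll n) g x = 0" unfolding conv_def by (simp only: Bochner_Integration.integral_zero)
      then show ?thesis using False R(2)[of x] by simp
    qed
    have Li: "integrable lborel (\<lambda>x. (conv (moll n) g x - g x)\<^sup>2)"
      by (intro L2_integrable_sq L2_diff conv_moll_L2 g)
    have Vi: "integrable lborel (\<lambda>x::real^'n. d\<^sup>2 * indicator (cball 0 (R + 1)) x)"
      using emeasure_lborel_cball_finite[of "0::real^'n" "R + 1"] by simp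
    have "(LBINT x. (conv (moll n) g x - g x)\<^sup>2) \<le> (LBINT x. d\<^sup>2 * indicator (cball (0::real^'n) (R + 1)) x)"
    proof (rule integral_mono[OF Li Vi])
      fix x
      have "(conv (moll n) g x - g x)\<^sup>2 \<le> (d * indicator (cball 0 (R + 1)) x)\<^sup>2"
        using pw[of x] by (intro abs_le_square_iff[THEN iffD1]) simp
      then show "(conv (moll n) g x - g x)\<^sup>2 \<le> d\<^sup>2 * indicator (cball 0 (R + 1)) x"
        by (auto simp: power_mult_distrib indicator_def split: if_splits)
    qed
    also have "\<dots> = d\<^sup>2 * ?V" by simp
    also have "d\<^sup>2 = e / (?V + 1) / 4" using e V unfolding d_def by (simp add: power_divide)
    also have "e / (?V + 1) / 4 * ?V < e"
    proof -
      have "?V * e < 4 * (e * (?V + 1))" 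
        using e mult_nonneg_nonneg[OF less_imp_le[OF e] V] unfolding distrib_left mult.commute[of ?V e] by linarith
      then show ?thesis using V by (simp add: divide_less_eq add_nonneg_pos mult_ac)
    qed
    finally show ?thesis by (simp add: Bochner_Integration.integral_nonneg)
  qed
  then show "\<exists>N. \<forall>n\<ge>N. norm ((LBINT x. (conv (moll n) g x - g x)\<^sup>2) - 0) < e" by blast
qed

text \<open>Density argument: f is replaced by a continuous function of bounded support, and the L^2
  contraction \<open>conv_moll_L2\<close> controls the mollified error independently of n.\<close>

lemma conv_moll_L2_lim:
  fixes f :: "real^'n::finite \<Rightarrow> real"
  assumes f: "f \<in> L2"
  shows "L2_lim (\<lambda>n. conv (moll n) f) f"
  unfolding L2_lim_def
proof (intro conjI allI f conv_moll_L2(1) LIMSEQ_I)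
  fix e :: real assume "e > 0"
  \<comment> \<open>Three error terms, each with the factor 3 from (p + q - r)^2 <= 3 p^2 + 3 q^2 +
    3 r^2.\<close>
  then have e9: "e / 9 > 0" by simp
  obtain g R where g: "g \<in> L2" "continuous_on UNIV g" "R > 0" "\<And>x. norm x \<ge> R \<Longrightarrow> g x = 0"
    and fg: "(LBINT x. (f x - g x)\<^sup>2) < e / 9"
    using L2_approx_continuous[OF f e9] by metis
  have "\<forall>\<^sub>F n in sequentially. (LBINT x. (conv (moll n) g x - g x)\<^sup>2) < e / 9"
    by (rule order_tendstoD(2)[OF conv_moll_continuous[OF g] e9])
  then obtain N where N: "\<And>n. n \<ge> N \<Longrightarrow> (LBINT x. (conv (moll n) g x - g x)\<^sup>2) < e / 9"
    by (auto simp: eventually_sequentially)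
  have "norm ((LBINT x. (conv (moll n) f x - f x)\<^sup>2) - 0) < e" if n: "n \<ge> N" for n
  proof -
    have a: "(\<lambda>x. f x - g x) \<in> L2" by (intro L2_diff f g)
    have b: "(\<lambda>x. conv (moll n) g x - g x) \<in> L2" by (intro L2_diff conv_moll_L2 g)
    note c = conv_moll_L2[OF a, of n]
    have "(LBINT x. (conv (moll n) f x - f x)\<^sup>2) \<le>
      (LBINT x. 3 * (conv (moll n) (\<lambda>x. f x - g x) x)\<^sup>2 + 3 * (conv (moll n) g x - g x)\<^sup>2 + 3 * (f x - g x)\<^sup>2)"
    proof (rule integral_mono)
      show "integrable lborel (\<lambda>x. (conv (moll n) f x - f x)\<^sup>2)"
        by (intro L2_integrable_sq L2_diff conv_moll_L2 f)
      show "integrable lborel (\<lambda>x. 3 * (conv (moll n) (\<lambda>x. f x - g x) x)\<^sup>2 + 3 * (conv (moll n) g x - g x)\<^sup>2 + 3 * (f x - g x)\<^sup>2)"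
        by (intro Bochner_Integration.integrable_add integrable_mult_right L2_integrable_sq a b c)
      fix x
      have "(p + q - r)\<^sup>2 \<le> 3 * p\<^sup>2 + 3 * q\<^sup>2 + 3 * r\<^sup>2" for p q r :: real
        using zero_le_power2[of "p - q"] zero_le_power2[of "p + r"] zero_le_power2[of "q + r"]
        by (simp add: power2_eq_square algebra_simps)
      from this[of "conv (moll n) (\<lambda>x. f x - g x) x" "conv (moll n) g x - g x" "f x - g x"]
      show "(conv (moll n) f x - f x)\<^sup>2 \<le> 3 * (conv (moll n) (\<lambda>x. f x - g x) x)\<^sup>2 + 3 * (conv (moll n) g x - g x)\<^sup>2 + 3 * (f x - g x)\<^sup>2"
        by (simp add: conv_diff_right[OF moll_test_function f g(1)])
    qed
    also have "\<dots> = 3 * (LBINT x. (conv (moll n) (\<lambda>x. f x - g x) x)\<^sup>2) + 3 * (LBINT x. (conv (moll n) g x - g x)\<^sup>2) + 3 * (LBINT x. (f x - g x)\<^sup>2)"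
      by (simp only: Bochner_Integration.integral_add Bochner_Integration.integrable_add integrable_mult_right
          integral_mult_right_zero L2_integrable_sq a b c)
    also have "\<dots> < e" using c(2) fg N[OF n] by linarith
    finally show ?thesis by (simp add: Bochner_Integration.integral_nonneg)
  qed
  then show "\<exists>N. \<forall>n\<ge>N. norm ((LBINT x. (conv (moll n) f x - f x)\<^sup>2) - 0) < e" by blast
qed

text \<open>Reflected mollifiers are test functions, so every mollification of f is 0; these
  converge to f in L^2.\<close>

lemma fundamental_lemma_calculus_of_variations:
  fixes f :: "real^'n::finite \<Rightarrow> real"
  assumes f: "f \<in> L2" and 0: "\<And>\<phi>. test_function \<phi> \<Longrightarrow> (LBINT x. \<phi> x * f x) = 0"
  shows "AE x in lborel. f x = 0"
proof -
  have "conv (moll n) f = (\<lambda>x. 0)" for n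
    using 0[OF test_function_reflect[OF moll_test_function]] by (auto simp: conv_def fun_eq_iff)
  then have "(\<lambda>n. LBINT x. (f x)\<^sup>2) \<longlonglongrightarrow> 0"
    using conv_moll_L2_lim[OF f] by (simp add: L2_lim_def)
  then have "(LBINT x. (f x)\<^sup>2) = 0" using LIMSEQ_unique tendsto_const by blast
  then show ?thesis using integral_nonneg_eq_0_iff_AE[OF L2_integrable_sq[OF f]] by simp
qed

section \<open>The product rule and Hardy's inequality\<close>

text \<open>The weak gradient is an explicit parameter indexed by coordinates, so mollification and
  affine maps can act on it directly, without reference to a chosen representative.\<close>

definition H1_pair :: "(real^'n::finite \<Rightarrow> real) \<Rightarrow> ('n \<Rightarrow> real^'n \<Rightarrow> real) \<Rightarrow> bool" where
  "H1_pair u g \<longleftrightarrow> u \<in> L2 \<and> (\<forall>i. g i \<in> L2 \<and> weak_partial i u (g i))"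

lemma H1_pairD:
  assumes "H1_pair u g" shows "u \<in> L2" "g i \<in> L2" "weak_partial i u (g i)"
  using assms by (auto simp: H1_pair_def)

lemma mollified_partial:
  "H1_pair u g \<Longrightarrow> partial_deriv i (conv (moll n) u) = conv (moll n) (g i)"
  by (simp add: partial_deriv_conv[OF moll_test_function H1_pairD(1)]
      conv_weak_partial[OF H1_pairD(3) moll_test_function])

text \<open>Mollified functions are smooth and satisfy the identity by classical integration by
  parts; both sides are bilinear in L^2-convergent sequences.\<close>

lemma product_rule_test:
  assumes u: "H1_pair u g" and \<phi>: "test_function \<phi>"
  shows "(LBINT x. partial_deriv i \<phi> x * (u x)\<^sup>2) = - 2 * (LBINT x. \<phi> x * u x * g i x)"
proof -
  let ?v = "\<lambda>n. conv (moll n) u" and ?w = "\<lambda>n. conv (moll n) (g i)"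
  have sm: "smooth (?v n)" for n by (intro smooth_conv moll_test_function H1_pairD[OF u])
  have v: "L2_lim ?v u" and w: "L2_lim ?w (g i)" by (intro conv_moll_L2_lim H1_pairD[OF u])+
  obtain B where B: "\<And>x. \<bar>\<phi> x\<bar> \<le> B" using test_function_bounded[OF \<phi>] by metis
  obtain B' where B': "\<And>x. \<bar>partial_deriv i \<phi> x\<bar> \<le> B'"
    using test_function_bounded[OF test_function_partial_deriv[OF \<phi>]] by metis
  have m: "\<phi> \<in> borel_measurable borel" "partial_deriv i \<phi> \<in> borel_measurable borel"
    by (intro smooth_borel smooth_partial_deriv test_function_smooth \<phi>)+
  have eq: "(LBINT x. partial_deriv i \<phi> x * ?v n x * ?v n x) = - 2 * (LBINT x. \<phi> x * ?v n x * ?w n x)" for n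
  proof -
    have "partial_deriv i (\<lambda>x. ?v n x * ?v n x) x = 2 * (?v n x * ?w n x)" for x
      by (subst partial_deriv_mult) (simp_all add: smooth_differentiable[OF sm] mollified_partial[OF u])
    then have "(LBINT x. partial_deriv i \<phi> x * (?v n x * ?v n x)) = - (LBINT x. \<phi> x * (2 * (?v n x * ?w n x)))"
      using integral_by_parts[OF \<phi> smooth_mult[OF sm sm], of i n n] by simp
    also have "(\<lambda>x. \<phi> x * (2 * (?v n x * ?w n x))) = (\<lambda>x. 2 * (\<phi> x * ?v n x * ?w n x))"
      by (simp add: fun_eq_iff)
    finally show ?thesis by (simp only: mult.assoc integral_mult_right_zero mult_minus_left)
  qed
  have "(\<lambda>n. LBINT x. partial_deriv i \<phi> x * ?v n x * ?v n x) \<longlonglongrightarrow> (LBINT x. partial_deriv i \<phi> x * u x * u x)"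
    by (rule L2_lim_integral[OF v v m(2) B'])
  moreover have "(\<lambda>n. LBINT x. partial_deriv i \<phi> x * ?v n x * ?v n x) \<longlonglongrightarrow> - 2 * (LBINT x. \<phi> x * u x * g i x)"
    unfolding eq by (intro tendsto_mult_left L2_lim_integral[OF v w m(1) B])
  ultimately show ?thesis using LIMSEQ_unique by (fastforce simp: power2_eq_square mult.assoc)
qed

text \<open>No plateau is required: the value 1 at the origin makes the dilates
  \<open>cutoff\<close> (x / (n+1)) converge to 1 pointwise.\<close>

definition cutoff :: "real^'n::finite \<Rightarrow> real" where
  "cutoff x = bump 1 x * (1 / bump 1 (0 :: real^'n))"

lemma cutoff_test_function: "test_function cutoff"
  unfolding cutoff_def by (intro test_function_mult_smooth bump_test_function smooth_const) simp

lemma cutoff_0: "cutoff 0 = 1"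
  using bump_neq_0_iff[of 1 0] by (simp add: cutoff_def)

lemma smooth_tendsto_at_0:
  assumes "smooth f" shows "(\<lambda>n. f ((1 / real (Suc n)) *\<^sub>R x)) \<longlonglongrightarrow> f 0"
proof -
  have "(\<lambda>n. inverse (real (Suc n)) *\<^sub>R x) \<longlonglongrightarrow> 0 *\<^sub>R x"
    by (intro tendsto_scaleR tendsto_const LIMSEQ_inverse_real_of_nat)
  then have "(\<lambda>n. (1 / real (Suc n)) *\<^sub>R x) \<longlonglongrightarrow> 0" by (simp add: inverse_eq_divide)
  then show ?thesis using smooth_isCont[OF assms, of 0] isCont_tendsto_compose by blast
qed

text \<open>Compact support is removed by the dilated cutoff. The term in which the cutoff is
  differentiated carries the factor 1/(n+1) and disappears in the limit. Hardy's inequality needs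
  this version, since its multiplier has unbounded support.\<close>

lemma product_rule:
  fixes u :: "real^'n::finite \<Rightarrow> real"
  assumes u: "H1_pair u g" and \<phi>: "smooth \<phi>" "\<And>x. \<bar>\<phi> x\<bar> \<le> B" "\<And>x. \<bar>partial_deriv i \<phi> x\<bar> \<le> B'"
  shows "(LBINT x. partial_deriv i \<phi> x * (u x)\<^sup>2) = - 2 * (LBINT x. \<phi> x * u x * g i x)"
proof -
  let ?a = "\<lambda>n. 1 / real (Suc n)"
  have [measurable]: "u \<in> borel_measurable borel" "g i \<in> borel_measurable borel"
    using u by (auto intro: L2_borel H1_pairD)
  have m [measurable]: "\<phi> \<in> borel_measurable borel" "partial_deriv i \<phi> \<in> borel_measurable borel"
    by (intro smooth_borel smooth_partial_deriv \<phi>)+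
  note ct = test_function_smooth[OF cutoff_test_function]
  obtain C where C: "\<And>x::real^'n. \<bar>cutoff x\<bar> \<le> C" using test_function_bounded[OF cutoff_test_function] by metis
  obtain C' where C': "\<And>x::real^'n. \<bar>partial_deriv i cutoff x\<bar> \<le> C'"
    using test_function_bounded[OF test_function_partial_deriv[OF cutoff_test_function]] by metis
  have [measurable]: "cutoff \<in> borel_measurable borel" "partial_deriv i cutoff \<in> borel_measurable borel"
    by (intro smooth_borel smooth_partial_deriv ct)+
  define \<psi> where "\<psi> n x = cutoff (?a n *\<^sub>R x) * \<phi> x" for n x
  have t: "test_function (\<psi> n)" for n
    unfolding \<psi>_def using test_function_affine[OF cutoff_test_function, of "?a n" 0] \<phi>(1)
    by (intro test_function_mult_smooth) auto
  have d: "partial_deriv i (\<psi> n) x = cutoff (?a n *\<^sub>R x) * partial_deriv i \<phi> x + ?a n * partial_deriv i cutoff (?a n *\<^sub>R x) * \<phi> x" for n x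
    unfolding \<psi>_def
    using partial_deriv_affine[OF ct, of i "?a n" 0 x] smooth_differentiable[OF smooth_affine[OF ct, of "?a n" 0]]
    by (subst partial_deriv_mult) (simp_all del: of_nat_Suc add: smooth_differentiable \<phi>)
  have BB: "B \<ge> 0" "B' \<ge> 0" "C \<ge> 0" "C' \<ge> 0" using \<phi>(2)[of 0] \<phi>(3)[of 0] C[of 0] C'[of 0] by linarith+
  have a: "0 \<le> ?a n" "?a n \<le> 1" for n by auto
  have ub: "\<bar>partial_deriv i (\<psi> n) x\<bar> \<le> C * B' + C' * B" for n x
  proof -
    have "\<bar>partial_deriv i (\<psi> n) x\<bar> \<le> \<bar>cutoff (?a n *\<^sub>R x)\<bar> * \<bar>partial_deriv i \<phi> x\<bar> + (\<bar>?a n\<bar> * \<bar>partial_deriv i cutoff (?a n *\<^sub>R x)\<bar>) * \<bar>\<phi> x\<bar>"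
      unfolding d by (rule order_trans[OF abs_triangle_ineq]) (simp only: abs_mult order_refl)
    also have "\<dots> \<le> C * B' + (1 * C') * B"
      using BB a(2)[of n] by (intro add_mono mult_mono C C' \<phi>) (auto simp del: of_nat_Suc)
    finally show ?thesis by simp
  qed
  have ub2: "\<bar>\<psi> n x\<bar> \<le> C * B" for n x
    unfolding \<psi>_def abs_mult using BB by (intro mult_mono C \<phi>) auto
  have l1: "(\<lambda>n. cutoff (?a n *\<^sub>R x)) \<longlonglongrightarrow> 1" for x :: "real^'n"
    using smooth_tendsto_at_0[OF ct, of x] by (simp add: cutoff_0)
  have l2: "(\<lambda>n. ?a n * partial_deriv i cutoff (?a n *\<^sub>R x)) \<longlonglongrightarrow> 0" for x
    using tendsto_mult[OF LIMSEQ_inverse_real_of_nat smooth_tendsto_at_0[OF smooth_partial_deriv[OF ct], of i x]]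
    by (simp add: inverse_eq_divide)
  have [measurable]: "\<psi> n \<in> borel_measurable borel" "partial_deriv i (\<psi> n) \<in> borel_measurable borel" for n
    using test_function_smooth[OF t] smooth_partial_deriv smooth_borel by blast+
  have lim1: "(\<lambda>n. LBINT x. partial_deriv i (\<psi> n) x * (u x)\<^sup>2) \<longlonglongrightarrow> (LBINT x. partial_deriv i \<phi> x * (u x)\<^sup>2)"
  proof (rule integral_dominated_convergence[where w = "\<lambda>x. (C * B' + C' * B) * (u x)\<^sup>2"])
    show "AE x in lborel. (\<lambda>n. partial_deriv i (\<psi> n) x * (u x)\<^sup>2) \<longlonglongrightarrow> partial_deriv i \<phi> x * (u x)\<^sup>2"
    proof (rule AE_I2)
      fix x
      have "(\<lambda>n. (cutoff (?a n *\<^sub>R x) * partial_deriv i \<phi> x + ?a n * partial_deriv i cutoff (?a n *\<^sub>R x) * \<phi> x) * (u x)\<^sup>2)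
         \<longlonglongrightarrow> (1 * partial_deriv i \<phi> x + 0 * \<phi> x) * (u x)\<^sup>2"
        by (intro tendsto_mult tendsto_add tendsto_const l1 l2)
      then show "(\<lambda>n. partial_deriv i (\<psi> n) x * (u x)\<^sup>2) \<longlonglongrightarrow> partial_deriv i \<phi> x * (u x)\<^sup>2"
        unfolding d by simp
    qed
    show "integrable lborel (\<lambda>x. (C * B' + C' * B) * (u x)\<^sup>2)"
      by (intro integrable_mult_right L2_integrable_sq H1_pairD(1)[OF u])
    show "AE x in lborel. norm (partial_deriv i (\<psi> n) x * (u x)\<^sup>2) \<le> (C * B' + C' * B) * (u x)\<^sup>2" for n
      using ub[of n] by (intro AE_I2) (simp add: abs_mult mult_right_mono)
  qed measurable
  have "(\<lambda>n. LBINT x. \<psi> n x * u x * g i x) \<longlonglongrightarrow> (LBINT x. \<phi> x * u x * g i x)"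
  proof (rule integral_dominated_convergence[where w = "\<lambda>x. (C * B) * \<bar>u x * g i x\<bar>"])
    show "AE x in lborel. (\<lambda>n. \<psi> n x * u x * g i x) \<longlonglongrightarrow> \<phi> x * u x * g i x"
    proof (rule AE_I2)
      fix x
      have "(\<lambda>n. cutoff (?a n *\<^sub>R x) * \<phi> x * u x * g i x) \<longlonglongrightarrow> 1 * \<phi> x * u x * g i x"
        by (intro tendsto_mult tendsto_const l1)
      then show "(\<lambda>n. \<psi> n x * u x * g i x) \<longlonglongrightarrow> \<phi> x * u x * g i x" unfolding \<psi>_def by simp
    qed
    show "integrable lborel (\<lambda>x. (C * B) * \<bar>u x * g i x\<bar>)"
      by (intro integrable_mult_right integrable_abs L2_integrable_mult H1_pairD[OF u])
    show "AE x in lborel. norm (\<psi> n x * u x * g i x) \<le> (C * B) * \<bar>u x * g i x\<bar>" for n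
    proof (rule AE_I2)
      fix x
      have "\<bar>\<psi> n x\<bar> * \<bar>u x * g i x\<bar> \<le> (C * B) * \<bar>u x * g i x\<bar>"
        by (rule mult_right_mono[OF ub2 abs_ge_zero])
      then show "norm (\<psi> n x * u x * g i x) \<le> (C * B) * \<bar>u x * g i x\<bar>"
        by (simp only: real_norm_def abs_mult mult.assoc)
    qed
  qed measurable
  from tendsto_mult_left[OF this, of "- 2"] show ?thesis
    by (rule LIMSEQ_unique[OF lim1[unfolded product_rule_test[OF u t]]])
qed

text \<open>Regularises |x|^(2p). The exponent counts powers of the squared norm, so the kernel
  |x|^(-\<gamma>) belongs to p = -\<gamma>/2.\<close>

definition reg_pow :: "real \<Rightarrow> real \<Rightarrow> real^'n::finite \<Rightarrow> real" where
  "reg_pow p \<epsilon> x = ((norm x)\<^sup>2 + \<epsilon>) powr p"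

text \<open>The m-th derivative of s^p with its falling factorial, in the shape of the tower
  demanded by \<open>smooth_compose\<close>.\<close>

lemma powr_DERIV_tower:
  assumes "s > 0"
  shows "((\<lambda>s. (\<Prod>j<m. p - real j) * s powr (p - real m)) has_real_derivative
      (\<Prod>j<Suc m. p - real j) * s powr (p - real (Suc m))) (at s)"
  using assms by (auto intro!: derivative_eq_intros simp: algebra_simps)

lemma smooth_reg_pow:
  assumes "\<epsilon> > 0" shows "smooth (reg_pow p \<epsilon>)"
proof -
  have "smooth (\<lambda>x::real^'a. (\<Prod>j<0. p - real j) * ((norm x)\<^sup>2 + \<epsilon>) powr (p - real 0))"
    by (rule smooth_compose[where S = "{0<..}" and d = "\<lambda>m s. (\<Prod>j<m. p - real j) * s powr (p - real m)"])
       (use assms powr_DERIV_tower in \<open>auto intro!: smooth_add smooth_norm_sq smooth_const add_nonneg_pos simp del: prod.lessThan_Suc\<close>)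
  then show ?thesis by (simp add: reg_pow_def[abs_def])
qed

lemma partial_deriv_reg_pow:
  assumes "\<epsilon> > 0" shows "partial_deriv i (reg_pow p \<epsilon>) x = 2 * p * x $ i * reg_pow (p - 1) \<epsilon> x"
proof -
  have pos: "(norm x)\<^sup>2 + \<epsilon> > 0" using assms by (simp add: add_nonneg_pos)
  have "((\<lambda>s. s powr p) has_real_derivative p * ((norm x)\<^sup>2 + \<epsilon>) powr (p - 1)) (at ((norm x)\<^sup>2 + \<epsilon>))"
    using pos by (auto intro!: derivative_eq_intros simp: powr_diff)
  from partial_deriv_compose[where q = "\<lambda>x. (norm x)\<^sup>2 + \<epsilon>", OF this, of i]
  have "partial_deriv i (reg_pow p \<epsilon>) x = p * ((norm x)\<^sup>2 + \<epsilon>) powr (p - 1) * partial_deriv i (\<lambda>x. (norm x)\<^sup>2 + \<epsilon>) x"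
    by (simp add: reg_pow_def[abs_def] smooth_differentiable smooth_add smooth_norm_sq)
  also have "partial_deriv i (\<lambda>x. (norm x)\<^sup>2 + \<epsilon>) x = 2 * x $ i"
    by (subst partial_deriv_add) (simp_all add: smooth_differentiable smooth_norm_sq partial_deriv_norm_sq)
  finally have "partial_deriv i (reg_pow p \<epsilon>) x = p * ((norm x)\<^sup>2 + \<epsilon>) powr (p - 1) * (2 * x $ i)" .
  then show ?thesis unfolding reg_pow_def[of "p - 1"] by (simp only: mult_ac)
qed

text \<open>The chain rule for weak derivatives is reduced to a change of variables, by composing
  the test function with the inverse affine map.\<close>

lemma H1_pair_affine:
  assumes u: "H1_pair u g" and t: "t \<noteq> 0"
  shows "H1_pair (\<lambda>x. s * u (t *\<^sub>R x + z)) (\<lambda>i x. s * t * g i (t *\<^sub>R x + z))"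
proof -
  have L: "(\<lambda>x. c * f (t *\<^sub>R x + z)) \<in> L2" if f: "f \<in> L2" for c and f :: "real^'a \<Rightarrow> real"
  proof -
    have [measurable]: "f \<in> borel_measurable borel" using f L2_borel by blast
    have "integrable lborel (\<lambda>x. (f (t *\<^sub>R x + z))\<^sup>2)"
      by (rule lborel_affine_integrable[OF L2_integrable_sq[OF f] t])
    then show ?thesis by (simp add: L2_real_iff power_mult_distrib)
  qed
  have "weak_partial i (\<lambda>x. s * u (t *\<^sub>R x + z)) (\<lambda>x. s * t * g i (t *\<^sub>R x + z))" for i
    unfolding weak_partial_def
  proof (intro allI impI)
    fix \<phi> :: "real^'a \<Rightarrow> real" assume \<phi>: "test_function \<phi>"
    have [measurable]: "u \<in> borel_measurable borel" "g i \<in> borel_measurable borel"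
      using u L2_borel by (auto simp: H1_pair_def)
    have m [measurable]: "\<phi> \<in> borel_measurable borel" "partial_deriv i \<phi> \<in> borel_measurable borel"
      by (intro smooth_borel smooth_partial_deriv test_function_smooth \<phi>)+
    \<comment> \<open>The inverse of x -> t x + z inside \<phi>; its partial derivative contributes
      1/t, which becomes the factor t in the new gradient.\<close>
    define \<psi> where "\<psi> x = \<phi> ((1/t) *\<^sub>R x + (- (1/t)) *\<^sub>R z)" for x
    have \<psi>: "test_function \<psi>" unfolding \<psi>_def by (rule test_function_affine[OF \<phi>]) (use t in simp)
    have [measurable]: "\<psi> \<in> borel_measurable borel" "partial_deriv i \<psi> \<in> borel_measurable borel"
      by (intro smooth_borel smooth_partial_deriv test_function_smooth \<psi>)+
    have inv: "(1/t) *\<^sub>R (t *\<^sub>R x + z) + (- (1/t)) *\<^sub>R z = x" for x using t by (simp add: scaleR_add_right)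
    have d: "partial_deriv i \<psi> (t *\<^sub>R x + z) = (1/t) * partial_deriv i \<phi> x" for x
      unfolding \<psi>_def by (subst partial_deriv_affine[OF test_function_smooth[OF \<phi>]]) (simp only: inv)
    have e: "\<psi> (t *\<^sub>R x + z) = \<phi> x" for x unfolding \<psi>_def inv ..
    have "(LBINT x. partial_deriv i \<psi> x * u x) = - (LBINT x. \<psi> x * g i x)"
      using H1_pairD(3)[OF u] \<psi> unfolding weak_partial_def by blast
    also have "(LBINT x. partial_deriv i \<psi> x * u x) = \<bar>t\<bar> ^ DIM(real^'a) * (LBINT x. (1/t) * partial_deriv i \<phi> x * u (t *\<^sub>R x + z))"
      by (subst lborel_affine_integral[OF _ t, of _ z]) (auto simp: d)
    also have "(LBINT x. \<psi> x * g i x) = \<bar>t\<bar> ^ DIM(real^'a) * (LBINT x. \<phi> x * g i (t *\<^sub>R x + z))"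
      by (subst lborel_affine_integral[OF _ t, of _ z]) (auto simp: e)
    finally have "\<bar>t\<bar> ^ DIM(real^'a) * (LBINT x. (1/t) * partial_deriv i \<phi> x * u (t *\<^sub>R x + z))
       = \<bar>t\<bar> ^ DIM(real^'a) * - (LBINT x. \<phi> x * g i (t *\<^sub>R x + z))"
      by (simp only: mult_minus_right)
    then have eq: "(LBINT x. (1/t) * partial_deriv i \<phi> x * u (t *\<^sub>R x + z)) = - (LBINT x. \<phi> x * g i (t *\<^sub>R x + z))"
      by (rule mult_left_cancel[THEN iffD1, rotated]) (use t in simp)
    have "(LBINT x. partial_deriv i \<phi> x * (s * u (t *\<^sub>R x + z)))
       = (LBINT x. (s * t) * ((1/t) * partial_deriv i \<phi> x * u (t *\<^sub>R x + z)))"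
      using t by (intro Bochner_Integration.integral_cong) auto
    also have "\<dots> = (s * t) * - (LBINT x. \<phi> x * g i (t *\<^sub>R x + z))"
      unfolding integral_mult_right_zero eq ..
    also have "\<dots> = - (LBINT x. (s * t) * (\<phi> x * g i (t *\<^sub>R x + z)))"
      unfolding integral_mult_right_zero by simp
    also have "(\<lambda>x. (s * t) * (\<phi> x * g i (t *\<^sub>R x + z))) = (\<lambda>x. \<phi> x * (s * t * g i (t *\<^sub>R x + z)))"
      by (simp add: fun_eq_iff)
    finally show "(LBINT x. partial_deriv i \<phi> x * (s * u (t *\<^sub>R x + z))) = - (LBINT x. \<phi> x * (s * t * g i (t *\<^sub>R x + z)))" .
  qed
  then show ?thesis using u L by (auto simp: H1_pair_def)
qed

lemma norm_sq_vec: "(norm (x :: real^'n::finite))\<^sup>2 = (\<Sum>i\<in>UNIV. (x $ i)\<^sup>2)"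
  unfolding power2_norm_eq_inner inner_vec_def by (simp add: power2_eq_square)

lemma reg_pow_bounds:
  assumes "\<epsilon> > 0"
  shows "0 < reg_pow (-1) \<epsilon> x" "reg_pow (-1) \<epsilon> x \<le> 1 / \<epsilon>" "(norm x)\<^sup>2 * reg_pow (-1) \<epsilon> x \<le> 1"
    "reg_pow (-2) \<epsilon> x = (reg_pow (-1) \<epsilon> x)\<^sup>2" "reg_pow (-1) \<epsilon> x = 1 / ((norm x)\<^sup>2 + \<epsilon>)"
proof -
  have pos: "(norm x)\<^sup>2 + \<epsilon> > 0" using assms by (simp add: add_nonneg_pos)
  then show r: "reg_pow (-1) \<epsilon> x = 1 / ((norm x)\<^sup>2 + \<epsilon>)"
    by (simp add: reg_pow_def powr_minus_divide)
  show "reg_pow (-2) \<epsilon> x = (reg_pow (-1) \<epsilon> x)\<^sup>2"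
    using pos unfolding reg_pow_def by (simp add: powr_minus_divide power_divide)
  show "0 < reg_pow (-1) \<epsilon> x" unfolding r using pos by simp
  show "reg_pow (-1) \<epsilon> x \<le> 1 / \<epsilon>" unfolding r using assms pos by (intro divide_left_mono) auto
  show "(norm x)\<^sup>2 * reg_pow (-1) \<epsilon> x \<le> 1" unfolding r using assms pos by simp
qed

text \<open>The multiplier is the vector field x / (|x|^2 + \<epsilon>) with components
  \<open>\<phi> i\<close>. With h = 1 / (|x|^2 + \<epsilon>), let H and X be the integrals of h u^2
  and |x|^2 h^2 u^2, and G that of the squared gradient. Its divergence gives N H - 2 X <= X/2 + 2 G
  after Young's inequality. As X <= H, this leaves (N - 5/2) H <= 2 G, and N >= 3 gives the constant
  4.\<close>

lemma Hardy_regularised: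
  fixes u :: "real^'n::finite \<Rightarrow> real"
  assumes u: "H1_pair u g" and N: "CARD('n) \<ge> 3" and \<epsilon>: "\<epsilon> > 0"
  shows "(LBINT x. reg_pow (-1) \<epsilon> x * (u x)\<^sup>2) \<le> 4 * (\<Sum>i\<in>UNIV. LBINT x. (g i x)\<^sup>2)"
proof -
  let ?h = "\<lambda>x::real^'n. reg_pow (-1) \<epsilon> x"
  note h = reg_pow_bounds[OF \<epsilon>]
  have [measurable]: "?h \<in> borel_measurable borel" by (intro smooth_borel smooth_reg_pow \<epsilon>)
  note uL = H1_pairD(1)[OF u] and gL = H1_pairD(2)[OF u]
  have xi: "(x $ i)\<^sup>2 \<le> (norm x)\<^sup>2" for x :: "real^'n" and i
    by (simp add: abs_le_square_iff[symmetric] component_le_norm_cart)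
  define \<phi> where "\<phi> i x = x $ i * ?h x" for i :: 'n and x
  have sm: "smooth (\<phi> i)" for i unfolding \<phi>_def by (intro smooth_mult smooth_coord smooth_reg_pow \<epsilon>)
  have [measurable]: "\<phi> i \<in> borel_measurable borel" for i using sm smooth_borel by blast
  have d: "partial_deriv i (\<phi> i) x = ?h x - 2 * (x $ i)\<^sup>2 * (?h x)\<^sup>2" for i x
    unfolding \<phi>_def
    by (subst partial_deriv_mult) (simp_all add: smooth_differentiable smooth_reg_pow \<epsilon> partial_deriv_reg_pow
        partial_deriv_coord h(4) power2_eq_square)
  have xh: "(x $ i)\<^sup>2 * (?h x)\<^sup>2 \<le> ?h x" for x i
  proof -
    have "(x $ i)\<^sup>2 * ?h x \<le> 1"
      using mult_right_mono[OF xi[of x i], of "?h x"] h(1)[of x] h(3)[of x] by linarith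
    then have "((x $ i)\<^sup>2 * ?h x) * ?h x \<le> 1 * ?h x" using h(1)[of x] by (intro mult_right_mono) auto
    then show ?thesis by (simp add: power2_eq_square mult.assoc)
  qed
  have b1: "\<bar>\<phi> i x\<bar> \<le> 1 + 1 / \<epsilon>" for i x
  proof -
    have "(\<phi> i x)\<^sup>2 \<le> 1 / \<epsilon>" using xh[of x i] h(2)[of x] by (simp add: \<phi>_def power_mult_distrib)
    moreover have "2 * \<bar>\<phi> i x\<bar> \<le> 1 + (\<phi> i x)\<^sup>2" using sum_squares_bound[of 1 "\<bar>\<phi> i x\<bar>"] by simp
    ultimately show ?thesis using \<epsilon> by (smt (verit) divide_pos_pos)
  qed
  have b2: "\<bar>partial_deriv i (\<phi> i) x\<bar> \<le> 1 / \<epsilon>" for i x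
  proof -
    have "0 \<le> (x $ i)\<^sup>2 * (?h x)\<^sup>2" by simp
    then show ?thesis using xh[of x i] h(1,2)[of x] unfolding d by linarith
  qed
  have hu: "integrable lborel (\<lambda>x. ?h x * (u x)\<^sup>2)"
  proof -
    have "\<bar>?h x\<bar> \<le> 1 / \<epsilon>" for x using h(1,2)[of x] by (simp only: abs_of_pos)
    from L2_integrable_mult3[OF uL uL _ this] show ?thesis by (simp add: power2_eq_square mult.assoc)
  qed
  have xhu: "integrable lborel (\<lambda>x. (x $ i)\<^sup>2 * (?h x)\<^sup>2 * (u x)\<^sup>2)" for i
  proof (rule Bochner_Integration.integrable_bound[OF hu])
    have [measurable]: "u \<in> borel_measurable borel" using uL L2_borel by blast
    show "(\<lambda>x. (x $ i)\<^sup>2 * (?h x)\<^sup>2 * (u x)\<^sup>2) \<in> borel_measurable lborel" by measurable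
    show "AE x in lborel. norm ((x $ i)\<^sup>2 * (?h x)\<^sup>2 * (u x)\<^sup>2) \<le> norm (?h x * (u x)\<^sup>2)"
    proof (rule AE_I2)
      fix x
      have "(x $ i)\<^sup>2 * (?h x)\<^sup>2 * (u x)\<^sup>2 \<le> ?h x * (u x)\<^sup>2" by (intro mult_right_mono xh) simp
      moreover have "0 \<le> (x $ i)\<^sup>2 * (?h x)\<^sup>2 * (u x)\<^sup>2" by simp
      ultimately show "norm ((x $ i)\<^sup>2 * (?h x)\<^sup>2 * (u x)\<^sup>2) \<le> norm (?h x * (u x)\<^sup>2)"
        unfolding real_norm_def by linarith
    qed
  qed
  have ig: "integrable lborel (\<lambda>x. (g i x)\<^sup>2)" for i using gL L2_integrable_sq by blast
  have main: "(LBINT x. ?h x * (u x)\<^sup>2) - 2 * (LBINT x. (x $ i)\<^sup>2 * (?h x)\<^sup>2 * (u x)\<^sup>2)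
     \<le> 1/2 * (LBINT x. (x $ i)\<^sup>2 * (?h x)\<^sup>2 * (u x)\<^sup>2) + 2 * (LBINT x. (g i x)\<^sup>2)" for i
  proof -
    have "(LBINT x. ?h x * (u x)\<^sup>2) - 2 * (LBINT x. (x $ i)\<^sup>2 * (?h x)\<^sup>2 * (u x)\<^sup>2)
      = (LBINT x. ?h x * (u x)\<^sup>2 - 2 * ((x $ i)\<^sup>2 * (?h x)\<^sup>2 * (u x)\<^sup>2))"
      using hu xhu[of i] by simp
    also have "\<dots> = (LBINT x. partial_deriv i (\<phi> i) x * (u x)\<^sup>2)"
      by (intro Bochner_Integration.integral_cong) (auto simp: d left_diff_distrib)
    also have "\<dots> = - 2 * (LBINT x. \<phi> i x * u x * g i x)"
      by (rule product_rule[OF u sm b1 b2])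
    also have "\<dots> = (LBINT x. - 2 * (\<phi> i x * u x * g i x))" by simp
    also have "\<dots> \<le> (LBINT x. 1/2 * ((x $ i)\<^sup>2 * (?h x)\<^sup>2 * (u x)\<^sup>2) + 2 * (g i x)\<^sup>2)"
    proof (rule integral_mono)
      show "integrable lborel (\<lambda>x. - 2 * (\<phi> i x * u x * g i x))"
        by (intro integrable_mult_right L2_integrable_mult3[OF uL gL _ b1]) measurable
      show "integrable lborel (\<lambda>x. 1/2 * ((x $ i)\<^sup>2 * (?h x)\<^sup>2 * (u x)\<^sup>2) + 2 * (g i x)\<^sup>2)"
        by (intro Bochner_Integration.integrable_add integrable_mult_right xhu ig)
      fix x
      \<comment> \<open>Half of this square gives Young's inequality with weights 1/2 and 2, which
        for N = 3 leave 3 - 2 - 1/2 = 1/2 of H on the left.\<close>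
      have "0 \<le> (\<phi> i x * u x + 2 * g i x)\<^sup>2" by simp
      then show "- 2 * (\<phi> i x * u x * g i x) \<le> 1/2 * ((x $ i)\<^sup>2 * (?h x)\<^sup>2 * (u x)\<^sup>2) + 2 * (g i x)\<^sup>2"
        by (simp add: \<phi>_def power2_sum power_mult_distrib)
    qed
    also have "\<dots> = 1/2 * (LBINT x. (x $ i)\<^sup>2 * (?h x)\<^sup>2 * (u x)\<^sup>2) + 2 * (LBINT x. (g i x)\<^sup>2)"
      using xhu[of i] ig[of i] by simp
    finally show ?thesis .
  qed
  let ?H = "LBINT x. ?h x * (u x)\<^sup>2" and ?X = "\<Sum>i\<in>UNIV. LBINT x. (x $ i)\<^sup>2 * (?h x)\<^sup>2 * (u x)\<^sup>2"
    and ?G = "\<Sum>i\<in>UNIV. LBINT x. (g i x)\<^sup>2"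
  have "real CARD('n) * ?H - 2 * ?X \<le> 1/2 * ?X + 2 * ?G"
  proof -
    have "(\<Sum>i\<in>(UNIV :: 'n set). ?H - 2 * (LBINT x. (x $ i)\<^sup>2 * (?h x)\<^sup>2 * (u x)\<^sup>2))
      \<le> (\<Sum>i\<in>UNIV. 1/2 * (LBINT x. (x $ i)\<^sup>2 * (?h x)\<^sup>2 * (u x)\<^sup>2) + 2 * (LBINT x. (g i x)\<^sup>2))"
      by (intro sum_mono main)
    then show ?thesis by (simp only: sum_subtractf sum.distrib sum_constant sum_distrib_left[symmetric])
  qed
  moreover have "?X \<le> ?H"
  proof -
    have "?X = (LBINT x. (\<Sum>i\<in>UNIV. (x $ i)\<^sup>2 * (?h x)\<^sup>2 * (u x)\<^sup>2))"
      by (intro Bochner_Integration.integral_sum[symmetric] xhu)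
    also have "\<dots> \<le> ?H"
    proof (rule integral_mono[OF Bochner_Integration.integrable_sum[OF xhu] hu])
      fix x
      have "(\<Sum>i\<in>UNIV. (x $ i)\<^sup>2 * (?h x)\<^sup>2 * (u x)\<^sup>2) = ((norm x)\<^sup>2 * ?h x) * (?h x * (u x)\<^sup>2)"
        unfolding sum_distrib_right[symmetric] norm_sq_vec[symmetric] by (simp add: power2_eq_square mult_ac)
      also have "\<dots> \<le> 1 * (?h x * (u x)\<^sup>2)"
        using h(1,3)[of x] by (intro mult_right_mono) auto
      finally show "(\<Sum>i\<in>UNIV. (x $ i)\<^sup>2 * (?h x)\<^sup>2 * (u x)\<^sup>2) \<le> ?h x * (u x)\<^sup>2" by simp
    qed
    finally show ?thesis .
  qed
  moreover have "?H \<ge> 0" by (intro Bochner_Integration.integral_nonneg mult_nonneg_nonneg less_imp_le[OF h(1)]) auto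
  moreover have "3 * ?H \<le> real CARD('n) * ?H" using N \<open>?H \<ge> 0\<close> by (intro mult_right_mono) auto
  ultimately show ?thesis by linarith
qed

text \<open>Fatou's lemma along \<epsilon> = 1/(n+1); the regularised bound does not depend on
  \<epsilon>.\<close>

lemma Hardy_0:
  fixes u :: "real^'n::finite \<Rightarrow> real"
  assumes u: "H1_pair u g" and N: "CARD('n) \<ge> 3"
  shows "(\<integral>\<^sup>+x. ennreal ((u x)\<^sup>2 / (norm x)\<^sup>2) \<partial>lborel) \<le> ennreal (4 * (\<Sum>i\<in>UNIV. LBINT x. (g i x)\<^sup>2))"
proof -
  let ?h = "\<lambda>n x::real^'n. reg_pow (-1) (1 / real (Suc n)) x"
  have [measurable]: "u \<in> borel_measurable borel" using H1_pairD(1)[OF u] L2_borel by blast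
  have hm [measurable]: "?h n \<in> borel_measurable borel" for n by (intro smooth_borel smooth_reg_pow) simp
  have int: "(\<integral>\<^sup>+x. ennreal (?h n x * (u x)\<^sup>2) \<partial>lborel) \<le> ennreal (4 * (\<Sum>i\<in>UNIV. LBINT x. (g i x)\<^sup>2))" for n
  proof -
    have e: "1 / real (Suc n) > 0" by simp
    note h = reg_pow_bounds[OF e]
    have "\<bar>?h n x\<bar> \<le> 1 / (1 / real (Suc n))" for x using h(1,2)[of x] by (simp add: abs_of_pos)
    from L2_integrable_mult3[OF H1_pairD(1)[OF u] H1_pairD(1)[OF u] hm this]
    have "integrable lborel (\<lambda>x. ?h n x * (u x)\<^sup>2)" by (simp add: power2_eq_square mult.assoc)
    then have "(\<integral>\<^sup>+x. ennreal (?h n x * (u x)\<^sup>2) \<partial>lborel) = ennreal (LBINT x. ?h n x * (u x)\<^sup>2)"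
      by (rule nn_integral_eq_integral) (intro AE_I2 mult_nonneg_nonneg less_imp_le[OF h(1)] zero_le_power2)
    then show ?thesis using Hardy_regularised[OF u N e] by (simp add: ennreal_leI)
  qed
  have "(\<integral>\<^sup>+x. ennreal ((u x)\<^sup>2 / (norm x)\<^sup>2) \<partial>lborel) \<le> (\<integral>\<^sup>+x. liminf (\<lambda>n. ennreal (?h n x * (u x)\<^sup>2)) \<partial>lborel)"
  proof (rule nn_integral_mono)
    fix x :: "real^'n"
    show "ennreal ((u x)\<^sup>2 / (norm x)\<^sup>2) \<le> liminf (\<lambda>n. ennreal (?h n x * (u x)\<^sup>2))"
    \<comment> \<open>At the origin the division by 0 yields 0, so that case is trivial.\<close>
    proof (cases "x = 0")
      case False
      have "(\<lambda>n. 1 / ((norm x)\<^sup>2 + inverse (real (Suc n))) * (u x)\<^sup>2) \<longlonglongrightarrow> 1 / ((norm x)\<^sup>2 + 0) * (u x)\<^sup>2"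
        by (intro tendsto_mult tendsto_divide tendsto_add tendsto_const LIMSEQ_inverse_real_of_nat) (use False in simp)
      then have "(\<lambda>n. ?h n x * (u x)\<^sup>2) \<longlonglongrightarrow> (u x)\<^sup>2 / (norm x)\<^sup>2"
        by (subst reg_pow_bounds(5)) (simp_all add: inverse_eq_divide)
      then have "(\<lambda>n. ennreal (?h n x * (u x)\<^sup>2)) \<longlonglongrightarrow> ennreal ((u x)\<^sup>2 / (norm x)\<^sup>2)"
        by (rule tendsto_ennrealI)
      then show ?thesis using lim_imp_Liminf[OF sequentially_bot] by (metis order_refl)
    qed simp
  qed
  also have "\<dots> \<le> liminf (\<lambda>n. \<integral>\<^sup>+x. ennreal (?h n x * (u x)\<^sup>2) \<partial>lborel)"
    by (rule nn_integral_liminf) measurable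
  also have "\<dots> \<le> ennreal (4 * (\<Sum>i\<in>UNIV. LBINT x. (g i x)\<^sup>2))"
    using int by (intro Liminf_le) auto
  finally show ?thesis .
qed

text \<open>Translating u leaves the gradient integral unchanged. The bound is therefore uniform in
  the centre x, which is what makes Hartree potentials bounded functions.\<close>

lemma Hardy:
  fixes u :: "real^'n::finite \<Rightarrow> real"
  assumes u: "H1_pair u g" and N: "CARD('n) \<ge> 3"
  shows "(\<integral>\<^sup>+y. ennreal ((u y)\<^sup>2 / (norm (x - y))\<^sup>2) \<partial>lborel) \<le> ennreal (4 * (\<Sum>i\<in>UNIV. LBINT x. (g i x)\<^sup>2))"
proof -
  have [measurable]: "u \<in> borel_measurable borel" "g i \<in> borel_measurable borel" for i
    using H1_pairD[OF u] L2_borel by blast+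
  have "(\<integral>\<^sup>+y. ennreal ((u y)\<^sup>2 / (norm (x - y))\<^sup>2) \<partial>lborel)
     = (\<integral>\<^sup>+y. ennreal ((u (y + x))\<^sup>2 / (norm y)\<^sup>2) \<partial>lborel)"
    by (subst lborel_affine_nn_integral[of _ 1 x]) (simp_all add: one_ennreal_def[symmetric])
  also have "\<dots> \<le> ennreal (4 * (\<Sum>i\<in>UNIV. LBINT y. (g i (y + x))\<^sup>2))"
    using Hardy_0[OF H1_pair_affine[OF u, of 1 1 x] N] by simp
  also have "\<dots> = ennreal (4 * (\<Sum>i\<in>UNIV. LBINT y. (g i y)\<^sup>2))"
  proof -
    have "(LBINT y. (g i (y + x))\<^sup>2) = (LBINT y. (g i y)\<^sup>2)" for i
      by (subst (2) lborel_affine_integral[of _ 1 x]) simp_all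
    then show ?thesis by simp
  qed
  finally show ?thesis .
qed

section \<open>Virial identities\<close>

text \<open>The virial identity for a localised vector field \<open>X e\<^sub>i\<close>.  Weak solutions are not known to be in
  \<open>H\<^sup>2\<close>, so the equation is mollified and tested with \<open>X \<partial>\<^sub>i v + 1/2 (\<partial>\<^sub>i X) v\<close>, where \<open>v\<close> is
  the mollified solution; the second derivatives of \<open>v\<close> then cancel by symmetry and the limit can be taken.\<close>

lemma local_virial_identity:
  fixes u :: "real^'n::finite \<Rightarrow> real"
  assumes u: "H1_pair u g" and f: "f \<in> L2"
    and eq: "\<And>\<phi>. test_function \<phi> \<Longrightarrow> (\<Sum>j\<in>UNIV. LBINT x. partial_deriv j \<phi> x * g j x) = (LBINT x. \<phi> x * f x)"
    and X: "test_function X"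
  shows "(\<Sum>j\<in>UNIV. (LBINT x. partial_deriv j X x * g i x * g j x)
             + 1/2 * (LBINT x. partial_deriv j (partial_deriv i X) x * u x * g j x))
    = (LBINT x. X x * f x * g i x) + 1/2 * (LBINT x. partial_deriv i X x * f x * u x)"
proof -
  let ?v = "\<lambda>n. conv (moll n) u" and ?w = "\<lambda>n j. conv (moll n) (g j)" and ?F = "\<lambda>n. conv (moll n) f"
  let ?dX = "\<lambda>j. partial_deriv j X" and ?ddX = "\<lambda>j. partial_deriv j (partial_deriv i X)"
  note uL = H1_pairD(1)[OF u] and gL = H1_pairD(2)[OF u]
  have sv: "smooth (?v n)" and sw: "smooth (?w n j)" and sF: "smooth (?F n)" for n j
    by (intro smooth_conv moll_test_function uL gL f)+
  have tdX: "test_function (?dX j)" and tddX: "test_function (?ddX j)" for j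
    by (intro test_function_partial_deriv X)+
  \<comment> \<open>The equation tested with the reflected mollifier: it holds pointwise, in
    divergence form, for the mollified functions.\<close>
  have mom: "(\<Sum>j\<in>UNIV. partial_deriv j (?w n j) x) = - ?F n x" for n x
  proof -
    have "(\<Sum>j\<in>UNIV. LBINT y. partial_deriv j (\<lambda>y. moll n (x - y)) y * g j y) = (LBINT y. moll n (x - y) * f y)"
      by (rule eq[OF test_function_reflect[OF moll_test_function]])
    then have "(\<Sum>j\<in>UNIV. - conv (partial_deriv j (moll n)) (g j) x) = ?F n x"
      by (simp add: partial_deriv_reflect[OF test_function_smooth[OF moll_test_function]] conv_def)
    then show ?thesis by (simp add: partial_deriv_conv[OF moll_test_function gL] sum_negf)
  qed
  \<comment> \<open>Both sides are second derivatives of the mollified u, with both derivatives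
    moved onto the mollifier.\<close>
  have sym: "partial_deriv j (?w n i) = partial_deriv i (?w n j)" for n j
  proof -
    have "partial_deriv j (?w n k) = conv (partial_deriv k (partial_deriv j (moll n))) u" for j k
      by (simp add: partial_deriv_conv[OF moll_test_function gL]
          conv_weak_partial[OF H1_pairD(3)[OF u] test_function_partial_deriv[OF moll_test_function]])
    then show ?thesis by (simp add: moll_partial_commute[of i j])
  qed
  have id: "(\<Sum>j\<in>UNIV. (LBINT x. ?dX j x * ?w n i x * ?w n j x) + 1/2 * (LBINT x. ?ddX j x * ?v n x * ?w n j x))
     = (LBINT x. X x * ?F n x * ?w n i x) + 1/2 * (LBINT x. ?dX i x * ?F n x * ?v n x)" for n
  proof -
    define Y where "Y x = X x * ?w n i x + 1/2 * (?dX i x * ?v n x)" for x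
    have tY: "test_function Y"
      unfolding Y_def mult.commute[of "1/2"]
      by (intro test_function_add test_function_mult_smooth X tdX sw sv smooth_const)
    have int: "integrable lborel (\<lambda>x. \<phi> x * (a x * b x))" if "test_function \<phi>" "smooth a" "smooth b" for \<phi> a b :: "real^'n \<Rightarrow> real"
      by (intro test_function_integrable test_function_mult_smooth smooth_mult that)
    have dY: "partial_deriv j Y x = X x * partial_deriv i (?w n j) x + ?dX j x * ?w n i x
       + 1/2 * (?dX i x * ?w n j x + ?ddX j x * ?v n x)" for j x
    proof -
      have "partial_deriv j Y x = partial_deriv j (\<lambda>x. X x * ?w n i x) x + partial_deriv j (\<lambda>x. 1/2 * (?dX i x * ?v n x)) x"
        unfolding Y_def
        by (intro partial_deriv_add smooth_differentiable smooth_mult test_function_smooth X tdX sw sv smooth_const)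
      also have "partial_deriv j (\<lambda>x. 1/2 * (?dX i x * ?v n x)) x = 1/2 * partial_deriv j (\<lambda>x. ?dX i x * ?v n x) x"
        by (intro partial_deriv_cmult smooth_differentiable smooth_mult test_function_smooth tdX sv)
      also have "partial_deriv j (\<lambda>x. ?dX i x * ?v n x) x = ?dX i x * partial_deriv j (?v n) x + ?ddX j x * ?v n x"
        by (intro partial_deriv_mult smooth_differentiable test_function_smooth tdX sv)
      also have "partial_deriv j (\<lambda>x. X x * ?w n i x) x = X x * partial_deriv j (?w n i) x + ?dX j x * ?w n i x"
        by (intro partial_deriv_mult smooth_differentiable test_function_smooth X sw)
      finally show ?thesis by (simp only: sym mollified_partial[OF u])
    qed
    \<comment> \<open>By \<open>sym\<close>, second derivatives occur only as X w_j d_i w_j = X d_i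
      (w_j^2) / 2; integrated by parts, this cancels the contribution of (d_i X / 2) v. The
      coefficient 1/2 in \<open>Y\<close> is chosen for this.\<close>
    have cancel: "(LBINT x. ?dX i x * (?w n j x * ?w n j x)) = - 2 * (LBINT x. X x * (?w n j x * partial_deriv i (?w n j) x))" for j
    proof -
      have "(LBINT x. ?dX i x * (?w n j x * ?w n j x)) = - (LBINT x. X x * partial_deriv i (\<lambda>x. ?w n j x * ?w n j x) x)"
        by (intro integral_by_parts X smooth_mult sw)
      also have "(\<lambda>x. X x * partial_deriv i (\<lambda>x. ?w n j x * ?w n j x) x) = (\<lambda>x. 2 * (X x * (?w n j x * partial_deriv i (?w n j) x)))"
        by (rule ext, subst partial_deriv_mult) (simp_all add: smooth_differentiable[OF sw])
      finally show ?thesis by simp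
    qed
    have j: "(LBINT x. partial_deriv j Y x * ?w n j x)
       = (LBINT x. ?dX j x * ?w n i x * ?w n j x) + 1/2 * (LBINT x. ?ddX j x * ?v n x * ?w n j x)" for j
    proof -
      have "(LBINT x. partial_deriv j Y x * ?w n j x) =
         (LBINT x. X x * (?w n j x * partial_deriv i (?w n j) x) + ?dX j x * (?w n i x * ?w n j x)
            + 1/2 * (?dX i x * (?w n j x * ?w n j x)) + 1/2 * (?ddX j x * (?v n x * ?w n j x)))"
        unfolding dY by (intro Bochner_Integration.integral_cong) (auto simp: algebra_simps)
      also have "\<dots> = (LBINT x. X x * (?w n j x * partial_deriv i (?w n j) x)) + (LBINT x. ?dX j x * (?w n i x * ?w n j x))
            + 1/2 * (LBINT x. ?dX i x * (?w n j x * ?w n j x)) + 1/2 * (LBINT x. ?ddX j x * (?v n x * ?w n j x))"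
        by (simp only: Bochner_Integration.integral_add Bochner_Integration.integrable_add integrable_mult_right
            integral_mult_right_zero int X tdX tddX sw sv smooth_partial_deriv)
      finally show ?thesis unfolding cancel by (simp add: mult.assoc)
    qed
    have "(\<Sum>j\<in>UNIV. LBINT x. partial_deriv j Y x * ?w n j x) = (\<Sum>j\<in>UNIV. - (LBINT x. Y x * partial_deriv j (?w n j) x))"
      by (intro sum.cong refl integral_by_parts tY sw)
    also have "\<dots> = - (LBINT x. (\<Sum>j\<in>UNIV. Y x * partial_deriv j (?w n j) x))"
      unfolding sum_negf
      by (subst Bochner_Integration.integral_sum)
         (auto intro!: test_function_integrable test_function_mult_smooth[OF tY] smooth_partial_deriv sw)
    also have "\<dots> = (LBINT x. Y x * ?F n x)"
      unfolding sum_distrib_left[symmetric] mom by simp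
    also have "\<dots> = (LBINT x. X x * (?F n x * ?w n i x) + 1/2 * (?dX i x * (?F n x * ?v n x)))"
      unfolding Y_def by (intro Bochner_Integration.integral_cong) (auto simp: algebra_simps)
    also have "\<dots> = (LBINT x. X x * (?F n x * ?w n i x)) + 1/2 * (LBINT x. ?dX i x * (?F n x * ?v n x))"
      by (simp only: Bochner_Integration.integral_add integrable_mult_right integral_mult_right_zero int X tdX sw sv sF)
    finally show ?thesis unfolding j by (simp only: mult.assoc)
  qed
  have lv: "L2_lim ?v u" and lw: "L2_lim (\<lambda>n. ?w n j) (g j)" and lF: "L2_lim ?F f" for j
    by (intro conv_moll_L2_lim uL gL f)+
  have lim: "(\<lambda>n. LBINT x. \<phi> x * a n x * b n x) \<longlonglongrightarrow> (LBINT x. \<phi> x * a' x * b' x)"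
    if t: "test_function \<phi>" "L2_lim a a'" "L2_lim b b'" for \<phi> a b a' b'
  proof -
    obtain B where "\<And>x. \<bar>\<phi> x\<bar> \<le> B" using test_function_bounded[OF t(1)] by metis
    then show ?thesis by (rule L2_lim_integral[OF t(2,3) smooth_borel[OF test_function_smooth[OF t(1)]]])
  qed
  have "(\<lambda>n. \<Sum>j\<in>UNIV. (LBINT x. ?dX j x * ?w n i x * ?w n j x) + 1/2 * (LBINT x. ?ddX j x * ?v n x * ?w n j x))
    \<longlonglongrightarrow> (\<Sum>j\<in>UNIV. (LBINT x. ?dX j x * g i x * g j x) + 1/2 * (LBINT x. ?ddX j x * u x * g j x))"
    by (intro tendsto_sum tendsto_add tendsto_mult_left lim lv lw tdX tddX)
  moreover have "(\<lambda>n. (LBINT x. X x * ?F n x * ?w n i x) + 1/2 * (LBINT x. ?dX i x * ?F n x * ?v n x))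
    \<longlonglongrightarrow> (LBINT x. X x * f x * g i x) + 1/2 * (LBINT x. ?dX i x * f x * u x)"
    by (intro tendsto_add tendsto_mult_left lim lv lw lF tdX X)
  ultimately show ?thesis unfolding id by (rule LIMSEQ_unique)
qed

section \<open>Double integrals and Riesz potentials of densities\<close>

abbreviation pair_lborel :: "((real^'n::finite) \<times> (real^'n)) measure" where
  "pair_lborel \<equiv> lborel \<Otimes>\<^sub>M lborel"

lemma pair_lborel_integrable:
  fixes F :: "(real^'n::finite) \<times> (real^'n) \<Rightarrow> real"
  assumes [measurable]: "F \<in> borel_measurable pair_lborel"
    and f: "integrable lborel f"
    and le: "\<And>x. (\<integral>\<^sup>+y. ennreal \<bar>F (x, y)\<bar> \<partial>lborel) \<le> ennreal \<bar>f x\<bar>"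
  shows "integrable pair_lborel F"
proof (rule integrableI_bounded)
  have "(\<integral>\<^sup>+z. ennreal (norm (F z)) \<partial>pair_lborel) = (\<integral>\<^sup>+x. \<integral>\<^sup>+y. ennreal \<bar>F (x, y)\<bar> \<partial>lborel \<partial>lborel)"
    by (subst lborel.nn_integral_fst[symmetric]) auto
  also have "\<dots> \<le> (\<integral>\<^sup>+x. ennreal \<bar>f x\<bar> \<partial>lborel)" by (intro nn_integral_mono le)
  also have "\<dots> < \<infinity>" using f by (simp add: integrable_iff_bounded)
  finally show "(\<integral>\<^sup>+z. ennreal (norm (F z)) \<partial>pair_lborel) < \<infinity>" .
qed fact

lemma pair_lborel_integrable_bounded:
  fixes f g :: "real^'n::finite \<Rightarrow> real"
  assumes f: "integrable lborel f" and g: "integrable lborel g"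
    and [measurable]: "m \<in> borel_measurable pair_lborel" and m: "\<And>z. \<bar>m z\<bar> \<le> B"
  shows "integrable pair_lborel (\<lambda>(x, y). m (x, y) * f x * g y)"
proof (rule pair_lborel_integrable)
  have [measurable]: "f \<in> borel_measurable borel" "g \<in> borel_measurable borel"
    using f g borel_measurable_integrable by fastforce+
  show "(\<lambda>(x, y). m (x, y) * f x * g y) \<in> borel_measurable pair_lborel" by measurable
  have B: "B \<ge> 0" using m[of undefined] by linarith
  show "integrable lborel (\<lambda>x. B * (LBINT y. \<bar>g y\<bar>) * f x)" using f by simp
  fix x
  have "(\<integral>\<^sup>+y. ennreal \<bar>case (x, y) of (x, y) \<Rightarrow> m (x, y) * f x * g y\<bar> \<partial>lborel) \<le> (\<integral>\<^sup>+y. ennreal (B * \<bar>f x\<bar>) * ennreal \<bar>g y\<bar> \<partial>lborel)"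
  proof (rule nn_integral_mono)
    fix y
    have "\<bar>m (x, y)\<bar> * \<bar>f x\<bar> * \<bar>g y\<bar> \<le> B * \<bar>f x\<bar> * \<bar>g y\<bar>" by (intro mult_right_mono m) auto
    then show "ennreal \<bar>case (x, y) of (x, y) \<Rightarrow> m (x, y) * f x * g y\<bar> \<le> ennreal (B * \<bar>f x\<bar>) * ennreal \<bar>g y\<bar>"
      using B by (simp add: abs_mult ennreal_leI flip: ennreal_mult)
  qed
  also have "\<dots> = ennreal (B * \<bar>f x\<bar>) * ennreal (LBINT y. \<bar>g y\<bar>)"
    using g by (simp add: nn_integral_cmult nn_integral_eq_integral)
  also have "\<dots> = ennreal \<bar>B * (LBINT y. \<bar>g y\<bar>) * f x\<bar>"
    using B by (simp add: abs_mult mult_ac flip: ennreal_mult)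
  finally show "(\<integral>\<^sup>+y. ennreal \<bar>case (x, y) of (x, y) \<Rightarrow> m (x, y) * f x * g y\<bar> \<partial>lborel) \<le> ennreal \<bar>B * (LBINT y. \<bar>g y\<bar>) * f x\<bar>" .
qed

text \<open>Isolates what the potential theory takes from u: an integrable nonnegative density with
  a Hardy bound uniform in the centre. Vector-valued u enters only as w = |u|^2.\<close>

definition Hardy_density :: "real \<Rightarrow> (real^'n::finite \<Rightarrow> real) \<Rightarrow> bool" where
  "Hardy_density C w \<longleftrightarrow> C \<ge> 0 \<and> integrable lborel w \<and> (\<forall>x. w x \<ge> 0) \<and>
     (\<forall>x. (\<integral>\<^sup>+y. ennreal (w y / (norm (x - y))\<^sup>2) \<partial>lborel) \<le> ennreal C)"

text \<open>Inside the unit ball the Hardy weight dominates because \<gamma> <= 2; outside it the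
  kernel is at most 1. At z = 0 both \<open>powr\<close> and division give 0.\<close>

lemma Riesz_kernel_le:
  fixes z :: "'a::real_normed_vector"
  assumes "0 < \<gamma>" "\<gamma> \<le> 2"
  shows "norm z powr (- \<gamma>) \<le> 1 + 1 / (norm z)\<^sup>2"
proof (cases "norm z \<le> 1")
  case True
  show ?thesis
  proof (cases "z = 0")
    case False
    then have "norm z powr (- \<gamma>) \<le> norm z powr (- 2)" using True assms by (intro powr_mono') auto
    also have "\<dots> = 1 / (norm z)\<^sup>2" using False by (simp add: powr_minus_divide)
    finally show ?thesis by simp
  qed simp
next
  case False
  then have "norm z powr (- \<gamma>) \<le> norm z powr 0" using assms by (intro powr_mono) auto
  also have "\<dots> \<le> 1" using False by simp
  also have "1 \<le> 1 + 1 / (norm z)\<^sup>2" by simp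
  finally show ?thesis .
qed

lemma Riesz_nn_bound:
  fixes w :: "real^'n::finite \<Rightarrow> real"
  assumes w: "Hardy_density C w" and \<gamma>: "0 < \<gamma>" "\<gamma> \<le> 2"
  shows "(\<integral>\<^sup>+y. ennreal (norm (x - y) powr (- \<gamma>) * w y) \<partial>lborel) \<le> ennreal (C + (LBINT y. w y))"
proof -
  have wi: "integrable lborel w" and w0: "w x \<ge> 0" and C: "C \<ge> 0"
    and h: "(\<integral>\<^sup>+y. ennreal (w y / (norm (x - y))\<^sup>2) \<partial>lborel) \<le> ennreal C" for x
    using w by (auto simp: Hardy_density_def)
  have [measurable]: "w \<in> borel_measurable borel" using borel_measurable_integrable[OF wi] by simp
  have "(\<integral>\<^sup>+y. ennreal (norm (x - y) powr (- \<gamma>) * w y) \<partial>lborel) \<le> (\<integral>\<^sup>+y. ennreal (w y / (norm (x - y))\<^sup>2) + ennreal (w y) \<partial>lborel)"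
  proof (rule nn_integral_mono)
    fix y
    have "norm (x - y) powr (- \<gamma>) * w y \<le> (1 + 1 / (norm (x - y))\<^sup>2) * w y"
      by (intro mult_right_mono Riesz_kernel_le \<gamma> w0)
    then show "ennreal (norm (x - y) powr (- \<gamma>) * w y) \<le> ennreal (w y / (norm (x - y))\<^sup>2) + ennreal (w y)"
      using w0 by (simp add: ennreal_plus[symmetric] ennreal_leI algebra_simps del: ennreal_plus)
  qed
  also have "\<dots> = (\<integral>\<^sup>+y. ennreal (w y / (norm (x - y))\<^sup>2) \<partial>lborel) + (\<integral>\<^sup>+y. ennreal (w y) \<partial>lborel)"
    by (rule nn_integral_add) auto
  also have "\<dots> \<le> ennreal C + ennreal (LBINT y. w y)"
    using h wi w0 by (intro add_mono) (auto simp: nn_integral_eq_integral)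
  also have "\<dots> = ennreal (C + (LBINT y. w y))"
    using C w0 by (simp add: ennreal_plus Bochner_Integration.integral_nonneg)
  finally show ?thesis .
qed

text \<open>For w = |u|^2 this is \<open>hartree_potential\<close>, expressed through the density
  alone.\<close>

definition Riesz_pot :: "real \<Rightarrow> (real^'n::finite \<Rightarrow> real) \<Rightarrow> real^'n \<Rightarrow> real" where
  "Riesz_pot \<gamma> w x = (LBINT y. norm (x - y) powr (- \<gamma>) * w y)"

lemma Riesz_integrable:
  fixes w :: "real^'n::finite \<Rightarrow> real"
  assumes w: "Hardy_density C w" and \<gamma>: "0 < \<gamma>" "\<gamma> \<le> 2"
  shows "integrable lborel (\<lambda>y. norm (x - y) powr (- \<gamma>) * w y)"
proof (rule integrableI_bounded)
  have wi: "integrable lborel w" and w0: "w x \<ge> 0" for x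
    using w by (auto simp: Hardy_density_def)
  have [measurable]: "w \<in> borel_measurable borel" using borel_measurable_integrable[OF wi] by simp
  show "(\<lambda>y. norm (x - y) powr (- \<gamma>) * w y) \<in> borel_measurable lborel" by measurable
  have "(\<integral>\<^sup>+y. ennreal (norm (norm (x - y) powr (- \<gamma>) * w y)) \<partial>lborel) = (\<integral>\<^sup>+y. ennreal (norm (x - y) powr (- \<gamma>) * w y) \<partial>lborel)"
    using w0 by (intro nn_integral_cong) (simp add: abs_mult)
  also have "\<dots> < \<infinity>"
    unfolding infinity_ennreal_def by (rule le_less_trans[OF Riesz_nn_bound[OF w \<gamma>] ennreal_less_top])
  finally show "(\<integral>\<^sup>+y. ennreal (norm (norm (x - y) powr (- \<gamma>) * w y)) \<partial>lborel) < \<infinity>" .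
qed

text \<open>Boundedness of the potential puts its product with an L^2 function back into L^2, so the
  nonlinearity can be mollified in L^2.\<close>

lemma Riesz_pot_bounds:
  fixes w :: "real^'n::finite \<Rightarrow> real"
  assumes w: "Hardy_density C w" and \<gamma>: "0 < \<gamma>" "\<gamma> \<le> 2"
  shows "0 \<le> Riesz_pot \<gamma> w x" "Riesz_pot \<gamma> w x \<le> C + (LBINT y. w y)"
    "Riesz_pot \<gamma> w \<in> borel_measurable borel"
proof -
  have wi: "integrable lborel w" and w0: "w x \<ge> 0" and C: "C \<ge> 0" for x
    using w by (auto simp: Hardy_density_def)
  have [measurable]: "w \<in> borel_measurable borel" using borel_measurable_integrable[OF wi] by simp
  show "0 \<le> Riesz_pot \<gamma> w x"
    unfolding Riesz_pot_def using w0 by (intro Bochner_Integration.integral_nonneg) auto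
  have "ennreal (Riesz_pot \<gamma> w x) = (\<integral>\<^sup>+y. ennreal (norm (x - y) powr (- \<gamma>) * w y) \<partial>lborel)"
    unfolding Riesz_pot_def using w0 by (intro nn_integral_eq_integral[symmetric] Riesz_integrable[OF w \<gamma>]) auto
  also have "\<dots> \<le> ennreal (C + (LBINT y. w y))" by (rule Riesz_nn_bound[OF w \<gamma>])
  finally show "Riesz_pot \<gamma> w x \<le> C + (LBINT y. w y)"
    using C w0 by (subst (asm) ennreal_le_iff) (auto intro!: add_nonneg_nonneg Bochner_Integration.integral_nonneg)
  show "Riesz_pot \<gamma> w \<in> borel_measurable borel"
    unfolding Riesz_pot_def[abs_def] by measurable
qed

lemma Riesz_pair_integrable:
  fixes w :: "real^'n::finite \<Rightarrow> real"
  assumes w: "Hardy_density C w" and \<gamma>: "0 < \<gamma>" "\<gamma> \<le> 2"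
  shows "integrable pair_lborel (\<lambda>(x, y). norm (x - y) powr (- \<gamma>) * w x * w y)"
proof (rule pair_lborel_integrable)
  have wi: "integrable lborel w" and w0: "w x \<ge> 0" and C: "C \<ge> 0" for x
    using w by (auto simp: Hardy_density_def)
  have [measurable]: "w \<in> borel_measurable borel" using borel_measurable_integrable[OF wi] by simp
  show "(\<lambda>(x, y). norm (x - y) powr (- \<gamma>) * w x * w y) \<in> borel_measurable pair_lborel" by measurable
  show "integrable lborel (\<lambda>x. (C + (LBINT y. w y)) * w x)" using wi by simp
  fix x
  have "(\<integral>\<^sup>+y. ennreal \<bar>case (x, y) of (x, y) \<Rightarrow> norm (x - y) powr (- \<gamma>) * w x * w y\<bar> \<partial>lborel)
     = (\<integral>\<^sup>+y. ennreal (w x) * ennreal (norm (x - y) powr (- \<gamma>) * w y) \<partial>lborel)"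
    using w0 by (intro nn_integral_cong) (simp add: abs_mult mult_ac flip: ennreal_mult)
  also have "\<dots> \<le> ennreal (w x) * ennreal (C + (LBINT y. w y))"
    using Riesz_nn_bound[OF w \<gamma>] by (subst nn_integral_cmult) (auto intro!: mult_left_mono)
  also have "\<dots> = ennreal \<bar>(C + (LBINT y. w y)) * w x\<bar>"
  proof -
    have "0 \<le> C + (LBINT y. w y)" using C w0 by (intro add_nonneg_nonneg Bochner_Integration.integral_nonneg)
    then show ?thesis using ennreal_mult[OF w0, of "C + (LBINT y. w y)" x] w0[of x]
      by (simp only: abs_mult abs_of_nonneg mult.commute)
  qed
  finally show "(\<integral>\<^sup>+y. ennreal \<bar>case (x, y) of (x, y) \<Rightarrow> norm (x - y) powr (- \<gamma>) * w x * w y\<bar> \<partial>lborel) \<le> ennreal \<bar>(C + (LBINT y. w y)) * w x\<bar>" .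
qed

text \<open>The shift by \<epsilon> only lowers negative powers, so the singular kernel dominates
  all its regularisations. The point z = 0 is excluded there because \<open>powr\<close> has value 0
  at base 0.\<close>

lemma reg_pow_le_kernel:
  assumes "\<epsilon> > 0" "p > 0"
  shows "0 < reg_pow (- p) \<epsilon> z" "z \<noteq> 0 \<Longrightarrow> reg_pow (- p) \<epsilon> z \<le> norm z powr (- (2 * p))" "reg_pow (- p) \<epsilon> z \<le> \<epsilon> powr (- p)"
proof -
  have pos: "(norm z)\<^sup>2 + \<epsilon> > 0" using assms by (simp add: add_nonneg_pos)
  then show "0 < reg_pow (- p) \<epsilon> z" by (simp add: reg_pow_def)
  show "reg_pow (- p) \<epsilon> z \<le> \<epsilon> powr (- p)"
    unfolding reg_pow_def using assms by (intro powr_mono2') auto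
  assume z: "z \<noteq> 0"
  have "reg_pow (- p) \<epsilon> z \<le> ((norm z)\<^sup>2) powr (- p)"
    unfolding reg_pow_def using assms z by (intro powr_mono2') auto
  also have "\<dots> = norm z powr (- (2 * p))" using z by (simp add: powr_powr flip: powr_numeral)
  finally show "reg_pow (- p) \<epsilon> z \<le> norm z powr (- (2 * p))" .
qed

lemma reg_pow_tendsto:
  assumes "z \<noteq> 0"
  shows "(\<lambda>n. reg_pow p (1 / real (Suc n)) z) \<longlonglongrightarrow> norm z powr (2 * p)"
proof -
  have "(\<lambda>n. ((norm z)\<^sup>2 + inverse (real (Suc n))) powr p) \<longlonglongrightarrow> ((norm z)\<^sup>2 + 0) powr p"
    by (intro tendsto_powr tendsto_add tendsto_const LIMSEQ_inverse_real_of_nat) (use assms in simp)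
  moreover have "((norm z)\<^sup>2 + 0) powr p = norm z powr (2 * p)"
    using assms by (simp add: powr_powr flip: powr_numeral)
  ultimately show ?thesis by (simp add: reg_pow_def inverse_eq_divide)
qed

lemma integrable_mult_bounded:
  fixes f m :: "'a \<Rightarrow> real"
  assumes f: "integrable M f" and m: "m \<in> borel_measurable M" "\<And>x. \<bar>m x\<bar> \<le> B"
  shows "integrable M (\<lambda>x. m x * f x)"
proof (rule Bochner_Integration.integrable_bound)
  show "integrable M (\<lambda>x. B * f x)" using f by simp
  show "(\<lambda>x. m x * f x) \<in> borel_measurable M" using m(1) borel_measurable_integrable[OF f] by simp
  have B: "B \<ge> 0" using m(2)[of undefined] by linarith
  show "AE x in M. norm (m x * f x) \<le> norm (B * f x)"
    using m(2) B by (intro AE_I2) (simp add: abs_mult mult_right_mono)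
qed

lemma AE_lborel_neq: "AE y in lborel. y \<noteq> (x::'a::euclidean_space)"
  by (rule AE_lborel_singleton)

text \<open>The factor \<open>X(x)\<close> is antisymmetrised to \<open>X(x) - X(y)\<close>, which compensates the extra
  singularity of the differentiated kernel.\<close>

lemma Riesz_virial:
  fixes w p X :: "real^'n::finite \<Rightarrow> real"
  assumes w: "Hardy_density C w" and \<gamma>: "0 < \<gamma>" "\<gamma> \<le> 2"
    and p: "integrable lborel p"
    and prod: "\<And>\<phi>. test_function \<phi> \<Longrightarrow> (LBINT x. partial_deriv i \<phi> x * w x) = - 2 * (LBINT x. \<phi> x * p x)"
    and X: "test_function X"
  shows "(LBINT x. Riesz_pot \<gamma> w x * (X x * p x + 1/2 * (partial_deriv i X x * w x)))
     = \<gamma> / 4 * (\<integral>(x, y). norm (x - y) powr (- \<gamma> - 2) * ((X x - X y) * (x $ i - y $ i)) * w x * w y \<partial>pair_lborel)"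
proof -
  have wi: "integrable lborel w" and w0: "w x \<ge> 0" and C: "C \<ge> 0" for x
    using w by (auto simp: Hardy_density_def)
  have [measurable]: "w \<in> borel_measurable borel" "p \<in> borel_measurable borel"
    using borel_measurable_integrable[OF wi] borel_measurable_integrable[OF p] by auto
  let ?dX = "partial_deriv i X"
  have Xm [measurable]: "X \<in> borel_measurable borel" "?dX \<in> borel_measurable borel"
    by (intro smooth_borel smooth_partial_deriv test_function_smooth X)+
  obtain BX where BX: "\<And>x. \<bar>X x\<bar> \<le> BX" using test_function_bounded[OF X] by metis
  obtain BdX where BdX: "\<And>x. \<bar>?dX x\<bar> \<le> BdX" using test_function_bounded[OF test_function_partial_deriv[OF X]] by metis
  obtain L where L: "L > 0" "\<And>x y. \<bar>X x - X y\<bar> \<le> L * norm (x - y)" using test_function_Lipschitz[OF X] by metis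
  define q where "q x = X x * p x + 1/2 * (?dX x * w x)" for x
  have qi: "integrable lborel q" unfolding q_def
    by (intro Bochner_Integration.integrable_add integrable_mult_right integrable_mult_bounded[OF p _ BX] integrable_mult_bounded[OF wi _ BdX]) auto
  have [measurable]: "q \<in> borel_measurable borel" using borel_measurable_integrable[OF qi] by simp
  define e where "e n = 1 / real (Suc n)" for n
  have e: "e n > 0" for n by (simp add: e_def)
  \<comment> \<open>\<open>K n\<close> regularises |z|^(-\<gamma>) and \<open>R n\<close>
    regularises |z|^(-\<gamma> - 2) with the same shift. Hence the i-th derivative of
    \<open>K n\<close> is - \<gamma> z_i \<open>R n\<close>, and (|z|^2 + e n) \<open>R n\<close> =
    \<open>K n\<close>.\<close>
  define K where "K n z = reg_pow (- (\<gamma> / 2)) (e n) (z :: real^'n)" for n z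
  define R where "R n z = reg_pow (- (\<gamma> / 2 + 1)) (e n) (z :: real^'n)" for n z
  define M where "M = C + (LBINT y. w y)"
  note V = Riesz_pot_bounds[OF w \<gamma>, folded M_def]
  have [measurable]: "Riesz_pot \<gamma> w \<in> borel_measurable borel" by (rule V(3))
  have sK: "smooth (K n)" and sR: "smooth (R n)" for n unfolding K_def[abs_def] R_def[abs_def] by (intro smooth_reg_pow e)+
  have [measurable]: "K n \<in> borel_measurable borel" "R n \<in> borel_measurable borel" for n
    using sK sR smooth_borel by auto
  have K: "0 < K n z" "z \<noteq> 0 \<Longrightarrow> K n z \<le> norm z powr (- \<gamma>)" "K n z \<le> e n powr (- (\<gamma>/2))" for n z
    using reg_pow_le_kernel[OF e[of n], of "\<gamma>/2" z] \<gamma> by (auto simp: K_def)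
  have Kabs: "\<bar>K n z\<bar> \<le> e n powr (- (\<gamma>/2))" for n z using K(1,3)[of n z] by (simp add: abs_of_pos)
  have Klim: "z \<noteq> 0 \<Longrightarrow> (\<lambda>n. K n z) \<longlonglongrightarrow> norm z powr (- \<gamma>)" for z
    using reg_pow_tendsto[of z "- (\<gamma>/2)"] by (simp add: K_def e_def)
  have Rlim: "z \<noteq> 0 \<Longrightarrow> (\<lambda>n. R n z) \<longlonglongrightarrow> norm z powr (- \<gamma> - 2)" for z
  proof -
    have "2 * - (\<gamma>/2 + 1) = - \<gamma> - 2" by simp
    then show "z \<noteq> 0 \<Longrightarrow> (\<lambda>n. R n z) \<longlonglongrightarrow> norm z powr (- \<gamma> - 2)"
      using reg_pow_tendsto[of z "- (\<gamma>/2 + 1)"] unfolding R_def e_def by (metis (no_types, lifting))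
  qed
  have R0: "0 < R n z" for n z
    using reg_pow_le_kernel(1)[OF e[of n], of "\<gamma>/2 + 1" z] \<gamma> by (auto simp: R_def)
  have RK: "((norm z)\<^sup>2 + e n) * R n z = K n z" for n z
  proof -
    have pos: "(norm z)\<^sup>2 + e n > 0" using e by (simp add: add_nonneg_pos)
    have "((norm z)\<^sup>2 + e n) * R n z = ((norm z)\<^sup>2 + e n) powr 1 * ((norm z)\<^sup>2 + e n) powr (- (\<gamma>/2 + 1))"
      using pos by (simp add: R_def reg_pow_def)
    also have "\<dots> = K n z" unfolding powr_add[symmetric] K_def reg_pow_def by simp
    finally show ?thesis .
  qed
  have dK: "partial_deriv i (K n) z = - \<gamma> * z $ i * R n z" for n z
  proof -
    have "- (\<gamma>/2) - 1 = - (\<gamma>/2 + 1)" by simp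
    then show ?thesis
      using partial_deriv_reg_pow[OF e[of n], of i "- (\<gamma>/2)" z] unfolding K_def[abs_def] R_def by simp
  qed
  have Rsym: "R n (y - x) = R n (x - y)" for n x y by (simp add: R_def reg_pow_def norm_minus_commute)
  \<comment> \<open>This bound degenerates as n grows; it serves only to justify Fubini's theorem at
    fixed n.\<close>
  have zR: "\<bar>z $ i\<bar> * R n z \<le> (1 + 1 / e n) * e n powr (- (\<gamma>/2))" for n z
  proof -
    have "\<bar>z $ i\<bar> \<le> 1 + (norm z)\<^sup>2"
      using component_le_norm_cart[of z i] sum_squares_bound[of 1 "norm z"] zero_le_power2[of "norm z"] by simp
    also have "\<dots> \<le> (1 + 1 / e n) * ((norm z)\<^sup>2 + e n)"
    proof -
      have "(1 + 1 / e n) * ((norm z)\<^sup>2 + e n) = (norm z)\<^sup>2 + e n + (norm z)\<^sup>2 / e n + 1" using e[of n] by (simp add: field_simps)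
      then show ?thesis using e[of n] by simp
    qed
    finally have "\<bar>z $ i\<bar> * R n z \<le> (1 + 1 / e n) * ((norm z)\<^sup>2 + e n) * R n z"
      by (rule mult_right_mono) (rule less_imp_le[OF R0])
    also have "\<dots> = (1 + 1 / e n) * K n z" using RK[where z = z and n = n] by (simp only: mult.assoc)
    also have "\<dots> \<le> (1 + 1 / e n) * e n powr (- (\<gamma>/2))"
      by (rule mult_left_mono[OF K(3)]) (use e[of n] in simp)
    finally show ?thesis .
  qed
  define VN where "VN n x = (LBINT y. K n (x - y) * w y)" for n x
  have [measurable]: "VN n \<in> borel_measurable borel" for n unfolding VN_def[abs_def] by measurable
  have Ki: "integrable lborel (\<lambda>y. K n (x - y) * w y)" for n x
    by (rule integrable_mult_bounded[OF wi _ Kabs]) measurable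
  have Kle: "AE y in lborel. K n (x - y) * w y \<le> norm (x - y) powr (- \<gamma>) * w y" for n x
    using AE_lborel_neq[of x]
  proof eventually_elim
    case (elim y)
    then show ?case by (intro mult_right_mono K(2) w0) auto
  qed
  have VNb: "\<bar>VN n x\<bar> \<le> M" for n x
  proof -
    have "VN n x \<ge> 0" unfolding VN_def
      by (intro Bochner_Integration.integral_nonneg mult_nonneg_nonneg less_imp_le[OF K(1)] w0)
    moreover have "VN n x \<le> Riesz_pot \<gamma> w x" unfolding VN_def Riesz_pot_def
      by (intro integral_mono_AE Ki Riesz_integrable[OF w \<gamma>] Kle)
    ultimately show ?thesis using V(2)[of x] by linarith
  qed
  have VNlim: "(\<lambda>n. VN n x) \<longlonglongrightarrow> Riesz_pot \<gamma> w x" for x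
    unfolding VN_def Riesz_pot_def
  proof (rule integral_dominated_convergence[where w = "\<lambda>y. norm (x - y) powr (- \<gamma>) * w y"])
    show "integrable lborel (\<lambda>y. norm (x - y) powr (- \<gamma>) * w y)" by (rule Riesz_integrable[OF w \<gamma>])
    show "AE y in lborel. (\<lambda>n. K n (x - y) * w y) \<longlonglongrightarrow> norm (x - y) powr (- \<gamma>) * w y"
      using AE_lborel_neq[of x]
    proof eventually_elim
      case (elim y)
      then show ?case by (intro tendsto_mult tendsto_const Klim) auto
    qed
    show "AE y in lborel. norm (K n (x - y) * w y) \<le> norm (x - y) powr (- \<gamma>) * w y" for n
      using Kle[of n x]
    proof eventually_elim
      case (elim y)
      then show ?case using less_imp_le[OF K(1)] w0 by (simp add: abs_mult)
    qed
  qed measurable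
  have lim1: "(\<lambda>n. LBINT x. VN n x * q x) \<longlonglongrightarrow> (LBINT x. Riesz_pot \<gamma> w x * q x)"
  proof (rule integral_dominated_convergence[where w = "\<lambda>x. M * \<bar>q x\<bar>"])
    show "integrable lborel (\<lambda>x. M * \<bar>q x\<bar>)" using qi by (intro integrable_mult_right integrable_abs)
    show "AE x in lborel. (\<lambda>n. VN n x * q x) \<longlonglongrightarrow> Riesz_pot \<gamma> w x * q x"
      by (intro AE_I2 tendsto_mult tendsto_const VNlim)
    show "AE x in lborel. norm (VN n x * q x) \<le> M * \<bar>q x\<bar>" for n
      unfolding real_norm_def abs_mult by (intro AE_I2 mult_right_mono VNb) auto
  qed measurable
  define S where "S n z = (case z of (x, y) \<Rightarrow> R n (x - y) * ((X x - X y) * (x $ i - y $ i)) * w x * w y)" for n z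
  have [measurable]: "S n \<in> borel_measurable pair_lborel" for n unfolding S_def[abs_def] by measurable
  have step: "(LBINT x. VN n x * q x) = \<gamma> / 4 * integral\<^sup>L pair_lborel (S n)" for n
  proof -
    let ?F = "\<lambda>x y. K n (x - y) * q x * w y"
    have "integrable pair_lborel (\<lambda>(x, y). (\<lambda>z. K n (fst z - snd z)) (x, y) * q x * w y)"
      by (rule pair_lborel_integrable_bounded[OF qi wi _ Kabs]) measurable
    then have Fi: "integrable pair_lborel (case_prod ?F)" by simp
    define m where "m z = X (fst z) * ((fst z - snd z) $ i * R n (fst z - snd z))" for z :: "(real^'n) \<times> (real^'n)"
    have [measurable]: "m \<in> borel_measurable pair_lborel" unfolding m_def[abs_def] by measurable
    have mb: "\<bar>m z\<bar> \<le> BX * ((1 + 1 / e n) * e n powr (- (\<gamma>/2)))" for z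
      unfolding m_def abs_mult abs_of_pos[OF R0]
      by (intro mult_mono BX zR) (use BX[of 0] less_imp_le[OF R0] in auto)
    have Gi: "integrable pair_lborel (\<lambda>(x, y). m (x, y) * w x * w y)"
      by (rule pair_lborel_integrable_bounded[OF wi wi _ mb]) measurable
    \<comment> \<open>For fixed y the function X(x) \<open>K n (x - y)\<close> is a test function,
      so \<open>prod\<close> applies to it. The derivative falling on X completes the integrand
      \<open>q\<close>, the one falling on the kernel yields \<open>m\<close>.\<close>
    have inner: "(LBINT x. ?F x y) = \<gamma> / 2 * (LBINT x. m (x, y) * w x * w y)" for y
    proof -
      have sKy: "smooth (\<lambda>x. K n (x - y))" using smooth_affine[OF sK[of n], of 1 "- y"] by simp
      have dKy: "partial_deriv i (\<lambda>x. K n (x - y)) x = - \<gamma> * (x - y) $ i * R n (x - y)" for x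
        using partial_deriv_affine[OF sK[of n], of i 1 "- y" x] by (simp add: dK)
      let ?\<phi> = "\<lambda>x. X x * K n (x - y)"
      have t\<phi>: "test_function ?\<phi>" by (intro test_function_mult_smooth X sKy)
      have d\<phi>: "partial_deriv i ?\<phi> x = ?dX x * K n (x - y) - \<gamma> * m (x, y)" for x
        by (subst partial_deriv_mult) (simp_all add: smooth_differentiable test_function_smooth[OF X] sKy dKy m_def algebra_simps)
      have i1: "integrable lborel (\<lambda>x. K n (x - y) * (?dX x * w x))"
        by (intro integrable_mult_bounded[OF _ _ Kabs] integrable_mult_bounded[OF wi _ BdX]) auto
      have i2: "integrable lborel (\<lambda>x. m (x, y) * w x)"
        by (rule integrable_mult_bounded[OF wi _ mb]) (rule measurable_Pair1[OF \<open>m \<in> borel_measurable pair_lborel\<close>], simp)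
      have i3: "integrable lborel (\<lambda>x. K n (x - y) * (X x * p x))"
        by (intro integrable_mult_bounded[OF _ _ Kabs] integrable_mult_bounded[OF p _ BX]) auto
      have "(LBINT x. partial_deriv i ?\<phi> x * w x) = - 2 * (LBINT x. ?\<phi> x * p x)" by (rule prod[OF t\<phi>])
      also have "(\<lambda>x. partial_deriv i ?\<phi> x * w x) = (\<lambda>x. K n (x - y) * (?dX x * w x) - \<gamma> * (m (x, y) * w x))"
        unfolding d\<phi> by (simp add: fun_eq_iff algebra_simps)
      also have "(LBINT x. K n (x - y) * (?dX x * w x) - \<gamma> * (m (x, y) * w x))
         = (LBINT x. K n (x - y) * (?dX x * w x)) - \<gamma> * (LBINT x. m (x, y) * w x)"
        using i1 i2 by simp
      also have "(\<lambda>x. ?\<phi> x * p x) = (\<lambda>x. K n (x - y) * (X x * p x))" by (simp add: fun_eq_iff)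
      finally have eq: "(LBINT x. K n (x - y) * (X x * p x)) + 1/2 * (LBINT x. K n (x - y) * (?dX x * w x))
        = \<gamma> / 2 * (LBINT x. m (x, y) * w x)" by simp
      have "(LBINT x. ?F x y) = (LBINT x. (K n (x - y) * (X x * p x) + 1/2 * (K n (x - y) * (?dX x * w x))) * w y)"
        unfolding q_def by (intro Bochner_Integration.integral_cong) (auto simp: algebra_simps)
      also have "\<dots> = ((LBINT x. K n (x - y) * (X x * p x)) + 1/2 * (LBINT x. K n (x - y) * (?dX x * w x))) * w y"
        using i1 i3 by simp
      finally show ?thesis unfolding eq by simp
    qed
    have "(LBINT x. VN n x * q x) = (LBINT x. (LBINT y. ?F x y))"
    proof (intro Bochner_Integration.integral_cong refl)
      fix x
      have "(LBINT y. ?F x y) = (LBINT y. K n (x - y) * w y * q x)"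
        by (intro Bochner_Integration.integral_cong) auto
      then show "VN n x * q x = (LBINT y. ?F x y)" unfolding VN_def by simp
    qed
    also have "\<dots> = (LBINT y. (LBINT x. ?F x y))" by (rule lborel_pair.Fubini_integral[OF Fi, symmetric])
    also have "\<dots> = \<gamma> / 2 * (LBINT y. (LBINT x. m (x, y) * w x * w y))"
      unfolding inner by simp
    also have "(LBINT y. (LBINT x. m (x, y) * w x * w y)) = (\<integral>(x, y). m (x, y) * w x * w y \<partial>pair_lborel)"
      by (rule lborel_pair.integral_snd[OF Gi])
    finally have 1: "(LBINT x. VN n x * q x) = \<gamma> / 2 * (\<integral>(x, y). m (x, y) * w x * w y \<partial>pair_lborel)" .
    \<comment> \<open>Exchanging x and y preserves the integral. As z_i is odd and
      \<open>R n\<close> even, \<open>?G\<close> + \<open>?G'\<close> contains the difference X(x) -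
      X(y), and \<gamma>/2 becomes \<gamma>/4.\<close>
    let ?G = "\<lambda>(x, y). m (x, y) * w x * w y" and ?G' = "\<lambda>(x, y). m (y, x) * w x * w y"
    have swap: "integral\<^sup>L pair_lborel ?G' = integral\<^sup>L pair_lborel ?G"
      using lborel_pair.integral_product_swap[OF borel_measurable_integrable[OF Gi]]
      by (simp add: case_prod_beta mult_ac)
    have Gi': "integrable pair_lborel ?G'"
      using lborel_pair.integrable_product_swap[OF Gi] by (simp add: case_prod_beta mult_ac)
    have "integral\<^sup>L pair_lborel (S n) = (\<integral>z. ?G z + ?G' z \<partial>pair_lborel)"
    proof (intro Bochner_Integration.integral_cong refl)
      fix z :: "(real^'n) \<times> (real^'n)"
      obtain x y where z: "z = (x, y)" by (cases z)
      show "S n z = ?G z + ?G' z"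
        unfolding z S_def m_def by (simp add: Rsym[of n y x] algebra_simps)
    qed
    also have "\<dots> = 2 * integral\<^sup>L pair_lborel ?G"
      using Gi Gi' swap by simp
    finally show ?thesis unfolding 1 by simp
  qed
  \<comment> \<open>The Lipschitz bound |X(x) - X(y)| |x_i - y_i| <= L |x - y|^2 compensates the two
    extra negative powers, so |x - y|^(-\<gamma>) w(x) w(y) dominates uniformly in n.\<close>
  have lim2: "(\<lambda>n. integral\<^sup>L pair_lborel (S n)) \<longlonglongrightarrow>
     (\<integral>(x, y). norm (x - y) powr (- \<gamma> - 2) * ((X x - X y) * (x $ i - y $ i)) * w x * w y \<partial>pair_lborel)"
  proof (rule integral_dominated_convergence[where w = "\<lambda>z. L * (case z of (x, y) \<Rightarrow> norm (x - y) powr (- \<gamma>) * w x * w y)"])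
    show "(\<lambda>(x, y). norm (x - y) powr (- \<gamma> - 2) * ((X x - X y) * (x $ i - y $ i)) * w x * w y) \<in> borel_measurable pair_lborel"
      by measurable
    show "integrable pair_lborel (\<lambda>z. L * (case z of (x, y) \<Rightarrow> norm (x - y) powr (- \<gamma>) * w x * w y))"
      by (intro integrable_mult_right Riesz_pair_integrable[OF w \<gamma>])
    show "AE z in pair_lborel. (\<lambda>n. S n z) \<longlonglongrightarrow> (case z of (x, y) \<Rightarrow> norm (x - y) powr (- \<gamma> - 2) * ((X x - X y) * (x $ i - y $ i)) * w x * w y)"
    proof (rule AE_I2)
      fix z :: "(real^'n) \<times> (real^'n)"
      obtain x y where z: "z = (x, y)" by (cases z)
      show "(\<lambda>n. S n z) \<longlonglongrightarrow> (case z of (x, y) \<Rightarrow> norm (x - y) powr (- \<gamma> - 2) * ((X x - X y) * (x $ i - y $ i)) * w x * w y)"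
      proof (cases "x = y")
        case True then show ?thesis by (simp add: z S_def)
      next
        case False
        then show ?thesis unfolding z S_def prod.case by (intro tendsto_mult tendsto_const Rlim) auto
      qed
    qed
    show "AE z in pair_lborel. norm (S n z) \<le> L * (case z of (x, y) \<Rightarrow> norm (x - y) powr (- \<gamma>) * w x * w y)" for n
    proof (rule AE_I2)
      fix z :: "(real^'n) \<times> (real^'n)"
      obtain x y where z: "z = (x, y)" by (cases z)
      show "norm (S n z) \<le> L * (case z of (x, y) \<Rightarrow> norm (x - y) powr (- \<gamma>) * w x * w y)"
      proof (cases "x = y")
        case True then show ?thesis by (simp add: z S_def)
      next
        case False
        have "\<bar>X x - X y\<bar> * \<bar>x $ i - y $ i\<bar> \<le> (L * norm (x - y)) * norm (x - y)"
          using component_le_norm_cart[of "x - y" i] L by (intro mult_mono L) auto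
        then have "R n (x - y) * (\<bar>X x - X y\<bar> * \<bar>x $ i - y $ i\<bar>) \<le> R n (x - y) * (L * (norm (x - y))\<^sup>2)"
          using less_imp_le[OF R0] by (intro mult_left_mono) (simp_all add: power2_eq_square mult.assoc)
        also have "\<dots> = L * ((norm (x - y))\<^sup>2 * R n (x - y))" by simp
        also have "\<dots> \<le> L * K n (x - y)"
        proof (rule mult_left_mono)
          have "(norm (x - y))\<^sup>2 * R n (x - y) \<le> ((norm (x - y))\<^sup>2 + e n) * R n (x - y)"
            using e[of n] less_imp_le[OF R0] by (intro mult_right_mono) auto
          then show "(norm (x - y))\<^sup>2 * R n (x - y) \<le> K n (x - y)" unfolding RK .
        qed (use L in simp)
        also have "\<dots> \<le> L * norm (x - y) powr (- \<gamma>)"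
          using L False by (intro mult_left_mono K(2)) auto
        finally have "R n (x - y) * (\<bar>X x - X y\<bar> * \<bar>x $ i - y $ i\<bar>) * (w x * w y) \<le> L * norm (x - y) powr (- \<gamma>) * (w x * w y)"
          using w0 by (intro mult_right_mono) auto
        then show ?thesis using w0 less_imp_le[OF R0] by (simp add: z S_def abs_mult mult.assoc)
      qed
    qed
  qed measurable
  from tendsto_mult_left[OF lim2, of "\<gamma> / 4"] show ?thesis
    unfolding q_def[symmetric] by (rule LIMSEQ_unique[OF lim1[unfolded step]])
qed

lemma integral_bounded_mult_tendsto:
  fixes F :: "'a \<Rightarrow> real"
  assumes F: "integrable M F" and m: "\<And>n. m n \<in> borel_measurable M" "m' \<in> borel_measurable M"
    and b: "\<And>n x. \<bar>m n x\<bar> \<le> B" and lim: "\<And>x. (\<lambda>n. m n x) \<longlonglongrightarrow> m' x"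
  shows "(\<lambda>n. \<integral>x. m n x * F x \<partial>M) \<longlonglongrightarrow> (\<integral>x. m' x * F x \<partial>M)"
proof (rule integral_dominated_convergence[where w = "\<lambda>x. B * \<bar>F x\<bar>"])
  note [measurable] = borel_measurable_integrable[OF F] m
  show "integrable M (\<lambda>x. B * \<bar>F x\<bar>)" using F by (intro integrable_mult_right integrable_abs)
  show "AE x in M. (\<lambda>n. m n x * F x) \<longlonglongrightarrow> m' x * F x"
    by (intro AE_I2 tendsto_mult lim tendsto_const)
  show "AE x in M. norm (m n x * F x) \<le> B * \<bar>F x\<bar>" for n
    unfolding real_norm_def abs_mult by (intro AE_I2 mult_right_mono b) auto
  show "(\<lambda>x. m' x * F x) \<in> borel_measurable M" "(\<lambda>x. m n x * F x) \<in> borel_measurable M" for n by measurable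
qed

text \<open>The vector field \<open>x \<mapsto> \<eta>(x/(n+1)) x\<close> with a cutoff \<open>\<eta>\<close>, \<open>\<eta>(0) = 1\<close>; its scaling keeps the
  first derivatives bounded and makes the second derivatives vanish in the limit.\<close>

definition dil0 :: "'n::finite \<Rightarrow> real^'n \<Rightarrow> real" where
  "dil0 i x = cutoff x * x $ i"

definition dil :: "nat \<Rightarrow> 'n::finite \<Rightarrow> real^'n \<Rightarrow> real" where
  "dil n i x = dil0 i ((1 / real (Suc n)) *\<^sub>R x) * real (Suc n)"

lemma dil0_test_function: "test_function (dil0 i)"
  unfolding dil0_def[abs_def] by (intro test_function_mult_smooth cutoff_test_function smooth_coord)

lemma dil_test_function: "test_function (dil n i)"
  unfolding dil_def[abs_def]
  using test_function_affine[OF dil0_test_function[of i], of "1 / real (Suc n)" 0]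
  by (intro test_function_mult_smooth smooth_const) (simp del: of_nat_Suc)

lemma partial_deriv_dil0: "partial_deriv j (dil0 i) 0 = (if j = i then 1 else 0)"
  unfolding dil0_def[abs_def]
  by (subst partial_deriv_mult, intro smooth_differentiable test_function_smooth cutoff_test_function,
      intro smooth_differentiable smooth_coord)
     (simp add: partial_deriv_coord cutoff_0)

lemma partial_deriv_dil: "partial_deriv j (dil n i) x = partial_deriv j (dil0 i) ((1 / real (Suc n)) *\<^sub>R x)"
proof -
  have "partial_deriv j (dil n i) x = partial_deriv j (\<lambda>x. real (Suc n) * dil0 i ((1 / real (Suc n)) *\<^sub>R x + 0)) x"
    by (simp add: dil_def[abs_def] mult.commute)
  also have "\<dots> = real (Suc n) * partial_deriv j (\<lambda>x. dil0 i ((1 / real (Suc n)) *\<^sub>R x + 0)) x"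
    by (intro partial_deriv_cmult smooth_differentiable smooth_affine test_function_smooth dil0_test_function)
  also have "\<dots> = partial_deriv j (dil0 i) ((1 / real (Suc n)) *\<^sub>R x)"
    by (subst partial_deriv_affine[OF test_function_smooth[OF dil0_test_function]]) (simp del: of_nat_Suc)
  finally show ?thesis .
qed

lemma partial_deriv_dil2:
  "partial_deriv k (partial_deriv j (dil n i)) x = 1 / real (Suc n) * partial_deriv k (partial_deriv j (dil0 i)) ((1 / real (Suc n)) *\<^sub>R x)"
proof -
  have sm: "smooth (partial_deriv j (dil0 i))" by (intro smooth_partial_deriv test_function_smooth dil0_test_function)
  have "partial_deriv j (dil n i) = (\<lambda>x. partial_deriv j (dil0 i) ((1 / real (Suc n)) *\<^sub>R x + 0))"
    by (simp add: fun_eq_iff partial_deriv_dil)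
  then show ?thesis using partial_deriv_affine[OF sm, of k "1 / real (Suc n)" 0 x] by (simp del: of_nat_Suc)
qed

lemma dil_tendsto: "(\<lambda>n. dil n i (x :: real^'n::finite)) \<longlonglongrightarrow> x $ i"
proof -
  have "(\<lambda>n. cutoff ((1 / real (Suc n)) *\<^sub>R x) * x $ i) \<longlonglongrightarrow> cutoff (0 :: real^'n) * x $ i"
    by (rule tendsto_mult[OF smooth_tendsto_at_0[OF test_function_smooth[OF cutoff_test_function]] tendsto_const])
  then show ?thesis by (simp del: of_nat_Suc add: dil_def dil0_def cutoff_0)
qed

text \<open>The factor n+1 in front offsets the scaling of the argument exactly, so one L serves all
  n; this gives the domination in \<open>Riesz_virial_limit\<close>.\<close>

lemma dil_Lipschitz:
  obtains L where "L > 0" "\<And>n x y. \<bar>dil n i x - dil n i y\<bar> \<le> L * norm (x - y)"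
proof -
  obtain L where L: "L > 0" "\<And>x y. \<bar>dil0 i x - dil0 i y\<bar> \<le> L * norm (x - y)"
    using test_function_Lipschitz[OF dil0_test_function] by metis
  have "\<bar>dil n i x - dil n i y\<bar> \<le> L * norm (x - y)" for n x y
  proof -
    let ?a = "1 / real (Suc n)"
    have "\<bar>dil n i x - dil n i y\<bar> = \<bar>dil0 i (?a *\<^sub>R x) - dil0 i (?a *\<^sub>R y)\<bar> * real (Suc n)"
      unfolding dil_def left_diff_distrib[symmetric] abs_mult by simp
    also have "\<dots> \<le> L * norm (?a *\<^sub>R x - ?a *\<^sub>R y) * real (Suc n)"
      by (intro mult_right_mono L) simp
    also have "norm (?a *\<^sub>R x - ?a *\<^sub>R y) = ?a * norm (x - y)"
      unfolding scaleR_diff_right[symmetric] by simp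
    finally show ?thesis by (simp del: of_nat_Suc)
  qed
  then show ?thesis using that L(1) by metis
qed

text \<open>First derivatives of the truncated field tend boundedly to the Kronecker delta and
  second derivatives to 0 like 1/(n+1), so only the diagonal term remains.\<close>

lemma kinetic_limit:
  fixes u :: "real^'n::finite \<Rightarrow> real"
  assumes u: "H1_pair u g"
  shows "(\<lambda>n. \<Sum>j\<in>UNIV. (LBINT x. partial_deriv j (dil n i) x * g i x * g j x)
             + 1/2 * (LBINT x. partial_deriv j (partial_deriv i (dil n i)) x * u x * g j x))
    \<longlonglongrightarrow> (LBINT x. (g i x)\<^sup>2)"
proof -
  have sm: "smooth (partial_deriv j (dil0 i))" "smooth (partial_deriv k (partial_deriv j (dil0 i)))" for j k
    by (intro smooth_partial_deriv test_function_smooth dil0_test_function)+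
  have msr: "partial_deriv j (dil n i) \<in> borel_measurable lborel" "partial_deriv k (partial_deriv j (dil n i)) \<in> borel_measurable lborel" for j k n
    by (simp_all add: smooth_borel smooth_partial_deriv test_function_smooth[OF dil_test_function])
  have 1: "(\<lambda>n. LBINT x. partial_deriv j (dil n i) x * (g i x * g j x)) \<longlonglongrightarrow> (LBINT x. (if j = i then 1 else 0) * (g i x * g j x))" for j
  proof -
    obtain B where B: "\<And>x. \<bar>partial_deriv j (dil0 i) x\<bar> \<le> B"
      using test_function_bounded[OF test_function_partial_deriv[OF dil0_test_function]] by metis
    show ?thesis
    proof (rule integral_bounded_mult_tendsto[OF L2_integrable_mult[OF H1_pairD(2)[OF u] H1_pairD(2)[OF u]] msr(1)])
      show "\<bar>partial_deriv j (dil n i) x\<bar> \<le> B" for n x unfolding partial_deriv_dil by (rule B)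
      show "(\<lambda>n. partial_deriv j (dil n i) x) \<longlonglongrightarrow> (if j = i then 1 else 0)" for x
        unfolding partial_deriv_dil partial_deriv_dil0[symmetric] by (rule smooth_tendsto_at_0[OF sm(1)])
    qed simp
  qed
  have 2: "(\<lambda>n. LBINT x. partial_deriv j (partial_deriv i (dil n i)) x * (u x * g j x)) \<longlonglongrightarrow> (LBINT x. 0 * (u x * g j x))" for j
  proof -
    obtain B where B: "B > 0" "\<And>x. \<bar>partial_deriv j (partial_deriv i (dil0 i)) x\<bar> \<le> B"
      using test_function_bounded[OF test_function_partial_deriv[OF test_function_partial_deriv[OF dil0_test_function]]] by metis
    show ?thesis
    proof (rule integral_bounded_mult_tendsto[OF L2_integrable_mult[OF H1_pairD(1)[OF u] H1_pairD(2)[OF u]] msr(2)])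
      show "\<bar>partial_deriv j (partial_deriv i (dil n i)) x\<bar> \<le> 1 * B" for n x
        unfolding partial_deriv_dil2 abs_mult by (intro mult_mono B(2)) auto
      show "(\<lambda>n. partial_deriv j (partial_deriv i (dil n i)) x) \<longlonglongrightarrow> 0" for x
        using tendsto_mult[OF LIMSEQ_inverse_real_of_nat smooth_tendsto_at_0[OF sm(2)[of j i], of x]]
        unfolding partial_deriv_dil2 by (simp add: inverse_eq_divide)
    qed simp
  qed
  have "(\<lambda>n. \<Sum>j\<in>UNIV. (LBINT x. partial_deriv j (dil n i) x * (g i x * g j x))
             + 1/2 * (LBINT x. partial_deriv j (partial_deriv i (dil n i)) x * (u x * g j x)))
    \<longlonglongrightarrow> (\<Sum>j\<in>UNIV. (LBINT x. (if j = i then 1 else 0) * (g i x * g j x)) + 1/2 * (LBINT x. 0 * (u x * g j x)))"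
    by (intro tendsto_sum tendsto_add tendsto_mult_left 1 2)
  also have "(\<Sum>j\<in>UNIV. (LBINT x. (if j = i then 1 else 0) * (g i x * g j x)) + 1/2 * (LBINT x. 0 * (u x * g j x)))
    = (\<Sum>j\<in>UNIV. if j = i then LBINT x. (g i x)\<^sup>2 else 0)"
    by (intro sum.cong) (auto simp: power2_eq_square)
  finally show ?thesis by (simp add: mult.assoc)
qed

text \<open>In the limit the increments become x_i - y_i; summing their squares over i restores |x -
  y|^2 and lowers the singularity to that of \<open>D_gamma\<close>.\<close>

lemma Riesz_virial_limit:
  fixes w :: "real^'n::finite \<Rightarrow> real"
  assumes w: "Hardy_density C w" and \<gamma>: "0 < \<gamma>" "\<gamma> \<le> 2"
  shows "(\<lambda>n. \<Sum>i\<in>UNIV. \<integral>(x, y). norm (x - y) powr (- \<gamma> - 2) * ((dil n i x - dil n i y) * (x $ i - y $ i)) * w x * w y \<partial>pair_lborel)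
    \<longlonglongrightarrow> (\<integral>(x, y). norm (x - y) powr (- \<gamma>) * w x * w y \<partial>pair_lborel)"
proof -
  have wi: "integrable lborel w" and w0: "w x \<ge> 0" for x
    using w by (auto simp: Hardy_density_def)
  have [measurable]: "w \<in> borel_measurable borel" using borel_measurable_integrable[OF wi] by simp
  have [measurable]: "dil n i \<in> borel_measurable borel" for n and i :: 'n
    by (intro smooth_borel test_function_smooth dil_test_function)
  \<comment> \<open>Also true at z = 0, where both sides are 0.\<close>
  have kern: "norm z powr (- \<gamma> - 2) * (norm z)\<^sup>2 = norm z powr (- \<gamma>)" for z :: "real^'n"
  proof (cases "z = 0")
    case False
    then have "norm z powr (- \<gamma> - 2) * (norm z)\<^sup>2 = norm z powr (- \<gamma> - 2) * norm z powr 2" by simp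
    also have "\<dots> = norm z powr (- \<gamma>)" unfolding powr_add[symmetric] by simp
    finally show ?thesis .
  qed simp
  let ?T = "\<lambda>(d :: real^'n \<Rightarrow> real) i (x, y). norm (x - y) powr (- \<gamma> - 2) * ((d x - d y) * (x $ i - y $ i)) * w x * w y"
  let ?K = "\<lambda>(x, y). norm (x - y) powr (- \<gamma>) * w x * w y"
  have bound: "norm (?T d i z) \<le> L * ?K z" if L: "L > 0" "\<And>x y. \<bar>d x - d y\<bar> \<le> L * norm (x - y)" for L d i z
  proof -
    obtain x y where z: "z = (x, y)" by (cases z)
    have "\<bar>d x - d y\<bar> * \<bar>x $ i - y $ i\<bar> \<le> (L * norm (x - y)) * norm (x - y)"
      using component_le_norm_cart[of "x - y" i] L(1) by (intro mult_mono L) auto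
    then have "norm (x - y) powr (- \<gamma> - 2) * (\<bar>d x - d y\<bar> * \<bar>x $ i - y $ i\<bar>) \<le> norm (x - y) powr (- \<gamma> - 2) * (L * (norm (x - y))\<^sup>2)"
      by (intro mult_left_mono) (simp_all add: power2_eq_square mult.assoc)
    also have "\<dots> = L * norm (x - y) powr (- \<gamma>)" using kern[of "x - y"] by (simp add: mult_ac)
    finally have "norm (x - y) powr (- \<gamma> - 2) * (\<bar>d x - d y\<bar> * \<bar>x $ i - y $ i\<bar>) * (w x * w y) \<le> L * norm (x - y) powr (- \<gamma>) * (w x * w y)"
      using w0 by (intro mult_right_mono) auto
    then show ?thesis using w0 by (simp add: z abs_mult mult.assoc)
  qed
  have Ki: "integrable pair_lborel (\<lambda>z. L * ?K z)" for L
    by (intro integrable_mult_right Riesz_pair_integrable[OF w \<gamma>])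
  have 1: "(\<lambda>n. integral\<^sup>L pair_lborel (?T (dil n i) i)) \<longlonglongrightarrow> integral\<^sup>L pair_lborel (?T (\<lambda>x. x $ i) i)" for i
  proof -
    obtain L where L: "L > 0" "\<And>n x y. \<bar>dil n i x - dil n i y\<bar> \<le> L * norm (x - y)" using dil_Lipschitz by metis
    show ?thesis
    proof (rule integral_dominated_convergence[OF _ _ Ki[of L]])
      show "AE z in pair_lborel. (\<lambda>n. ?T (dil n i) i z) \<longlonglongrightarrow> ?T (\<lambda>x. x $ i) i z"
        by (intro AE_I2) (auto simp: case_prod_beta intro!: tendsto_mult tendsto_diff tendsto_const dil_tendsto)
      show "AE z in pair_lborel. norm (?T (dil n i) i z) \<le> L * ?K z" for n
        by (intro AE_I2 bound L)
    qed measurable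
  qed
  have Ti: "integrable pair_lborel (?T (\<lambda>x. x $ i) i)" for i
  proof (rule Bochner_Integration.integrable_bound[OF Ki[of 1]])
    show "AE z in pair_lborel. norm (?T (\<lambda>x. x $ i) i z) \<le> norm (1 * ?K z)"
    proof (rule AE_I2)
      fix z
      have "norm (?T (\<lambda>x. x $ i) i z) \<le> 1 * ?K z"
        by (rule bound) (use component_le_norm_cart[of "_ - _" i] in auto)
      then show "norm (?T (\<lambda>x. x $ i) i z) \<le> norm (1 * ?K z)" unfolding real_norm_def by linarith
    qed
  qed measurable
  have "(\<lambda>n. \<Sum>i\<in>UNIV. integral\<^sup>L pair_lborel (?T (dil n i) i)) \<longlonglongrightarrow> (\<Sum>i\<in>UNIV. integral\<^sup>L pair_lborel (?T (\<lambda>x. x $ i) i))"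
    by (intro tendsto_sum 1)
  also have "(\<Sum>i\<in>UNIV. integral\<^sup>L pair_lborel (?T (\<lambda>x. x $ i) i)) = (\<integral>z. (\<Sum>i\<in>UNIV. ?T (\<lambda>x. x $ i) i z) \<partial>pair_lborel)"
    by (rule Bochner_Integration.integral_sum[OF Ti, symmetric])
  also have "(\<lambda>z. \<Sum>i\<in>UNIV. ?T (\<lambda>x. x $ i) i z) = ?K"
  proof
    fix z :: "(real^'n) \<times> (real^'n)"
    obtain x y where z: "z = (x, y)" by (cases z)
    have "(\<Sum>i\<in>UNIV. ?T (\<lambda>x. x $ i) i z) = norm (x - y) powr (- \<gamma> - 2) * (\<Sum>i\<in>UNIV. ((x - y) $ i)\<^sup>2) * w x * w y"
      by (simp add: z sum_distrib_left sum_distrib_right power2_eq_square)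
    also have "\<dots> = ?K z" unfolding norm_sq_vec[symmetric] kern z by simp
    finally show "(\<Sum>i\<in>UNIV. ?T (\<lambda>x. x $ i) i z) = ?K z" .
  qed
  finally show ?thesis .
qed

section \<open>Vector-valued Sobolev functions\<close>

lemma norm_sq_vec_components:
  "(norm (x :: 'v::euclidean_space ^ 'n::finite))\<^sup>2 = (\<Sum>i\<in>UNIV. \<Sum>b\<in>Basis. ((x $ i) \<bullet> b)\<^sup>2)"
proof -
  have e: "(norm v)\<^sup>2 = (\<Sum>b\<in>Basis. (v \<bullet> b)\<^sup>2)" for v :: 'v
    by (subst power2_norm_eq_inner, subst euclidean_inner) (simp add: power2_eq_square)
  have "(norm x)\<^sup>2 = (\<Sum>i\<in>UNIV. (norm (x $ i))\<^sup>2)"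
    by (simp add: norm_vec_def L2_set_def sum_nonneg)
  then show ?thesis by (simp only: e)
qed

lemma norm_sq_Basis: "(norm (v :: 'v::euclidean_space))\<^sup>2 = (\<Sum>b\<in>Basis. (v \<bullet> b)\<^sup>2)"
  by (subst power2_norm_eq_inner, subst euclidean_inner) (simp add: power2_eq_square)

lemma L2_inner: "u \<in> L2 \<Longrightarrow> (\<lambda>x. u x \<bullet> b) \<in> L2"
  by (rule L2_mono[where B = "norm b"])
     (auto simp: L2_borel mult.commute intro: Cauchy_Schwarz_ineq2[THEN order_trans] borel_measurable_inner)

lemma borel_measurable_vec_nth_comp:
  fixes G :: "real^'n::finite \<Rightarrow> 'v::euclidean_space ^ 'm::finite"
  assumes "G \<in> borel_measurable borel"
  shows "(\<lambda>x. G x $ i) \<in> borel_measurable borel"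
proof -
  have "(\<lambda>v :: 'v ^ 'm. v $ i) \<in> borel_measurable borel"
    by (intro borel_measurable_continuous_onI linear_continuous_on bounded_linear_vec_nth)
  then show ?thesis by (rule measurable_compose[OF assms])
qed

lemma L2_vec_nth: "(G :: real^'n::finite \<Rightarrow> 'v::euclidean_space ^ 'm::finite) \<in> L2 \<Longrightarrow> (\<lambda>x. G x $ i) \<in> L2"
  by (rule L2_mono[where B = 1])
     (auto intro: borel_measurable_vec_nth_comp L2_borel order_trans[OF Finite_Cartesian_Product.norm_nth_le])

lemma integrable_test_scaleR:
  fixes u :: "real^'n::finite \<Rightarrow> 'v::euclidean_space"
  assumes \<phi>: "test_function \<phi>" and u: "u \<in> L2"
  shows "integrable lborel (\<lambda>x. \<phi> x *\<^sub>R u x)"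
proof (rule Bochner_Integration.integrable_bound)
  have [measurable]: "\<phi> \<in> borel_measurable borel" "u \<in> borel_measurable borel"
    using \<phi> u by (auto intro: L2_borel smooth_borel test_function_smooth)
  show "(\<lambda>x. \<phi> x *\<^sub>R u x) \<in> borel_measurable lborel" by measurable
  have "(\<lambda>x. norm (u x)) \<in> L2" by (rule L2_mono[OF u, of _ 1]) auto
  then show "integrable lborel (\<lambda>x. \<phi> x * norm (u x))"
    by (rule L2_integrable_mult[OF test_function_L2[OF \<phi>]])
  show "AE x in lborel. norm (\<phi> x *\<^sub>R u x) \<le> norm (\<phi> x * norm (u x))" by simp
qed

definition components :: "(real^'n::finite \<Rightarrow> 'v::euclidean_space) \<Rightarrow> (real^'n \<Rightarrow> 'v ^ 'n) \<Rightarrow> bool" where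
  "components u G \<longleftrightarrow> u \<in> L2 \<and> G \<in> L2 \<and> (\<forall>b\<in>Basis. H1_pair (\<lambda>x. u x \<bullet> b) (\<lambda>i x. (G x $ i) \<bullet> b))"

text \<open>The vector identity is tested against the basis. Integrability is established first, so
  that inner products may be moved inside the Bochner integrals.\<close>

lemma components_iff:
  fixes u :: "real^'n::finite \<Rightarrow> 'v::euclidean_space"
  shows "components u G \<longleftrightarrow> u \<in> L2 \<and> G \<in> L2 \<and> has_weak_grad u G"
proof (cases "u \<in> L2 \<and> G \<in> L2")
  case True
  then have uL: "u \<in> L2" and GL: "\<And>i. (\<lambda>x. G x $ i) \<in> L2" by (auto intro: L2_vec_nth)
  have *: "((LBINT x. partial_deriv i \<phi> x *\<^sub>R u x) = - (LBINT x. \<phi> x *\<^sub>R (G x $ i)))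
    \<longleftrightarrow> (\<forall>b\<in>Basis. (LBINT x. partial_deriv i \<phi> x * (u x \<bullet> b)) = - (LBINT x. \<phi> x * ((G x $ i) \<bullet> b)))"
    if \<phi>: "test_function \<phi>" for \<phi> i
  proof -
    have "(LBINT x. partial_deriv i \<phi> x *\<^sub>R u x) \<bullet> b = (LBINT x. partial_deriv i \<phi> x * (u x \<bullet> b))" for b
      using integral_inner_left[OF integrable_test_scaleR[OF test_function_partial_deriv[OF \<phi>, of i] uL], of b] by simp
    moreover have "(- (LBINT x. \<phi> x *\<^sub>R (G x $ i))) \<bullet> b = - (LBINT x. \<phi> x * ((G x $ i) \<bullet> b))" for b
      using integral_inner_left[OF integrable_test_scaleR[OF \<phi> GL[of i]], of b] by simp
    ultimately show ?thesis by (subst euclidean_eq_iff) simp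
  qed
  have "has_weak_grad u G \<longleftrightarrow> (\<forall>b\<in>Basis. \<forall>i. weak_partial i (\<lambda>x. u x \<bullet> b) (\<lambda>x. (G x $ i) \<bullet> b))"
    unfolding has_weak_grad_def weak_partial_def using * by blast
  then show ?thesis using True uL GL by (auto simp: components_def H1_pair_def L2_inner)
qed (auto simp: components_def)

lemma components_weak_grad:
  assumes "u \<in> H1" shows "components u (weak_grad u)"
proof -
  from assms obtain G where "G \<in> L2 \<and> has_weak_grad u G" by (auto simp: H1_def)
  then have "weak_grad u \<in> L2 \<and> has_weak_grad u (weak_grad u)"
    unfolding weak_grad_def by (rule someI[where P = "\<lambda>G. G \<in> L2 \<and> has_weak_grad u G"])
  then show ?thesis using assms by (simp add: components_iff H1_def)
qed

lemma components_H1: "components u G \<Longrightarrow> u \<in> H1"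
  by (auto simp: components_iff H1_def)

lemma weak_partial_unique:
  fixes u :: "real^'n::finite \<Rightarrow> real"
  assumes "weak_partial i u g" "weak_partial i u g'" "g \<in> L2" "g' \<in> L2"
  shows "AE x in lborel. g x = g' x"
proof -
  have "AE x in lborel. g x - g' x = 0"
  proof (rule fundamental_lemma_calculus_of_variations)
    show "(\<lambda>x. g x - g' x) \<in> L2" using assms by (intro L2_diff)
    fix \<phi> :: "real^'n \<Rightarrow> real" assume \<phi>: "test_function \<phi>"
    have "(LBINT x. \<phi> x * g x) = (LBINT x. \<phi> x * g' x)"
      using assms \<phi> unfolding weak_partial_def by (metis neg_equal_iff_equal)
    then show "(LBINT x. \<phi> x * (g x - g' x)) = 0"
      using L2_integrable_mult[OF test_function_L2[OF \<phi>]] assms by (simp add: right_diff_distrib)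
  qed
  then show ?thesis by simp
qed

text \<open>Weak gradients are unique almost everywhere, component by component. Thus the kinetic
  energy may be computed from any explicit gradient in place of the chosen one.\<close>

lemma integral_weak_grad:
  assumes "components u G"
  shows "(LBINT x. (norm (weak_grad u x))\<^sup>2) = (LBINT x. (norm (G x))\<^sup>2)"
proof -
  let ?G = "weak_grad u"
  have c: "components u ?G" using components_weak_grad components_H1 assms by blast
  have "AE x in lborel. (?G x $ i) \<bullet> b = (G x $ i) \<bullet> b" if "b \<in> Basis" for i b
    using assms c that by (intro weak_partial_unique[of i "\<lambda>x. u x \<bullet> b"]) (auto simp: components_def H1_pair_def)
  then have "AE x in lborel. \<forall>b\<in>Basis. (?G x $ i) \<bullet> b = (G x $ i) \<bullet> b" for i
    by (rule AE_finite_allI[OF finite_Basis])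
  then have "AE x in lborel. \<forall>i\<in>UNIV. \<forall>b\<in>Basis. (?G x $ i) \<bullet> b = (G x $ i) \<bullet> b"
    by (rule AE_finite_allI[OF finite])
  then have "AE x in lborel. ?G x = G x"
    by eventually_elim (simp add: vec_eq_iff euclidean_eq_iff[where 'a = 'b])
  then have ae: "AE x in lborel. (norm (?G x))\<^sup>2 = (norm (G x))\<^sup>2" by eventually_elim simp
  have m: "?G \<in> borel_measurable borel" "G \<in> borel_measurable borel"
    using assms c by (auto simp: components_def intro: L2_borel)
  show ?thesis by (rule integral_cong_AE[OF _ _ ae]) (use m in auto)
qed

lemma integral_norm_sq_components:
  assumes "components u G"
  shows "(LBINT x. (norm (G x))\<^sup>2) = (\<Sum>b\<in>Basis. \<Sum>i\<in>UNIV. LBINT x. ((G x $ i) \<bullet> b)\<^sup>2)"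
    "(LBINT x. (norm (u x))\<^sup>2) = (\<Sum>b\<in>Basis. LBINT x. (u x \<bullet> b)\<^sup>2)"
proof -
  have i: "integrable lborel (\<lambda>x. ((G x $ i) \<bullet> b)\<^sup>2)" "integrable lborel (\<lambda>x. (u x \<bullet> b)\<^sup>2)" if "b \<in> Basis" for i b
    using assms that by (auto simp: components_def H1_pair_def intro: L2_integrable_sq)
  show "(LBINT x. (norm (G x))\<^sup>2) = (\<Sum>b\<in>Basis. \<Sum>i\<in>UNIV. LBINT x. ((G x $ i) \<bullet> b)\<^sup>2)"
    unfolding norm_sq_vec_components
    by (subst sum.swap, subst Bochner_Integration.integral_sum)
       (auto intro!: sum.cong Bochner_Integration.integral_sum Bochner_Integration.integrable_sum i)
  show "(LBINT x. (norm (u x))\<^sup>2) = (\<Sum>b\<in>Basis. LBINT x. (u x \<bullet> b)\<^sup>2)"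
    unfolding norm_sq_Basis by (rule Bochner_Integration.integral_sum[OF i(2)])
qed

text \<open>Hardy's inequality is quadratic and adds up over the real components, with the same
  constant 4.\<close>

lemma Hardy_density_H1:
  fixes u :: "real^'n::finite \<Rightarrow> 'v::euclidean_space"
  assumes c: "components u G" and N: "CARD('n) \<ge> 3"
  shows "Hardy_density (4 * (LBINT x. (norm (G x))\<^sup>2)) (\<lambda>x. (norm (u x))\<^sup>2)"
  unfolding Hardy_density_def
proof (intro conjI allI)
  show "0 \<le> 4 * (LBINT x. (norm (G x))\<^sup>2)" by simp
  show "integrable lborel (\<lambda>x. (norm (u x))\<^sup>2)" using c by (auto simp: components_def L2_integrable_norm_sq)
  fix x
  have [measurable]: "u \<in> borel_measurable borel" using c by (auto simp: components_def L2_borel)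
  have "(\<integral>\<^sup>+y. ennreal ((norm (u y))\<^sup>2 / (norm (x - y))\<^sup>2) \<partial>lborel)
     = (\<integral>\<^sup>+y. (\<Sum>b\<in>Basis. ennreal ((u y \<bullet> b)\<^sup>2 / (norm (x - y))\<^sup>2)) \<partial>lborel)"
    by (intro nn_integral_cong) (simp add: norm_sq_Basis[of "u _"] sum_divide_distrib)
  also have "\<dots> = (\<Sum>b\<in>Basis. \<integral>\<^sup>+y. ennreal ((u y \<bullet> b)\<^sup>2 / (norm (x - y))\<^sup>2) \<partial>lborel)"
    by (rule nn_integral_sum) measurable
  also have "\<dots> \<le> (\<Sum>b\<in>Basis. ennreal (4 * (\<Sum>i\<in>UNIV. LBINT x. ((G x $ i) \<bullet> b)\<^sup>2)))"
    using c by (intro sum_mono Hardy N) (auto simp: components_def)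
  also have "\<dots> = ennreal (\<Sum>b\<in>Basis. 4 * (\<Sum>i\<in>UNIV. LBINT x. ((G x $ i) \<bullet> b)\<^sup>2))"
    by (intro sum_ennreal) (auto intro!: sum_nonneg)
  also have "(\<Sum>b\<in>Basis. 4 * (\<Sum>i\<in>UNIV. LBINT x. ((G x $ i) \<bullet> b)\<^sup>2)) = 4 * (LBINT x. (norm (G x))\<^sup>2)"
    unfolding integral_norm_sq_components(1)[OF c] by (simp add: sum_distrib_left)
  finally show "(\<integral>\<^sup>+y. ennreal ((norm (u y))\<^sup>2 / (norm (x - y))\<^sup>2) \<partial>lborel) \<le> ennreal (4 * (LBINT x. (norm (G x))\<^sup>2))" .
qed simp

lemma D_gamma_Riesz:
  fixes u :: "real^'n::finite \<Rightarrow> 'v::euclidean_space"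
  assumes w: "Hardy_density C (\<lambda>x. (norm (u x))\<^sup>2)" and \<gamma>: "0 < \<gamma>" "\<gamma> \<le> 2"
  shows "D_gamma \<gamma> u = (\<integral>(x, y). norm (x - y) powr (- \<gamma>) * (norm (u x))\<^sup>2 * (norm (u y))\<^sup>2 \<partial>pair_lborel)"
    "D_gamma \<gamma> u = (LBINT x. (norm (u x))\<^sup>2 * Riesz_pot \<gamma> (\<lambda>x. (norm (u x))\<^sup>2) x)"
    "integrable lborel (\<lambda>x. (norm (u x))\<^sup>2 * Riesz_pot \<gamma> (\<lambda>x. (norm (u x))\<^sup>2) x)"
proof -
  let ?F = "\<lambda>x y. norm (x - y) powr (- \<gamma>) * (norm (u x))\<^sup>2 * (norm (u y))\<^sup>2"
  have i: "integrable pair_lborel (case_prod ?F)" by (rule Riesz_pair_integrable[OF w \<gamma>])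
  have e: "(norm (u x))\<^sup>2 * (norm (u y))\<^sup>2 / norm (x - y) powr \<gamma> = ?F x y" for x y
    by (simp add: powr_minus_divide)
  have r: "(LBINT y. ?F x y) = (norm (u x))\<^sup>2 * Riesz_pot \<gamma> (\<lambda>x. (norm (u x))\<^sup>2) x" for x
  proof -
    have "(LBINT y. ?F x y) = (LBINT y. (norm (u x))\<^sup>2 * (norm (x - y) powr (- \<gamma>) * (norm (u y))\<^sup>2))"
      by (intro Bochner_Integration.integral_cong) auto
    then show ?thesis unfolding Riesz_pot_def by simp
  qed
  show "D_gamma \<gamma> u = (\<integral>(x, y). ?F x y \<partial>pair_lborel)"
    unfolding D_gamma_def e by (rule lborel_pair.integral_fst[OF i])
  show "D_gamma \<gamma> u = (LBINT x. (norm (u x))\<^sup>2 * Riesz_pot \<gamma> (\<lambda>x. (norm (u x))\<^sup>2) x)"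
    unfolding D_gamma_def e r ..
  show "integrable lborel (\<lambda>x. (norm (u x))\<^sup>2 * Riesz_pot \<gamma> (\<lambda>x. (norm (u x))\<^sup>2) x)"
    using lborel_pair.integrable_fst[OF i] unfolding r .
qed

text \<open>For exponent 2 the kernel is the Hardy weight itself, so the mass term in
  \<open>Riesz_pot_bounds\<close> disappears. The resulting \<open>D_gamma_2_le\<close> is invariant
  under dilations.\<close>

lemma Riesz_pot_2_le:
  fixes w :: "real^'n::finite \<Rightarrow> real"
  assumes w: "Hardy_density C w" shows "Riesz_pot 2 w x \<le> C"
proof -
  have w0: "w x \<ge> 0" and C: "C \<ge> 0" for x using w by (auto simp: Hardy_density_def)
  have "ennreal (Riesz_pot 2 w x) = (\<integral>\<^sup>+y. ennreal (norm (x - y) powr (- 2) * w y) \<partial>lborel)"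
    unfolding Riesz_pot_def using w0 by (intro nn_integral_eq_integral[symmetric] Riesz_integrable[OF w]) auto
  also have "\<dots> = (\<integral>\<^sup>+y. ennreal (w y / (norm (x - y))\<^sup>2) \<partial>lborel)"
    by (intro nn_integral_cong) (simp add: powr_minus_divide)
  also have "\<dots> \<le> ennreal C" using w by (simp add: Hardy_density_def)
  finally show ?thesis using C by (simp add: ennreal_le_iff)
qed

lemma D_gamma_2_le:
  fixes u :: "real^'n::finite \<Rightarrow> 'v::euclidean_space"
  assumes w: "Hardy_density C (\<lambda>x. (norm (u x))\<^sup>2)"
  shows "D_gamma 2 u \<le> C * (LBINT x. (norm (u x))\<^sup>2)"
proof -
  have wi: "integrable lborel (\<lambda>x. (norm (u x))\<^sup>2)" using w by (simp add: Hardy_density_def)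
  have "D_gamma 2 u \<le> (LBINT x. C * (norm (u x))\<^sup>2)"
    unfolding D_gamma_Riesz(2)[OF w zero_less_numeral order_refl]
    using wi Riesz_pot_2_le[OF w]
    by (intro integral_mono D_gamma_Riesz(3)[OF w]) (auto simp: mult.commute[of C] intro!: mult_left_mono)
  then show ?thesis by simp
qed

text \<open>The kernel is positive off the single point y = x, so a zero of the potential at any one
  x would already force u to vanish almost everywhere.\<close>

lemma D_gamma_pos:
  fixes u :: "real^'n::finite \<Rightarrow> 'v::euclidean_space"
  assumes w: "Hardy_density C (\<lambda>x. (norm (u x))\<^sup>2)" and \<gamma>: "0 < \<gamma>" "\<gamma> \<le> 2"
    and pos: "(LBINT x. (norm (u x))\<^sup>2) > 0"
  shows "D_gamma \<gamma> u > 0"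
proof -
  let ?w = "\<lambda>x. (norm (u x))\<^sup>2" and ?V = "Riesz_pot \<gamma> (\<lambda>x. (norm (u x))\<^sup>2)"
  have wi: "integrable lborel ?w" using w by (simp add: Hardy_density_def)
  have nae: "\<not> (AE x in lborel. ?w x = 0)"
    using pos integral_nonneg_eq_0_iff_AE[OF wi] by simp
  have V: "?V x \<noteq> 0" for x
  proof
    assume "?V x = 0"
    then have "AE y in lborel. norm (x - y) powr (- \<gamma>) * ?w y = 0"
      unfolding Riesz_pot_def
      by (subst (asm) integral_nonneg_eq_0_iff_AE[OF Riesz_integrable[OF w \<gamma>]]) auto
    with AE_lborel_neq[of x] have "AE y in lborel. ?w y = 0" by eventually_elim auto
    then show False using nae by simp
  qed
  have "D_gamma \<gamma> u \<noteq> 0"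
  proof
    assume "D_gamma \<gamma> u = 0"
    then have "AE x in lborel. ?w x * ?V x = 0"
      unfolding D_gamma_Riesz(2)[OF w \<gamma>]
      using Riesz_pot_bounds(1)[OF w \<gamma>]
      by (subst (asm) integral_nonneg_eq_0_iff_AE[OF D_gamma_Riesz(3)[OF w \<gamma>]]) auto
    then have "AE x in lborel. ?w x = 0" by eventually_elim (use V in auto)
    then show False using nae by simp
  qed
  moreover have "D_gamma \<gamma> u \<ge> 0"
    unfolding D_gamma_Riesz(2)[OF w \<gamma>] using Riesz_pot_bounds(1)[OF w \<gamma>]
    by (intro Bochner_Integration.integral_nonneg mult_nonneg_nonneg) auto
  ultimately show ?thesis by linarith
qed

section \<open>The Pohozaev identity\<close>

text \<open>Pairing with b yields a real linear equation for one component: all components share the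
  bounded potentials, and the multiplier joins them in the coefficient of the right side.\<close>

lemma weak_solution_component:
  fixes u :: "real^'n::finite \<Rightarrow> 'v::euclidean_space"
  assumes sol: "weak_solution \<gamma>1 \<gamma>2 \<mu> u" and c: "components u (weak_grad u)"
    and w: "Hardy_density C (\<lambda>x. (norm (u x))\<^sup>2)"
    and \<gamma>: "0 < \<gamma>1" "\<gamma>1 \<le> 2" "0 < \<gamma>2" "\<gamma>2 \<le> 2"
    and \<phi>: "test_function \<phi>"
  shows "(\<Sum>j\<in>UNIV. LBINT x. partial_deriv j \<phi> x * ((weak_grad u x $ j) \<bullet> b))
    = (LBINT x. \<phi> x * ((Riesz_pot \<gamma>1 (\<lambda>x. (norm (u x))\<^sup>2) x - Riesz_pot \<gamma>2 (\<lambda>x. (norm (u x))\<^sup>2) x - \<mu>) * (u x \<bullet> b)))"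
proof -
  let ?G = "weak_grad u" and ?V = "\<lambda>\<gamma>. Riesz_pot \<gamma> (\<lambda>x. (norm (u x))\<^sup>2)"
  have uL: "u \<in> L2" and GL: "?G \<in> L2" using c by (auto simp: components_def)
  have [measurable]: "u \<in> borel_measurable borel" using uL L2_borel by blast
  have h: "hartree_potential \<gamma> u = ?V \<gamma>" for \<gamma> by (simp add: fun_eq_iff hartree_potential_def Riesz_pot_def)
  have VL: "(\<lambda>x. ?V \<gamma> x *\<^sub>R u x) \<in> L2" if "0 < \<gamma>" "\<gamma> \<le> 2" for \<gamma>
  proof (rule L2_mono[OF uL])
    note V = Riesz_pot_bounds[OF w that]
    show "(\<lambda>x. ?V \<gamma> x *\<^sub>R u x) \<in> borel_measurable borel" using V(3) by measurable
    show "norm (?V \<gamma> x *\<^sub>R u x) \<le> (C + (LBINT y. (norm (u y))\<^sup>2)) * norm (u x)" for x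
      using V(1,2)[of x] by (simp add: mult_right_mono)
  qed
  have e: "(LBINT x. (\<Sum>i\<in>UNIV. partial_deriv i \<phi> x *\<^sub>R (?G x $ i))) + \<mu> *\<^sub>R (LBINT x. \<phi> x *\<^sub>R u x)
        = (LBINT x. \<phi> x *\<^sub>R (?V \<gamma>1 x *\<^sub>R u x)) - (LBINT x. \<phi> x *\<^sub>R (?V \<gamma>2 x *\<^sub>R u x))"
    using sol \<phi> unfolding weak_solution_def h by blast
  have i0: "integrable lborel (\<lambda>x. partial_deriv i \<phi> x *\<^sub>R (?G x $ i))" for i
    by (intro integrable_test_scaleR test_function_partial_deriv \<phi> L2_vec_nth GL)
  have i1: "integrable lborel (\<lambda>x. \<phi> x *\<^sub>R u x)" by (intro integrable_test_scaleR \<phi> uL)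
  have i2: "integrable lborel (\<lambda>x. \<phi> x *\<^sub>R (?V \<gamma>1 x *\<^sub>R u x))" "integrable lborel (\<lambda>x. \<phi> x *\<^sub>R (?V \<gamma>2 x *\<^sub>R u x))"
    by (intro integrable_test_scaleR \<phi> VL \<gamma>)+
  have inn: "(LBINT x. f x) \<bullet> b = (LBINT x. f x \<bullet> b)" if "integrable lborel f" for f :: "real^'n \<Rightarrow> 'v"
    using that by simp
  have r: "integrable lborel (\<lambda>x. \<phi> x * (u x \<bullet> b))" "integrable lborel (\<lambda>x. \<phi> x * (?V \<gamma>1 x * (u x \<bullet> b)))"
     "integrable lborel (\<lambda>x. \<phi> x * (?V \<gamma>2 x * (u x \<bullet> b)))"
    using integrable_inner_left[OF i1, of b] integrable_inner_left[OF i2(1), of b] integrable_inner_left[OF i2(2), of b]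
    by (simp_all add: mult.assoc)
  have "(\<Sum>j\<in>UNIV. LBINT x. partial_deriv j \<phi> x * ((?G x $ j) \<bullet> b))
     = (LBINT x. (\<Sum>i\<in>UNIV. partial_deriv i \<phi> x *\<^sub>R (?G x $ i))) \<bullet> b"
    using inn[OF i0] by (simp add: Bochner_Integration.integral_sum[OF i0] inner_sum_left)
  also have "\<dots> = (LBINT x. \<phi> x * (?V \<gamma>1 x * (u x \<bullet> b))) - (LBINT x. \<phi> x * (?V \<gamma>2 x * (u x \<bullet> b)))
     - \<mu> * (LBINT x. \<phi> x * (u x \<bullet> b))"
    using arg_cong[OF e, of "\<lambda>v. v \<bullet> b"] inn[OF i1] inn[OF i2(1)] inn[OF i2(2)]
    by (simp add: inner_add_left inner_diff_left mult.assoc)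
  also have "\<dots> = (LBINT x. \<phi> x * (?V \<gamma>1 x * (u x \<bullet> b)) - \<phi> x * (?V \<gamma>2 x * (u x \<bullet> b)) - \<mu> * (\<phi> x * (u x \<bullet> b)))"
    using r by simp
  also have "\<dots> = (LBINT x. \<phi> x * ((?V \<gamma>1 x - ?V \<gamma>2 x - \<mu>) * (u x \<bullet> b)))"
    by (intro Bochner_Integration.integral_cong) (auto simp: algebra_simps)
  finally show ?thesis .
qed

text \<open>The local virial identities of the components are added before the nonlinearity is
  treated: only the sum over the basis produces the derivative of |u|^2 that
  \<open>Riesz_virial\<close> requires.\<close>

theorem Pohozaev_identity:
  fixes u :: "real^'n::finite \<Rightarrow> 'v::euclidean_space"
  assumes sol: "weak_solution \<gamma>1 \<gamma>2 \<mu> u" and N: "CARD('n) \<ge> 3"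
    and \<gamma>: "0 < \<gamma>1" "\<gamma>1 \<le> 2" "0 < \<gamma>2" "\<gamma>2 \<le> 2"
  shows "(LBINT x. (norm (weak_grad u x))\<^sup>2) = \<gamma>1 / 4 * D_gamma \<gamma>1 u - \<gamma>2 / 4 * D_gamma \<gamma>2 u"
proof -
  let ?G = "weak_grad u" and ?w = "\<lambda>x. (norm (u x))\<^sup>2"
  let ?V = "\<lambda>\<gamma>. Riesz_pot \<gamma> ?w"
  have c: "components u ?G" using sol by (simp add: weak_solution_def components_weak_grad)
  define C where "C = 4 * (LBINT x. (norm (?G x))\<^sup>2)"
  have w: "Hardy_density C ?w" unfolding C_def by (rule Hardy_density_H1[OF c N])
  have wi: "integrable lborel ?w" using w by (simp add: Hardy_density_def)
  note V1 = Riesz_pot_bounds[OF w \<gamma>(1,2)] and V2 = Riesz_pot_bounds[OF w \<gamma>(3,4)]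
  define v where "v b x = u x \<bullet> b" for b x
  define g where "g b i x = (?G x $ i) \<bullet> b" for b i x
  define V where "V x = ?V \<gamma>1 x - ?V \<gamma>2 x - \<mu>" for x
  have Vm [measurable]: "V \<in> borel_measurable borel" unfolding V_def[abs_def] using V1(3) V2(3) by measurable
  define B where "B = 2 * (C + (LBINT x. ?w x)) + \<bar>\<mu>\<bar>"
  have VB: "\<bar>V x\<bar> \<le> B" for x
    using V1(1,2)[of x] V2(1,2)[of x] unfolding V_def B_def by (smt (verit))
  have P: "H1_pair (v b) (g b)" if "b \<in> Basis" for b
    using c that by (simp add: components_def v_def[abs_def] g_def[abs_def])
  define f where "f b x = V x * v b x" for b x
  have fL: "f b \<in> L2" if "b \<in> Basis" for b
    unfolding f_def[abs_def] by (intro L2_bounded_mult[OF H1_pairD(1)[OF P[OF that]] Vm VB])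
  have eq: "(\<Sum>j\<in>UNIV. LBINT x. partial_deriv j \<phi> x * g b j x) = (LBINT x. \<phi> x * f b x)" if "test_function \<phi>" for \<phi> b
    unfolding g_def f_def V_def v_def by (rule weak_solution_component[OF sol c w \<gamma> that])
  \<comment> \<open>Half of the weak derivative of |u|^2 in direction i, as \<open>prod\<close>
    confirms.\<close>
  define p where "p i x = (\<Sum>b\<in>Basis. v b x * g b i x)" for i x
  have vg: "integrable lborel (\<lambda>x. v b x * g b i x)" if "b \<in> Basis" for b i
    using P[OF that] by (intro L2_integrable_mult H1_pairD)
  have pi: "integrable lborel (p i)" for i
    unfolding p_def[abs_def] by (intro Bochner_Integration.integrable_sum vg)
  have wv: "?w x = (\<Sum>b\<in>Basis. (v b x)\<^sup>2)" for x unfolding v_def by (rule norm_sq_Basis)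
  have prod: "(LBINT x. partial_deriv i \<phi> x * ?w x) = - 2 * (LBINT x. \<phi> x * p i x)" if \<phi>: "test_function \<phi>" for \<phi> i
  proof -
    obtain B1 where B1: "\<And>x. \<bar>\<phi> x\<bar> \<le> B1" using test_function_bounded[OF \<phi>] by metis
    obtain B2 where B2: "\<And>x. \<bar>partial_deriv i \<phi> x\<bar> \<le> B2" using test_function_bounded[OF test_function_partial_deriv[OF \<phi>]] by metis
    have m: "\<phi> \<in> borel_measurable borel" "partial_deriv i \<phi> \<in> borel_measurable borel"
      by (intro smooth_borel smooth_partial_deriv test_function_smooth \<phi>)+
    have i1: "integrable lborel (\<lambda>x. partial_deriv i \<phi> x * (v b x)\<^sup>2)" if "b \<in> Basis" for b
      using integrable_mult_bounded[OF L2_integrable_sq[OF H1_pairD(1)[OF P[OF that]]] _ B2] m by simp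
    have i2: "integrable lborel (\<lambda>x. \<phi> x * (v b x * g b i x))" if "b \<in> Basis" for b
      using integrable_mult_bounded[OF vg[OF that] _ B1] m by simp
    have "(LBINT x. partial_deriv i \<phi> x * ?w x) = (\<Sum>b\<in>Basis. LBINT x. partial_deriv i \<phi> x * (v b x)\<^sup>2)"
      unfolding wv sum_distrib_left by (rule Bochner_Integration.integral_sum[OF i1])
    also have "\<dots> = (\<Sum>b\<in>Basis. - 2 * (LBINT x. \<phi> x * (v b x * g b i x)))"
      by (intro sum.cong refl) (simp only: product_rule_test[OF P \<phi>] mult.assoc)
    also have "\<dots> = - 2 * (LBINT x. \<phi> x * p i x)"
      unfolding p_def sum_distrib_left[of "\<phi> _"] by (subst Bochner_Integration.integral_sum[OF i2]) (simp_all only: sum_distrib_left)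
    finally show ?thesis .
  qed
  let ?I = "\<lambda>\<gamma> X i. \<integral>(x, y). norm (x - y) powr (- \<gamma> - 2) * ((X x - X y) * (x $ i - y $ i)) * ?w x * ?w y \<partial>pair_lborel"
  let ?k = "\<lambda>X b i. \<Sum>j\<in>UNIV. (LBINT x. partial_deriv j X x * g b i x * g b j x)
             + 1/2 * (LBINT x. partial_deriv j (partial_deriv i X) x * v b x * g b j x)"
  have loc: "(\<Sum>b\<in>Basis. ?k X b i) = \<gamma>1 / 4 * ?I \<gamma>1 X i - \<gamma>2 / 4 * ?I \<gamma>2 X i" if X: "test_function X" for X i
  proof -
    let ?dX = "partial_deriv i X"
    obtain B1 where B1: "\<And>x. \<bar>X x\<bar> \<le> B1" using test_function_bounded[OF X] by metis
    obtain B2 where B2: "\<And>x. \<bar>?dX x\<bar> \<le> B2" using test_function_bounded[OF test_function_partial_deriv[OF X]] by metis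
    have m: "X \<in> borel_measurable borel" "?dX \<in> borel_measurable borel"
      by (intro smooth_borel smooth_partial_deriv test_function_smooth X)+
    define q where "q x = X x * p i x + 1/2 * (?dX x * ?w x)" for x
    have q1: "integrable lborel (\<lambda>x. X x * p i x)" using integrable_mult_bounded[OF pi _ B1] m by simp
    have q2: "integrable lborel (\<lambda>x. ?dX x * ?w x)" using integrable_mult_bounded[OF wi _ B2] m by simp
    have qi: "integrable lborel q" unfolding q_def[abs_def]
      by (intro Bochner_Integration.integrable_add integrable_mult_right q1 q2)
    \<comment> \<open>By \<open>prod\<close> with \<phi> = X; here the constant \<mu> drops out of
      the coefficient \<open>V\<close>.\<close>
    have q0: "(LBINT x. q x) = 0"
      unfolding q_def using q1 q2 prod[OF X, of i] by simp
    have f1: "integrable lborel (\<lambda>x. X x * f b x * g b i x)" "integrable lborel (\<lambda>x. ?dX x * f b x * v b x)" if "b \<in> Basis" for b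
      using L2_integrable_mult3[OF fL[OF that] H1_pairD(2)[OF P[OF that]] m(1) B1]
        L2_integrable_mult3[OF fL[OF that] H1_pairD(1)[OF P[OF that]] m(2) B2] by auto
    have "(\<Sum>b\<in>Basis. ?k X b i) = (\<Sum>b\<in>Basis. (LBINT x. X x * f b x * g b i x) + 1/2 * (LBINT x. ?dX x * f b x * v b x))"
      by (intro sum.cong refl local_virial_identity P fL eq X)
    also have "\<dots> = (\<Sum>b\<in>Basis. LBINT x. X x * f b x * g b i x + 1/2 * (?dX x * f b x * v b x))"
      by (intro sum.cong refl) (simp add: f1)
    also have "\<dots> = (LBINT x. (\<Sum>b\<in>Basis. X x * f b x * g b i x + 1/2 * (?dX x * f b x * v b x)))"
      by (intro Bochner_Integration.integral_sum[symmetric] Bochner_Integration.integrable_add integrable_mult_right f1)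
    also have "\<dots> = (LBINT x. V x * q x)"
    proof (intro Bochner_Integration.integral_cong refl)
      fix x
      have "(\<Sum>b\<in>Basis. X x * f b x * g b i x + 1/2 * (?dX x * f b x * v b x))
        = (\<Sum>b\<in>Basis. (V x * X x) * (v b x * g b i x) + (V x * 1/2 * ?dX x) * (v b x)\<^sup>2)"
        by (intro sum.cong refl) (simp add: f_def power2_eq_square)
      also have "\<dots> = (V x * X x) * p i x + (V x * 1/2 * ?dX x) * ?w x"
        unfolding wv p_def by (simp only: sum.distrib sum_distrib_left)
      finally show "(\<Sum>b\<in>Basis. X x * f b x * g b i x + 1/2 * (?dX x * f b x * v b x)) = V x * q x"
        unfolding q_def by (simp add: distrib_left)
    qed
    also have "\<dots> = (LBINT x. ?V \<gamma>1 x * q x - ?V \<gamma>2 x * q x - \<mu> * q x)"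
      by (intro Bochner_Integration.integral_cong refl) (simp add: V_def left_diff_distrib)
    also have "\<dots> = (LBINT x. ?V \<gamma>1 x * q x) - (LBINT x. ?V \<gamma>2 x * q x) - \<mu> * (LBINT x. q x)"
    proof -
      have "\<bar>?V \<gamma>1 x\<bar> \<le> C + (LBINT x. ?w x)" "\<bar>?V \<gamma>2 x\<bar> \<le> C + (LBINT x. ?w x)" for x
        using V1(1,2)[of x] V2(1,2)[of x] by linarith+
      from integrable_mult_bounded[OF qi _ this(1)] integrable_mult_bounded[OF qi _ this(2)]
      have "integrable lborel (\<lambda>x. ?V \<gamma>1 x * q x)" "integrable lborel (\<lambda>x. ?V \<gamma>2 x * q x)"
        using V1(3) V2(3) by simp_all
      then show ?thesis using qi by simp
    qed
    also have "\<dots> = \<gamma>1 / 4 * ?I \<gamma>1 X i - \<gamma>2 / 4 * ?I \<gamma>2 X i"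
    proof -
      have "(LBINT x. ?V \<gamma>1 x * q x) = \<gamma>1 / 4 * ?I \<gamma>1 X i"
        unfolding q_def by (rule Riesz_virial[OF w \<gamma>(1,2) pi prod X])
      moreover have "(LBINT x. ?V \<gamma>2 x * q x) = \<gamma>2 / 4 * ?I \<gamma>2 X i"
        unfolding q_def by (rule Riesz_virial[OF w \<gamma>(3,4) pi prod X])
      ultimately show ?thesis unfolding q0 by simp
    qed
    finally show ?thesis .
  qed
  \<comment> \<open>The truncated dilation field is inserted, its i-th component in the i-th
    identity, and the identities are summed over i.\<close>
  have "(\<lambda>n. \<Sum>i\<in>UNIV. \<Sum>b\<in>Basis. ?k (dil n i) b i) \<longlonglongrightarrow> (\<Sum>i\<in>UNIV. \<Sum>b\<in>Basis. LBINT x. (g b i x)\<^sup>2)"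
    by (intro tendsto_sum kinetic_limit P)
  also have "(\<Sum>i\<in>UNIV. \<Sum>b\<in>Basis. LBINT x. (g b i x)\<^sup>2) = (LBINT x. (norm (?G x))\<^sup>2)"
    unfolding integral_norm_sq_components(1)[OF c] g_def by (rule sum.swap)
  finally have lim1: "(\<lambda>n. \<Sum>i\<in>UNIV. \<Sum>b\<in>Basis. ?k (dil n i) b i) \<longlonglongrightarrow> (LBINT x. (norm (?G x))\<^sup>2)" .
  have "(\<lambda>n. \<gamma>1 / 4 * (\<Sum>i\<in>UNIV. ?I \<gamma>1 (dil n i) i) - \<gamma>2 / 4 * (\<Sum>i\<in>UNIV. ?I \<gamma>2 (dil n i) i))
     \<longlonglongrightarrow> \<gamma>1 / 4 * D_gamma \<gamma>1 u - \<gamma>2 / 4 * D_gamma \<gamma>2 u"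
    unfolding D_gamma_Riesz(1)[OF w \<gamma>(1,2)] D_gamma_Riesz(1)[OF w \<gamma>(3,4)]
    by (intro tendsto_diff tendsto_mult_left Riesz_virial_limit[OF w] \<gamma>)
  then have lim2: "(\<lambda>n. \<Sum>i\<in>UNIV. \<Sum>b\<in>Basis. ?k (dil n i) b i) \<longlonglongrightarrow> \<gamma>1 / 4 * D_gamma \<gamma>1 u - \<gamma>2 / 4 * D_gamma \<gamma>2 u"
    unfolding loc[OF dil_test_function] sum_subtractf sum_distrib_left .
  from lim1 lim2 show ?thesis by (rule LIMSEQ_unique)
qed

section \<open>Scaling and the critical mass\<close>

lemma components_scale:
  fixes u :: "real^'n::finite \<Rightarrow> 'v::euclidean_space"
  assumes c: "components u G" and t: "t > 0"
  shows "components (\<lambda>x. s *\<^sub>R u (t *\<^sub>R x)) (\<lambda>x. (s * t) *\<^sub>R G (t *\<^sub>R x))"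
proof -
  have L: "(\<lambda>x. r *\<^sub>R f (t *\<^sub>R x)) \<in> L2" if f: "f \<in> L2" for r and f :: "real^'n \<Rightarrow> 'w::euclidean_space"
  proof -
    have [measurable]: "f \<in> borel_measurable borel" using f L2_borel by blast
    have "integrable lborel (\<lambda>x. r\<^sup>2 * (norm (f (t *\<^sub>R x)))\<^sup>2)"
      using lborel_affine_integrable[OF L2_integrable_norm_sq[OF f], of t 0] t by simp
    then show ?thesis by (simp add: L2_def power_mult_distrib)
  qed
  have "H1_pair (\<lambda>x. (s *\<^sub>R u (t *\<^sub>R x)) \<bullet> b) (\<lambda>i x. (((s * t) *\<^sub>R G (t *\<^sub>R x)) $ i) \<bullet> b)" if "b \<in> Basis" for b
    using H1_pair_affine[of "\<lambda>x. u x \<bullet> b" "\<lambda>i x. (G x $ i) \<bullet> b" t s 0] c t that by (simp add: components_def)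
  then show ?thesis using c by (simp add: components_def L)
qed

text \<open>Two parameters are kept apart: k adjusts the mass to a prescribed value, and t dilates
  at fixed mass.\<close>

lemma scaling:
  fixes u :: "real^'n::finite \<Rightarrow> 'v::euclidean_space"
  assumes u: "u \<in> H1" and t: "t > 0" and k: "k > 0"
  obtains v :: "real^'n \<Rightarrow> 'v" where "v \<in> H1" "(LBINT x. (norm (v x))\<^sup>2) = k * (LBINT x. (norm (u x))\<^sup>2)"
    "(LBINT x. (norm (weak_grad v x))\<^sup>2) = k * t\<^sup>2 * (LBINT x. (norm (weak_grad u x))\<^sup>2)"
    "\<And>\<gamma>. D_gamma \<gamma> v = k\<^sup>2 * t powr \<gamma> * D_gamma \<gamma> u"
proof -
  let ?G = "weak_grad u"
  define d where "d = DIM(real^'n)"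
  \<comment> \<open>The amplitude absorbs the Jacobian t^(-N), N being the dimension, so that the
    mass is multiplied by k alone; in the double integral s^4 = k^2 t^(2N) absorbs two
    Jacobians.\<close>
  define s where "s = sqrt (k * t ^ d)"
  have s2: "s\<^sup>2 = k * t ^ d" using t k by (simp add: s_def)
  have td: "t ^ d > 0" using t by simp
  define v where "v x = s *\<^sub>R u (t *\<^sub>R x)" for x
  have cu: "components u ?G" using u by (rule components_weak_grad)
  have cv: "components v (\<lambda>x. (s * t) *\<^sub>R ?G (t *\<^sub>R x))" unfolding v_def[abs_def] by (rule components_scale[OF cu t])
  have [measurable]: "u \<in> borel_measurable borel" "?G \<in> borel_measurable borel" using cu by (auto simp: components_def L2_borel)
  have sc: "(LBINT x. f (t *\<^sub>R x)) = (LBINT x. f x) / t ^ d"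
    if "f \<in> borel_measurable borel" for f :: "real^'n \<Rightarrow> real"
    using lborel_affine_integral[OF that, of t 0] t td by (simp add: d_def)
  have 1: "(LBINT x. (norm (v x))\<^sup>2) = k * (LBINT x. (norm (u x))\<^sup>2)"
    unfolding v_def using sc[of "\<lambda>x. (norm (u x))\<^sup>2"] s2 t by (simp add: power_mult_distrib)
  have "(LBINT x. (norm (weak_grad v x))\<^sup>2) = (LBINT x. (s * t)\<^sup>2 * (norm (?G (t *\<^sub>R x)))\<^sup>2)"
    unfolding integral_weak_grad[OF cv] by (simp add: power_mult_distrib)
  also have "\<dots> = (s * t)\<^sup>2 * ((LBINT x. (norm (?G x))\<^sup>2) / t ^ d)"
    using sc[of "\<lambda>x. (norm (?G x))\<^sup>2"] by simp
  also have "\<dots> = k * t\<^sup>2 * (LBINT x. (norm (?G x))\<^sup>2)"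
    using td s2 by (simp add: power_mult_distrib)
  finally have 2: "(LBINT x. (norm (weak_grad v x))\<^sup>2) = k * t\<^sup>2 * (LBINT x. (norm (?G x))\<^sup>2)" .
  have 3: "D_gamma \<gamma> v = k\<^sup>2 * t powr \<gamma> * D_gamma \<gamma> u" for \<gamma>
  proof -
    let ?F = "\<lambda>x y. (norm (u x))\<^sup>2 * (norm (u y))\<^sup>2 / norm (x - y) powr \<gamma>"
    have pw: "(norm (v x))\<^sup>2 * (norm (v y))\<^sup>2 / norm (x - y) powr \<gamma> = (s ^ 4 * t powr \<gamma>) * ?F (t *\<^sub>R x) (t *\<^sub>R y)" for x y
    proof -
      have "norm (t *\<^sub>R x - t *\<^sub>R y) powr \<gamma> = t powr \<gamma> * norm (x - y) powr \<gamma>"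
        using t unfolding scaleR_diff_right[symmetric] by (simp add: powr_mult)
      moreover have "t powr \<gamma> \<noteq> 0" using t by simp
      ultimately show ?thesis unfolding v_def by (simp add: power_mult_distrib field_simps)
    qed
    have inner: "(LBINT y. (norm (v x))\<^sup>2 * (norm (v y))\<^sup>2 / norm (x - y) powr \<gamma>)
        = (s ^ 4 * t powr \<gamma> / t ^ d) * (LBINT y. ?F (t *\<^sub>R x) y)" for x
    proof -
      have m: "?F (t *\<^sub>R x) \<in> borel_measurable borel" by measurable
      show ?thesis unfolding pw integral_mult_right_zero sc[OF m] by simp
    qed
    have "(\<lambda>x. LBINT y. ?F x y) \<in> borel_measurable borel" by measurable
    from sc[OF this] have "D_gamma \<gamma> v = (s ^ 4 * t powr \<gamma> / t ^ d) * (D_gamma \<gamma> u / t ^ d)"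
      unfolding D_gamma_def inner by simp
    also have "s ^ 4 = (k * t ^ d)\<^sup>2" unfolding s2[symmetric] by simp
    finally show ?thesis using td by (simp add: power_mult_distrib power2_eq_square)
  qed
  show ?thesis by (rule that[OF components_H1[OF cv] 1 2]) (rule 3)
qed

lemma H1_nontrivial:
  obtains u :: "real^'n::finite \<Rightarrow> 'v::euclidean_space" where "u \<in> H1" "(LBINT x. (norm (u x))\<^sup>2) > 0"
proof -
  let ?f = "bump 1 :: real^'n \<Rightarrow> real"
  obtain b0 :: 'v where b0: "b0 \<in> Basis" using nonempty_Basis by blast
  then have n: "norm b0 = 1" by simp
  have tf: "test_function ?f" by (rule bump_test_function) simp
  note sm = test_function_smooth[OF tf]
  have td: "test_function (partial_deriv i ?f)" for i using tf test_function_partial_deriv by blast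
  define u where "u x = ?f x *\<^sub>R b0" for x
  define G where "G x = (\<chi> i. partial_deriv i ?f x *\<^sub>R b0)" for x
  have [measurable]: "?f \<in> borel_measurable borel" by (rule smooth_borel[OF sm])
  have nu: "(norm (u x))\<^sup>2 = (?f x)\<^sup>2" for x by (simp add: u_def n)
  have uL: "u \<in> L2"
  proof -
    have "u \<in> borel_measurable borel" unfolding u_def[abs_def] by measurable
    then show ?thesis using test_function_L2[OF tf] by (simp add: L2_def nu)
  qed
  have GL: "G \<in> L2"
  proof -
    have "continuous_on UNIV G" unfolding G_def[abs_def]
      by (intro continuous_on_vec_lambda continuous_on_scaleR continuous_on_const smooth_continuous test_function_smooth td)
    then have "G \<in> borel_measurable borel" by (rule borel_measurable_continuous_onI)
    moreover have "(norm (G x))\<^sup>2 = (\<Sum>i\<in>UNIV. (partial_deriv i ?f x)\<^sup>2)" for x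
      by (simp add: G_def norm_vec_def L2_set_def sum_nonneg n power2_abs)
    moreover have "integrable lborel (\<lambda>x. \<Sum>i\<in>UNIV. (partial_deriv i ?f x)\<^sup>2)"
      by (intro Bochner_Integration.integrable_sum L2_integrable_sq test_function_L2 td)
    ultimately show ?thesis by (simp add: L2_def)
  qed
  have "has_weak_grad u G"
    unfolding has_weak_grad_def
  proof (intro allI impI)
    fix \<phi> :: "real^'n \<Rightarrow> real" and i assume \<phi>: "test_function \<phi>"
    have "(LBINT x. partial_deriv i \<phi> x *\<^sub>R u x) = (LBINT x. partial_deriv i \<phi> x * ?f x) *\<^sub>R b0"
      unfolding u_def scaleR_scaleR
      by (intro integral_scaleR_left test_function_integrable test_function_mult_smooth test_function_partial_deriv \<phi> sm)
    also have "\<dots> = - ((LBINT x. \<phi> x * partial_deriv i ?f x) *\<^sub>R b0)"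
      unfolding integral_by_parts[OF \<phi> sm] by simp
    also have "(LBINT x. \<phi> x * partial_deriv i ?f x) *\<^sub>R b0 = (LBINT x. \<phi> x *\<^sub>R (G x $ i))"
      unfolding G_def vec_lambda_beta scaleR_scaleR
      by (intro integral_scaleR_left[symmetric] test_function_integrable test_function_mult_smooth \<phi> smooth_partial_deriv sm)
    finally show "(LBINT x. partial_deriv i \<phi> x *\<^sub>R u x) = - (LBINT x. \<phi> x *\<^sub>R (G x $ i))" .
  qed
  with uL GL have "components u G" by (simp add: components_iff)
  then have H: "u \<in> H1" by (rule components_H1)
  have "(LBINT x. (norm (u x))\<^sup>2) \<noteq> 0"
  proof
    assume "(LBINT x. (norm (u x))\<^sup>2) = 0"
    then have "AE x in lborel. ?f x = 0"
      unfolding nu using integral_nonneg_eq_0_iff_AE[OF L2_integrable_sq[OF test_function_L2[OF tf]]] by simp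
    then have "(LBINT x. ?f x) = 0" by (intro integral_eq_zero_AE)
    then show False using integral_bump_pos[of 1, where 'n = 'n] by simp
  qed
  moreover have "(LBINT x. (norm (u x))\<^sup>2) \<ge> 0" by simp
  ultimately show ?thesis using that[OF H] by linarith
qed

definition grad_sq :: "(real^'n::finite \<Rightarrow> 'v::euclidean_space) \<Rightarrow> real" where
  "grad_sq u = (LBINT x. (norm (weak_grad u x))\<^sup>2)"

definition mass :: "(real^'n::finite \<Rightarrow> 'v::euclidean_space) \<Rightarrow> real" where
  "mass u = (LBINT x. (norm (u x))\<^sup>2)"

text \<open>The critical mass is determined by the best constant in
  \<open>D\<^sub>2(u) \<le> K \<parallel>\<nabla>u\<parallel>\<^sup>2 \<parallel>u\<parallel>\<^sup>2\<close>, namely \<open>2 / K\<close>.\<close>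

definition critical_mass :: "(real^'n::finite \<Rightarrow> 'v::euclidean_space) itself \<Rightarrow> real" where
  "critical_mass _ = Inf ((\<lambda>u. 2 * grad_sq u * mass u / D_gamma 2 u) ` {u :: real^'n \<Rightarrow> 'v. u \<in> H1 \<and> mass u > 0})"

section \<open>Dimension at least three: the energy on both sides of the critical mass\<close>

context
  assumes N: "CARD('n::finite) \<ge> 3"
begin

lemma H1_D_gamma_pos:
  fixes u :: "real^'n \<Rightarrow> 'v::euclidean_space"
  assumes "u \<in> H1" "mass u > 0" "0 < \<gamma>" "\<gamma> \<le> 2"
  shows "D_gamma \<gamma> u > 0"
  using assms D_gamma_pos[OF Hardy_density_H1[OF components_weak_grad N]] by (simp add: mass_def)

text \<open>From D_2 <= 4 A |u|^2, with the 4 of Hardy's inequality. It bounds the quotients below,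
  so that their real infimum is a genuine lower bound, and a positive one.\<close>

lemma Hardy_quotient_ge:
  fixes u :: "real^'n \<Rightarrow> 'v::euclidean_space"
  assumes "u \<in> H1" "mass u > 0"
  shows "1/2 \<le> 2 * grad_sq u * mass u / D_gamma 2 u"
  using D_gamma_2_le[OF Hardy_density_H1[OF components_weak_grad[OF assms(1)] N]] H1_D_gamma_pos[OF assms, of 2]
  by (simp add: mass_def grad_sq_def field_simps)

lemma critical_mass_pos: "critical_mass TYPE(real^'n \<Rightarrow> 'v::euclidean_space) > 0"
proof -
  obtain u :: "real^'n \<Rightarrow> 'v" where "u \<in> H1" "mass u > 0" unfolding mass_def using H1_nontrivial by blast
  then have "1/2 \<le> critical_mass TYPE(real^'n \<Rightarrow> 'v)"
    unfolding critical_mass_def using Hardy_quotient_ge by (intro cInf_greatest) blast+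
  then show ?thesis by simp
qed

text \<open>The definition of the infimum gives this up to and including the critical mass, whether
  or not the best constant is attained.\<close>

lemma D_2_le_subcritical:
  fixes u :: "real^'n \<Rightarrow> 'v::euclidean_space"
  assumes "u \<in> H1" "mass u > 0" "mass u \<le> critical_mass TYPE(real^'n \<Rightarrow> 'v)"
  shows "D_gamma 2 u \<le> 2 * grad_sq u"
proof -
  have "critical_mass TYPE(real^'n \<Rightarrow> 'v) \<le> 2 * grad_sq u * mass u / D_gamma 2 u"
    unfolding critical_mass_def
  proof (rule cInf_lower)
    show "bdd_below ((\<lambda>u. 2 * grad_sq u * mass u / D_gamma 2 u) ` {u :: real^'n \<Rightarrow> 'v. u \<in> H1 \<and> mass u > 0})"
      by (rule bdd_belowI2) (use Hardy_quotient_ge in blast)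
  qed (use assms in blast)
  then have "mass u \<le> 2 * grad_sq u * mass u / D_gamma 2 u" using assms(3) by linarith
  then have "mass u * D_gamma 2 u \<le> mass u * (2 * grad_sq u)"
    using H1_D_gamma_pos[OF assms(1,2), of 2] by (simp add: field_simps)
  then show ?thesis using assms(2) by simp
qed

text \<open>The quotient is invariant under u -> s u, so the mass of u may differ from c;
  \<open>min_energy_le_scaled\<close> corrects it afterwards.\<close>

lemma supercritical_function:
  assumes "c > critical_mass TYPE(real^'n \<Rightarrow> 'v::euclidean_space)"
  obtains u :: "real^'n \<Rightarrow> 'v::euclidean_space" where "u \<in> H1" "mass u > 0" "2 * grad_sq u * mass u < c * D_gamma 2 u"
proof -
  obtain u0 :: "real^'n \<Rightarrow> 'v" where "u0 \<in> H1" "mass u0 > 0" unfolding mass_def using H1_nontrivial by blast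
  then have "\<exists>x \<in> (\<lambda>u. 2 * grad_sq u * mass u / D_gamma 2 u) ` {u :: real^'n \<Rightarrow> 'v. u \<in> H1 \<and> mass u > 0}. x < c"
    using assms unfolding critical_mass_def by (intro cInf_lessD) auto
  then obtain u :: "real^'n \<Rightarrow> 'v" where u: "u \<in> H1" "mass u > 0" "2 * grad_sq u * mass u / D_gamma 2 u < c" by auto
  then have "2 * grad_sq u * mass u < c * D_gamma 2 u"
    using H1_D_gamma_pos[OF u(1,2), of 2] by (simp add: field_simps)
  then show ?thesis using that u by blast
qed

text \<open>The energy along the dilation curve, after k has normalised the mass to c. Both the
  kinetic term and D_2 go with t^2, so one coefficient governs large t.\<close>

lemma min_energy_le_scaled:
  fixes u :: "real^'n \<Rightarrow> 'v::euclidean_space"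
  assumes u: "u \<in> H1" "mass u > 0" and c: "c > 0" and t: "t > 0"
  defines "k \<equiv> c / mass u"
  shows "min_energy TYPE(real^'n \<Rightarrow> 'v) 2 \<gamma>\<^sub>2 c
    \<le> ereal ((1/2 * k * grad_sq u - 1/4 * k\<^sup>2 * D_gamma 2 u) * t\<^sup>2 + 1/4 * k\<^sup>2 * D_gamma \<gamma>\<^sub>2 u * t powr \<gamma>\<^sub>2)"
proof -
  have k: "k > 0" using assms by simp
  obtain v :: "real^'n \<Rightarrow> 'v" where v: "v \<in> H1" "mass v = k * mass u" "grad_sq v = k * t\<^sup>2 * grad_sq u"
    "\<And>\<gamma>. D_gamma \<gamma> v = k\<^sup>2 * t powr \<gamma> * D_gamma \<gamma> u"
    by (rule scaling[OF u(1) t k, folded mass_def grad_sq_def]) (rule that)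
  have "mass v = c" using v(2) u(2) by (simp add: k_def)
  then have "v \<in> mass_sphere c" using v(1) by (simp add: mass_sphere_def mass_def)
  then have "min_energy TYPE(real^'n \<Rightarrow> 'v) 2 \<gamma>\<^sub>2 c \<le> ereal (energy 2 \<gamma>\<^sub>2 v)"
    unfolding min_energy_def by (rule INF_lower)
  also have "energy 2 \<gamma>\<^sub>2 v = (1/2 * k * grad_sq u - 1/4 * k\<^sup>2 * D_gamma 2 u) * t\<^sup>2 + 1/4 * k\<^sup>2 * D_gamma \<gamma>\<^sub>2 u * t powr \<gamma>\<^sub>2"
    using t unfolding energy_def grad_sq_def[symmetric] v by (simp add: algebra_simps)
  finally show ?thesis .
qed

lemma min_energy_subcritical:
  assumes c: "0 < c" "c \<le> critical_mass TYPE(real^'n \<Rightarrow> 'v::euclidean_space)" and \<gamma>: "0 < \<gamma>\<^sub>2" "\<gamma>\<^sub>2 < 2"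
  shows "min_energy TYPE(real^'n \<Rightarrow> 'v) 2 \<gamma>\<^sub>2 c = 0"
proof (rule antisym)
  show "0 \<le> min_energy TYPE(real^'n \<Rightarrow> 'v) 2 \<gamma>\<^sub>2 c"
    unfolding min_energy_def
  proof (rule INF_greatest)
    fix u :: "real^'n \<Rightarrow> 'v" assume "u \<in> mass_sphere c"
    then have u: "u \<in> H1" "mass u = c" by (auto simp: mass_sphere_def mass_def)
    then have "D_gamma 2 u \<le> 2 * grad_sq u" "D_gamma \<gamma>\<^sub>2 u > 0"
      using D_2_le_subcritical[of u] H1_D_gamma_pos[of u \<gamma>\<^sub>2] c \<gamma> by auto
    then show "0 \<le> ereal (energy 2 \<gamma>\<^sub>2 u)" by (simp add: energy_def grad_sq_def[symmetric])
  qed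
  \<comment> \<open>Any nontrivial u serves for the upper bound: both terms vanish as t tends to 0,
    whatever the sign of \<open>a\<close>.\<close>
  obtain u :: "real^'n \<Rightarrow> 'v" where u: "u \<in> H1" "mass u > 0" unfolding mass_def using H1_nontrivial by blast
  define a where "a = 1/2 * (c / mass u) * grad_sq u - 1/4 * (c / mass u)\<^sup>2 * D_gamma 2 u"
  define b where "b = 1/4 * (c / mass u)\<^sup>2 * D_gamma \<gamma>\<^sub>2 u"
  have le: "min_energy TYPE(real^'n \<Rightarrow> 'v) 2 \<gamma>\<^sub>2 c \<le> ereal (a * t\<^sup>2 + b * t powr \<gamma>\<^sub>2)" if "t > 0" for t
    unfolding a_def b_def by (rule min_energy_le_scaled[OF u c(1) that])
  have "((\<lambda>t. a * t\<^sup>2 + b * t powr \<gamma>\<^sub>2) \<longlongrightarrow> 0) (at_right 0)"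
    using \<gamma> by real_asymp
  then have "((\<lambda>t. ereal (a * t\<^sup>2 + b * t powr \<gamma>\<^sub>2)) \<longlongrightarrow> ereal 0) (at_right 0)" by (rule tendsto_ereal)
  then have "min_energy TYPE(real^'n \<Rightarrow> 'v) 2 \<gamma>\<^sub>2 c \<le> ereal 0"
    by (rule tendsto_lowerbound) (auto simp: eventually_at_filter le)
  then show "min_energy TYPE(real^'n \<Rightarrow> 'v) 2 \<gamma>\<^sub>2 c \<le> 0" by (simp add: zero_ereal_def)
qed

lemma min_energy_supercritical:
  assumes c: "c > critical_mass TYPE(real^'n \<Rightarrow> 'v::euclidean_space)" and \<gamma>: "0 < \<gamma>\<^sub>2" "\<gamma>\<^sub>2 < 2"
  shows "min_energy TYPE(real^'n \<Rightarrow> 'v) 2 \<gamma>\<^sub>2 c = - \<infinity>"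
proof -
  have c0: "c > 0" using c critical_mass_pos[where 'v = 'v] by linarith
  obtain u :: "real^'n \<Rightarrow> 'v" where u: "u \<in> H1" "mass u > 0" "2 * grad_sq u * mass u < c * D_gamma 2 u"
    using supercritical_function[OF c] by metis
  define a where "a = 1/2 * (c / mass u) * grad_sq u - 1/4 * (c / mass u)\<^sup>2 * D_gamma 2 u"
  define b where "b = 1/4 * (c / mass u)\<^sup>2 * D_gamma \<gamma>\<^sub>2 u"
  have le: "min_energy TYPE(real^'n \<Rightarrow> 'v) 2 \<gamma>\<^sub>2 c \<le> ereal (a * t\<^sup>2 + b * t powr \<gamma>\<^sub>2)" if "t > 0" for t
    unfolding a_def b_def by (rule min_energy_le_scaled[OF u(1,2) c0 that])
  \<comment> \<open>The factorisation shows that \<open>a\<close> has the sign of 2 A |u|^2 - c D_2,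
    negative by the choice of u.\<close>
  have "a = c / (4 * (mass u)\<^sup>2) * (2 * grad_sq u * mass u - c * D_gamma 2 u)"
    using u(2) by (simp add: a_def power2_eq_square field_simps)
  also have "\<dots> < 0" using u(2,3) c0 by (intro mult_pos_neg) auto
  finally have a: "a < 0" .
  have b: "b > 0" using H1_D_gamma_pos[OF u(1,2)] \<gamma> u(2) c0 by (simp add: b_def)
  have lim: "filterlim (\<lambda>t. a * t\<^sup>2 + b * t powr \<gamma>\<^sub>2) at_bot at_top"
    using a b \<gamma> by real_asymp
  show ?thesis
  proof (rule ereal_bot)
    fix B
    have "\<forall>\<^sub>F t in at_top. a * t\<^sup>2 + b * t powr \<gamma>\<^sub>2 \<le> B \<and> t > 0"
      using lim eventually_gt_at_top[of 0] by (intro eventually_conj) (auto simp: filterlim_at_bot)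
    then obtain t where "a * t\<^sup>2 + b * t powr \<gamma>\<^sub>2 \<le> B" "t > 0"
      using eventually_happens'[OF trivial_limit_at_top_linorder] by blast
    then show "min_energy TYPE(real^'n \<Rightarrow> 'v) 2 \<gamma>\<^sub>2 c \<le> ereal B"
      using le[of t] by (meson ereal_less_eq(3) order_trans)
  qed
qed

text \<open>For leading exponent 2 the Pohozaev identity says that D_2 - 2 A equals half of
  \<open>\<gamma>\<^sub>2 * D_gamma \<gamma>\<^sub>2 u\<close>, a positive number, at every mass up
  to and including the critical one.\<close>

lemma no_subcritical_solution:
  fixes u :: "real^'n \<Rightarrow> 'v::euclidean_space"
  assumes c: "0 < c" "c \<le> critical_mass TYPE(real^'n \<Rightarrow> 'v)" and \<gamma>: "0 < \<gamma>\<^sub>2" "\<gamma>\<^sub>2 < 2"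
    and u: "u \<in> mass_sphere c"
  shows "\<not> weak_solution 2 \<gamma>\<^sub>2 \<mu> u"
proof
  assume sol: "weak_solution 2 \<gamma>\<^sub>2 \<mu> u"
  have H: "u \<in> H1" "mass u = c" using u by (auto simp: mass_sphere_def mass_def)
  have "grad_sq u = 2 / 4 * D_gamma 2 u - \<gamma>\<^sub>2 / 4 * D_gamma \<gamma>\<^sub>2 u"
    unfolding grad_sq_def using \<gamma> by (intro Pohozaev_identity[OF sol N]) auto
  moreover have "D_gamma 2 u \<le> 2 * grad_sq u" using D_2_le_subcritical[of u] H c by auto
  moreover have "\<gamma>\<^sub>2 / 4 * D_gamma \<gamma>\<^sub>2 u > 0" using H1_D_gamma_pos[of u \<gamma>\<^sub>2] H c \<gamma> by simp
  ultimately show False by linarith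
qed

end

theorem theorem1p3:
  assumes "CARD('n::finite) \<ge> 3"
  shows "\<exists>c\<^sub>1::real. c\<^sub>1 > 0 \<and>
    (\<forall>\<gamma>\<^sub>1 \<gamma>\<^sub>2::real. 0 < \<gamma>\<^sub>2 \<and> \<gamma>\<^sub>2 < \<gamma>\<^sub>1 \<and> \<gamma>\<^sub>1 = 2 \<longrightarrow>
      (\<forall>c. 0 < c \<and> c \<le> c\<^sub>1 \<longrightarrow>
        min_energy TYPE(real ^ 'n \<Rightarrow> 'k::{real_normed_field, euclidean_space}) \<gamma>\<^sub>1 \<gamma>\<^sub>2 c = 0) \<and>
      (\<forall>c. c > c\<^sub>1 \<longrightarrow>
        min_energy TYPE(real ^ 'n \<Rightarrow> 'k) \<gamma>\<^sub>1 \<gamma>\<^sub>2 c = - \<infinity>) \<and>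
      (\<forall>c. 0 < c \<and> c \<le> c\<^sub>1 \<longrightarrow>
        \<not> (\<exists>(u :: real ^ 'n \<Rightarrow> 'k) \<mu>. u \<in> mass_sphere c \<and> weak_solution \<gamma>\<^sub>1 \<gamma>\<^sub>2 \<mu> u)))"
\<comment> \<open>The witness involves only the quotient with D_2, so it can be fixed before the
  second exponent is introduced.\<close>
proof (intro exI[of _ "critical_mass TYPE(real^'n \<Rightarrow> 'k)"] conjI allI impI; (elim conjE)?)
  show "critical_mass TYPE(real^'n \<Rightarrow> 'k) > 0" by (rule critical_mass_pos[OF assms])
qed (auto simp: min_energy_subcritical[OF assms] min_energy_supercritical[OF assms] dest: no_subcritical_solution[OF assms, rotated -1])

end
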